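(* Let $A$ be a local ring with residue field $k$. The following statements are equivalent: (1) $A$ is a regular local ring. (2) The cosyzygy module $\Omega_{-n}^A(k)$ has a non-zero finitely generated direct summand of finite projective dimension for some integer $n \ge 0$.
   Context: All rings are commutative Noetherian with identity. For a finitely generated $A$-module $M$ with augmented minimal injective resolution $0\to M\xrightarrow{d^{-1}}I^0\xrightarrow{d^0}I^1\xrightarrow{d^1}I^2\to\cdots$, the $n$th cosyzygy module of $M$ is $\Omega_{-n}^A(M):=\mathrm{Image}(d^{n-1})$ for $n\ge0$ (so $\Omega_0^A(M)\cong M$). *)

theory Defs
  imports "HOL-Algebra.Ring_Divisibility" "HOL-Library.Extended_Nat"
begin

section \<open>Regular local rings\<close>

locale noetherian_local_ring = noetherian_ring R + cring R for R (structure) +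
  assumes ex1_maximalideal: "\<exists>!m. maximalideal m R"

definition max_ideal :: "('a, 'r) ring_scheme \<Rightarrow> 'a set" where
  "max_ideal R = (THE m. maximalideal m R)"

definition krull_dim :: "('a, 'r) ring_scheme \<Rightarrow> enat" where
  "krull_dim R = Sup {enat n | n. \<exists>P :: nat \<Rightarrow> 'a set.
     (\<forall>i\<le>n. primeideal (P i) R) \<and> (\<forall>i<n. P i \<subset> P (Suc i))}"

definition regular_local_ring :: "('a, 'r) ring_scheme \<Rightarrow> bool" where
  "regular_local_ring R \<longleftrightarrow> noetherian_local_ring R \<and>
     (\<exists>S \<subseteq> carrier R. finite S \<and> genideal R S = max_ideal R \<and> enat (card S) = krull_dim R)"

text \<open>The residue field, with its structure of a module over the local ring.\<close>

definition residue_module :: "('a, 'r) ring_scheme \<Rightarrow> ('a, 'a set) module" where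
  "residue_module R = (let k = R Quot max_ideal R in
     ring.extend k (module.fields (\<lambda>a X. (max_ideal R +>\<^bsub>R\<^esub> a) \<otimes>\<^bsub>k\<^esub> X)))"


section \<open>Modules\<close>

text \<open>The ring multiplication and unit that a \<^typ>\<open>('a, 'b) module\<close> record carries play no
  role here. Linear maps are constrained on the carrier only.\<close>

definition mod_homs ::
  "('a, 'r) ring_scheme \<Rightarrow> ('a, 'b) module \<Rightarrow> ('a, 'c) module \<Rightarrow> ('b \<Rightarrow> 'c) set" where
  "mod_homs R M N = {f \<in> hom (add_monoid M) (add_monoid N).
     \<forall>a \<in> carrier R. \<forall>x \<in> carrier M. f (a \<odot>\<^bsub>M\<^esub> x) = a \<odot>\<^bsub>N\<^esub> f x}"

definition fin_gen_module :: "('a, 'r) ring_scheme \<Rightarrow> ('a, 'b) module \<Rightarrow> bool" where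
  "fin_gen_module R M \<longleftrightarrow> module R M \<and>
     (\<exists>S \<subseteq> carrier M. finite S \<and>
        carrier M = {finsum M (\<lambda>s. a s \<odot>\<^bsub>M\<^esub> s) S | a. a \<in> S \<rightarrow> carrier R})"

definition direct_summand ::
  "('a, 'r) ring_scheme \<Rightarrow> 'b set \<Rightarrow> ('a, 'b) module \<Rightarrow> bool" where
  "direct_summand R N M \<longleftrightarrow> submodule N R M \<and>
     (\<exists>L. submodule L R M \<and> N \<inter> L = {\<zero>\<^bsub>M\<^esub>} \<and> N <+>\<^bsub>M\<^esub> L = carrier M)"

definition essential_submodule ::
  "('a, 'r) ring_scheme \<Rightarrow> 'b set \<Rightarrow> ('a, 'b) module \<Rightarrow> bool" where
  "essential_submodule R N M \<longleftrightarrow> submodule N R M \<and>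
     (\<forall>L. submodule L R M \<longrightarrow> N \<inter> L = {\<zero>\<^bsub>M\<^esub>} \<longrightarrow> L = {\<zero>\<^bsub>M\<^esub>})"

text \<open>A definition cannot quantify over all types, so the test modules below, and the terms of a
  projective resolution, range over the modules carried by one type that is large enough.
  For a module over a ring on \<open>'a\<close> with elements of type \<open>'b\<close> take \<open>('a + 'b) list\<close>: its
  cardinality is the maximum of those of \<open>'a\<close>, \<open>'b\<close> and the natural numbers, so up to isomorphism
  it carries the ring, the module, the free module on the set of all elements of the module, every
  submodule of that free module, and so on for all further syzygies. Hence:

  \<^item> lifting against these test modules splits the surjection from that free module, so it is
    projectivity in the usual sense;
  \<^item> extension along these test monomorphisms includes the inclusions of ideals into the ring, so by
    Baer's criterion it is injectivity in the usual sense;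
  \<^item> every module has a free resolution by such modules, and, on replacing a kernel in it that is
    projective, one of length \<open>n\<close> whenever its projective dimension is at most \<open>n\<close>.\<close>

type_synonym ('a, 'b) ample = "('a + 'b) list"

definition projective_module :: "('a, 'r) ring_scheme \<Rightarrow> ('a, 'b) module \<Rightarrow> bool" where
  "projective_module R P \<longleftrightarrow> module R P \<and>
     (\<forall>(X :: ('a, ('a, 'b) ample) module) (Y :: ('a, ('a, 'b) ample) module) f g.
        module R X \<and> module R Y \<and>
        f \<in> mod_homs R X Y \<and> f ` carrier X = carrier Y \<and> g \<in> mod_homs R P Y \<longrightarrow>
        (\<exists>h \<in> mod_homs R P X. \<forall>x \<in> carrier P. f (h x) = g x))"

definition injective_module :: "('a, 'r) ring_scheme \<Rightarrow> ('a, 'b) module \<Rightarrow> bool" where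
  "injective_module R E \<longleftrightarrow> module R E \<and>
     (\<forall>(X :: ('a, ('a, 'b) ample) module) (Y :: ('a, ('a, 'b) ample) module) f g.
        module R X \<and> module R Y \<and>
        f \<in> mod_homs R X Y \<and> inj_on f (carrier X) \<and> g \<in> mod_homs R X E \<longrightarrow>
        (\<exists>h \<in> mod_homs R Y E. \<forall>x \<in> carrier X. h (f x) = g x))"


section \<open>Projective dimension\<close>

definition projective_resolution ::
  "('a, 'r) ring_scheme \<Rightarrow> ('a, 'b) module \<Rightarrow>
   ('c \<Rightarrow> 'b) \<Rightarrow> (nat \<Rightarrow> ('a, 'c) module) \<Rightarrow> (nat \<Rightarrow> 'c \<Rightarrow> 'c) \<Rightarrow> bool" where
  "projective_resolution R M \<epsilon> P \<delta> \<longleftrightarrow>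
     module R M \<and> (\<forall>i. projective_module R (P i)) \<and>
     \<epsilon> \<in> mod_homs R (P 0) M \<and> (\<forall>i. \<delta> i \<in> mod_homs R (P (Suc i)) (P i)) \<and>
     \<epsilon> ` carrier (P 0) = carrier M \<and>
     a_kernel (P 0) M \<epsilon> = \<delta> 0 ` carrier (P 1) \<and>
     (\<forall>i. a_kernel (P (Suc i)) (P i) (\<delta> i) = \<delta> (Suc i) ` carrier (P (Suc (Suc i))))"

text \<open>In \<^typ>\<open>enat\<close> the infimum of the empty set is \<open>\<infinity>\<close>.\<close>

definition proj_dim :: "('a, 'r) ring_scheme \<Rightarrow> ('a, 'b) module \<Rightarrow> enat" where
  "proj_dim R M = Inf {enat n | n. \<exists>\<epsilon> (P :: nat \<Rightarrow> ('a, ('a, 'b) ample) module) \<delta>.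
     projective_resolution R M \<epsilon> P \<delta> \<and> (\<forall>i>n. carrier (P i) = {\<zero>\<^bsub>P i\<^esub>})}"


section \<open>Minimal injective resolutions and cosyzygies\<close>

text \<open>In an augmented complex \<open>0 \<rightarrow> M \<rightarrow> I 0 \<rightarrow> I 1 \<rightarrow> \<dots>\<close> with augmentation \<open>e\<close> and differentials
  \<open>d n\<close> from \<open>I n\<close> to \<open>I (Suc n)\<close>, the \<open>n\<close>th cosyzygy is the image of the map into \<open>I n\<close>.\<close>

definition cosyzygy ::
  "('a, 'c) module \<Rightarrow> ('c \<Rightarrow> 'b) \<Rightarrow> (nat \<Rightarrow> ('a, 'b) module) \<Rightarrow> (nat \<Rightarrow> 'b \<Rightarrow> 'b) \<Rightarrow> nat \<Rightarrow>
   ('a, 'b) module" where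
  "cosyzygy M e I d n =
     (I n)\<lparr>carrier := (case n of 0 \<Rightarrow> e ` carrier M | Suc i \<Rightarrow> d i ` carrier (I i))\<rparr>"

text \<open>Minimality says that each \<open>I n\<close> is an injective hull of the \<open>n\<close>th cosyzygy.\<close>

definition minimal_injective_resolution ::
  "('a, 'r) ring_scheme \<Rightarrow> ('a, 'c) module \<Rightarrow>
   ('c \<Rightarrow> 'b) \<Rightarrow> (nat \<Rightarrow> ('a, 'b) module) \<Rightarrow> (nat \<Rightarrow> 'b \<Rightarrow> 'b) \<Rightarrow> bool" where
  "minimal_injective_resolution R M e I d \<longleftrightarrow>
     module R M \<and> (\<forall>n. injective_module R (I n)) \<and>
     e \<in> mod_homs R M (I 0) \<and> (\<forall>n. d n \<in> mod_homs R (I n) (I (Suc n))) \<and>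
     inj_on e (carrier M) \<and>
     (\<forall>n. a_kernel (I n) (I (Suc n)) (d n) = carrier (cosyzygy M e I d n)) \<and>
     (\<forall>n. essential_submodule R (carrier (cosyzygy M e I d n)) (I n))"

end

theory Submission
  imports Defs "HOL-Algebra.Ideal_Product"
begin

text \<open>A cosyzygy of positive index has no non-zero finitely generated summand \<open>S\<close> of finite projective
  dimension. If the maximal ideal \<open>\<mm>\<close> contains a regular element \<open>x\<close>, then the cosyzygy is
  \<open>x\<close>-divisible, being a quotient of an injective module, so \<open>S = xS\<close> and \<open>S = 0\<close> by Nakayama's lemma.
  If not, a non-zero element kills \<open>\<mm>\<close>, finitely generated modules of finite projective dimension are
  free, and \<open>S\<close> lifts to a submodule of the injective module that meets the preceding cosyzygy
  trivially, against minimality.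

  For index zero \<open>S\<close> is the residue field \<open>k\<close>, and the claim is Serre's theorem: \<open>A\<close> is regular
  iff \<open>k\<close> has finite projective dimension. Dividing by a regular element \<open>x \<in> \<mm> - \<mm>\<^sup>2\<close> keeps the
  projective dimension of \<open>k\<close> finite because \<open>k\<close> is a direct summand of \<open>\<mm>/x\<mm>\<close>, so by Noetherian
  induction \<open>\<mm>\<close> is generated by a regular sequence, whose length is the dimension of \<open>A\<close> by Krull's
  principal ideal theorem. Conversely the generators of the maximal ideal of a regular local ring form
  a regular sequence, and their Koszul complex resolves \<open>k\<close>.\<close>

section \<open>Noetherian induction and Nakayama's lemma\<close>

text \<open>Two obstacles shape the proof. Projectivity and projective dimension are defined through
  modules on one type, fixed by the ring and the module, so finite projective dimension does not
  pass readily between modules on different types, nor through functors such as Ext and Tor. It is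
  exchanged for \<open>finite_minimal_resolution\<close>, whose modules all consist of functions
  from the natural numbers to the ring, and is transferred between modules by stable retracts, which
  survive the passage to syzygies. Serre's theorem then speaks of \<open>\<mm>\<close>, the first
  syzygy of \<open>k\<close>, rather than of \<open>k\<close>. Secondly, localisation would change
  the ring and its type. In Krull's theorem it is replaced by submodules of the original module that
  are saturated at a prime. Associated primes and prime avoidance are replaced by adding to one
  element a suitable power of another, which also provides the regular element outside
  \<open>\<mm>\<^sup>2\<close>.\<close>

lemma (in noetherian_ring) maximal_ideal_in_family:
  assumes "\<F> \<noteq> {}" and "\<And>I. I \<in> \<F> \<Longrightarrow> ideal I R"
  obtains M where "M \<in> \<F>" and "\<And>J. J \<in> \<F> \<Longrightarrow> M \<subseteq> J \<Longrightarrow> J = M"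
proof -
  have "\<exists>M\<in>\<F>. \<forall>X\<in>\<F>. M \<subseteq> X \<longrightarrow> X = M"
  proof (rule subset_Zorn)
    fix C assume C: "subset.chain \<F> C"
    show "\<exists>U\<in>\<F>. \<forall>X\<in>C. X \<subseteq> U"
    proof (cases "C = {}")
      case True then show ?thesis using assms(1) by auto
    next
      case False
      have "subset.chain {I. ideal I R} C"
        using C assms(2) unfolding pred_on.chain_def by auto
      \<comment> \<open>A non-empty chain of ideals in a Noetherian ring contains its own union, so
        Zorn's lemma asks for no closure property of the family.\<close>
      then have "\<Union>C \<in> C" using ideal_chain_is_trivial False by blast
      then show ?thesis using C unfolding pred_on.chain_def by auto
    qed
  qed
  then show thesis using that by blast
qed

lemma (in noetherian_ring) ideal_induct [consumes 1, case_names step]: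
  assumes I: "ideal I R"
    and step: "\<And>I. ideal I R \<Longrightarrow> (\<And>J. ideal J R \<Longrightarrow> I \<subset> J \<Longrightarrow> P J) \<Longrightarrow> P I"
  shows "P I"
proof (rule ccontr)
  assume "\<not> P I"
  then have ne: "{J. ideal J R \<and> \<not> P J} \<noteq> {}" using I by auto
  obtain M where M: "M \<in> {J. ideal J R \<and> \<not> P J}"
    "\<And>J. J \<in> {J. ideal J R \<and> \<not> P J} \<Longrightarrow> M \<subseteq> J \<Longrightarrow> J = M"
    by (rule maximal_ideal_in_family[OF ne]) auto
  have "P M" by (rule step) (use M in blast)+
  then show False using M(1) by simp
qed

section \<open>Submodules saturated at a prime, in place of localisation\<close>

lemma (in abelian_group) add_minus_cancel:
  assumes "x \<in> carrier G" "y \<in> carrier G"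
  shows "(x \<oplus> y) \<ominus> y = x" and "(x \<ominus> y) \<oplus> y = x"
  using assms by (simp_all add: a_minus_def a_assoc r_neg l_neg)

text \<open>For a prime \<open>N\<close> the saturated submodules are the contractions of the
  submodules of the localisation at \<open>N\<close>. Working with them inside \<open>M\<close>
  spares the construction of the localised ring and module.\<close>

definition saturated :: "('a, 'r) ring_scheme \<Rightarrow> 'a set \<Rightarrow> ('a, 'b, 'm) module_scheme \<Rightarrow> 'b set \<Rightarrow> bool" where
  "saturated R N M H \<longleftrightarrow> (\<forall>s \<in> carrier R - N. \<forall>x \<in> carrier M. s \<odot>\<^bsub>M\<^esub> x \<in> H \<longrightarrow> x \<in> H)"

lemma (in module) submoduleE':
  assumes "submodule H R M"
  shows "H \<subseteq> carrier M" and "\<zero>\<^bsub>M\<^esub> \<in> H"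
    and "\<And>a x. a \<in> carrier R \<Longrightarrow> x \<in> H \<Longrightarrow> a \<odot>\<^bsub>M\<^esub> x \<in> H"
    and "\<And>x y. x \<in> H \<Longrightarrow> y \<in> H \<Longrightarrow> x \<oplus>\<^bsub>M\<^esub> y \<in> H"
    and "\<And>x. x \<in> H \<Longrightarrow> \<ominus>\<^bsub>M\<^esub> x \<in> H"
    and "\<And>x y. x \<in> H \<Longrightarrow> y \<in> H \<Longrightarrow> x \<ominus>\<^bsub>M\<^esub> y \<in> H"
  using submoduleE[OF assms] subgroup.one_closed[OF submodule.axioms(1)[OF assms]]
  by (auto simp: a_minus_def)

lemma (in module) submoduleI':
  assumes "H \<subseteq> carrier M" and "\<zero>\<^bsub>M\<^esub> \<in> H"
    and "\<And>x y. x \<in> H \<Longrightarrow> y \<in> H \<Longrightarrow> x \<oplus>\<^bsub>M\<^esub> y \<in> H"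
    and "\<And>a x. a \<in> carrier R \<Longrightarrow> x \<in> H \<Longrightarrow> a \<odot>\<^bsub>M\<^esub> x \<in> H"
  shows "submodule H R M"
proof (rule submoduleI)
  fix x assume x: "x \<in> H"
  have "\<ominus>\<^bsub>M\<^esub> x = (\<ominus> \<one>) \<odot>\<^bsub>M\<^esub> x" using x assms(1) by (simp add: smult_l_minus subsetD)
  then show "\<ominus>\<^bsub>M\<^esub> x \<in> H" using assms(4)[of "\<ominus> \<one>" x] x by simp
qed (use assms in auto)

lemma (in module) smult_l_minus':
  assumes "a \<in> carrier R" "b \<in> carrier R" "x \<in> carrier M"
  shows "(a \<ominus> b) \<odot>\<^bsub>M\<^esub> x = a \<odot>\<^bsub>M\<^esub> x \<ominus>\<^bsub>M\<^esub> b \<odot>\<^bsub>M\<^esub> x"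
  using assms by (simp add: a_minus_def smult_l_distr smult_l_minus)

lemma (in primeideal) prime_mult_closed:
  assumes "s \<in> carrier R - I" "t \<in> carrier R - I"
  shows "s \<otimes> t \<in> carrier R - I"
  using assms I_prime by auto

lemma (in primeideal) prime_one: "\<one> \<in> carrier R - I"
  using I_notcarr one_imp_carrier by blast

text \<open>\<open>L\<close> is the contraction of \<open>H + Ct\<close> from the localisation at
  \<open>N\<close>, with the denominator \<open>s\<close> made explicit. The choice
  \<open>C = R\<close> adjoins \<open>t\<close> to \<open>H\<close>, and \<open>C = N\<close>
  adjoins only \<open>Nt\<close>.\<close>

lemma (in module) saturation_submodule:
  assumes N: "primeideal N R" and H: "submodule H R M" and C: "ideal C R" and t: "t \<in> carrier M"
  defines "L \<equiv> {y \<in> carrier M. \<exists>s \<in> carrier R - N. \<exists>h \<in> H. \<exists>c \<in> C. s \<odot>\<^bsub>M\<^esub> y = h \<oplus>\<^bsub>M\<^esub> c \<odot>\<^bsub>M\<^esub> t}"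
  shows "submodule L R M" and "saturated R N M L" and "H \<subseteq> L"
    and "\<And>c. c \<in> C \<Longrightarrow> c \<odot>\<^bsub>M\<^esub> t \<in> L"
proof -
  interpret N: primeideal N R by fact
  interpret C: ideal C R by fact
  note H' = submoduleE'[OF H]
  have HM: "h \<in> H \<Longrightarrow> h \<in> carrier M" for h using H'(1) by blast
  show "H \<subseteq> L"
  proof
    fix h assume h: "h \<in> H"
    have "\<one> \<odot>\<^bsub>M\<^esub> h = h \<oplus>\<^bsub>M\<^esub> \<zero> \<odot>\<^bsub>M\<^esub> t" using h HM t by simp
    then show "h \<in> L" unfolding L_def using h HM N.prime_one C.zero_closed by blast
  qed
  show "c \<odot>\<^bsub>M\<^esub> t \<in> L" if c: "c \<in> C" for c
  proof -
    have "\<one> \<odot>\<^bsub>M\<^esub> (c \<odot>\<^bsub>M\<^esub> t) = \<zero>\<^bsub>M\<^esub> \<oplus>\<^bsub>M\<^esub> c \<odot>\<^bsub>M\<^esub> t" using c t C.Icarr by simp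
    then show ?thesis unfolding L_def using c t N.prime_one C.Icarr H'(2) by blast
  qed
  show "saturated R N M L"
    unfolding saturated_def
  proof (intro ballI impI)
    fix s x assume s: "s \<in> carrier R - N" and x: "x \<in> carrier M" and "s \<odot>\<^bsub>M\<^esub> x \<in> L"
    then obtain u h c where u: "u \<in> carrier R - N" "h \<in> H" "c \<in> C"
      "u \<odot>\<^bsub>M\<^esub> (s \<odot>\<^bsub>M\<^esub> x) = h \<oplus>\<^bsub>M\<^esub> c \<odot>\<^bsub>M\<^esub> t" unfolding L_def by blast
    have "(u \<otimes> s) \<odot>\<^bsub>M\<^esub> x = h \<oplus>\<^bsub>M\<^esub> c \<odot>\<^bsub>M\<^esub> t" using u s x by (simp add: smult_assoc1)
    then show "x \<in> L" unfolding L_def using N.prime_mult_closed[OF u(1) s] u x by blast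
  qed
  show "submodule L R M"
  proof (rule submoduleI')
    show "L \<subseteq> carrier M" unfolding L_def by auto
    show "\<zero>\<^bsub>M\<^esub> \<in> L" using \<open>H \<subseteq> L\<close> H'(2) by auto
    fix x y assume "x \<in> L" "y \<in> L"
    then obtain s1 h1 c1 s2 h2 c2 where *: "x \<in> carrier M" "y \<in> carrier M"
      "s1 \<in> carrier R - N" "h1 \<in> H" "c1 \<in> C" "s1 \<odot>\<^bsub>M\<^esub> x = h1 \<oplus>\<^bsub>M\<^esub> c1 \<odot>\<^bsub>M\<^esub> t"
      "s2 \<in> carrier R - N" "h2 \<in> H" "c2 \<in> C" "s2 \<odot>\<^bsub>M\<^esub> y = h2 \<oplus>\<^bsub>M\<^esub> c2 \<odot>\<^bsub>M\<^esub> t"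
      unfolding L_def by blast
    have "(s1 \<otimes> s2) \<odot>\<^bsub>M\<^esub> (x \<oplus>\<^bsub>M\<^esub> y) = s2 \<odot>\<^bsub>M\<^esub> (s1 \<odot>\<^bsub>M\<^esub> x) \<oplus>\<^bsub>M\<^esub> s1 \<odot>\<^bsub>M\<^esub> (s2 \<odot>\<^bsub>M\<^esub> y)"
      using *(1-3,7) by (simp add: smult_r_distr smult_assoc1[symmetric] R.m_comm)
    also have "\<dots> = (s2 \<odot>\<^bsub>M\<^esub> h1 \<oplus>\<^bsub>M\<^esub> s1 \<odot>\<^bsub>M\<^esub> h2) \<oplus>\<^bsub>M\<^esub> (s2 \<otimes> c1 \<oplus> s1 \<otimes> c2) \<odot>\<^bsub>M\<^esub> t"
      using * HM C.Icarr t by (simp add: smult_r_distr smult_l_distr smult_assoc1 M.a_ac)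
    finally have "(s1 \<otimes> s2) \<odot>\<^bsub>M\<^esub> (x \<oplus>\<^bsub>M\<^esub> y) =
      (s2 \<odot>\<^bsub>M\<^esub> h1 \<oplus>\<^bsub>M\<^esub> s1 \<odot>\<^bsub>M\<^esub> h2) \<oplus>\<^bsub>M\<^esub> (s2 \<otimes> c1 \<oplus> s1 \<otimes> c2) \<odot>\<^bsub>M\<^esub> t" .
    moreover have "s2 \<odot>\<^bsub>M\<^esub> h1 \<oplus>\<^bsub>M\<^esub> s1 \<odot>\<^bsub>M\<^esub> h2 \<in> H" using H'(3,4) * by simp
    moreover have "s2 \<otimes> c1 \<oplus> s1 \<otimes> c2 \<in> C" using * C.I_l_closed by simp
    ultimately show "x \<oplus>\<^bsub>M\<^esub> y \<in> L"
      unfolding L_def using N.prime_mult_closed[OF *(3,7)] *(1,2) by blast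
  next
    fix a x assume a: "a \<in> carrier R" and "x \<in> L"
    then obtain s h c where *: "x \<in> carrier M" "s \<in> carrier R - N" "h \<in> H" "c \<in> C"
       "s \<odot>\<^bsub>M\<^esub> x = h \<oplus>\<^bsub>M\<^esub> c \<odot>\<^bsub>M\<^esub> t" unfolding L_def by blast
    have "s \<odot>\<^bsub>M\<^esub> (a \<odot>\<^bsub>M\<^esub> x) = a \<odot>\<^bsub>M\<^esub> (s \<odot>\<^bsub>M\<^esub> x)"
      using *(1,2) a by (simp add: smult_assoc1[symmetric] R.m_comm)
    also have "\<dots> = a \<odot>\<^bsub>M\<^esub> h \<oplus>\<^bsub>M\<^esub> (a \<otimes> c) \<odot>\<^bsub>M\<^esub> t"
      using * a t HM C.Icarr by (simp add: smult_assoc1 smult_r_distr)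
    finally show "a \<odot>\<^bsub>M\<^esub> x \<in> L" unfolding L_def
      using * a H'(3) C.I_l_closed by blast
  qed
qed

text \<open>The last hypothesis says that \<open>T \<subseteq> H + NT\<close> after localisation at \<open>N\<close>, with \<open>H + NT\<close>
  replaced by the saturated submodules that contain it.\<close>

lemma (in module) nakayama:
  assumes N: "primeideal N R"
    and "finite T" "T \<subseteq> carrier M" "submodule H R M" "saturated R N M H"
    and "\<And>t L. t \<in> T \<Longrightarrow> submodule L R M \<Longrightarrow> saturated R N M L \<Longrightarrow> H \<subseteq> L \<Longrightarrow>
        (\<And>a u. a \<in> N \<Longrightarrow> u \<in> T \<Longrightarrow> a \<odot>\<^bsub>M\<^esub> u \<in> L) \<Longrightarrow> t \<in> L"
  shows "T \<subseteq> H"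
  using assms(2-)
proof (induction T arbitrary: H rule: finite_induct)
  case empty then show ?case by simp
next
  case (insert t0 T)
  interpret N: primeideal N R by fact
  have t0: "t0 \<in> carrier M" and T: "T \<subseteq> carrier M" using insert.prems by auto
  note H' = submoduleE'[OF insert.prems(2)]
  \<comment> \<open>Modulo \<open>t0\<close> the induction hypothesis applies, with
    \<open>H1\<close> in place of \<open>H\<close>. It puts the other generators into
    \<open>H1\<close>, the contraction of \<open>H + R t0\<close>.\<close>
  define H1 where "H1 = {y \<in> carrier M. \<exists>s \<in> carrier R - N. \<exists>h \<in> H. \<exists>c \<in> carrier R. s \<odot>\<^bsub>M\<^esub> y = h \<oplus>\<^bsub>M\<^esub> c \<odot>\<^bsub>M\<^esub> t0}"
  note H1 = saturation_submodule[OF N insert.prems(2) R.oneideal t0, folded H1_def]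
  have t0H1: "\<And>c. c \<in> carrier R \<Longrightarrow> c \<odot>\<^bsub>M\<^esub> t0 \<in> H1" by (rule H1(4))
  have TH1: "T \<subseteq> H1"
  proof (rule insert.IH[OF T H1(1,2)])
    fix t L assume *: "t \<in> T" "submodule L R M" "saturated R N M L" "H1 \<subseteq> L"
      "\<And>a u. a \<in> N \<Longrightarrow> u \<in> T \<Longrightarrow> a \<odot>\<^bsub>M\<^esub> u \<in> L"
    show "t \<in> L"
    proof (rule insert.prems(4)[OF _ *(2,3)])
      show "t \<in> insert t0 T" using * by simp
      show "H \<subseteq> L" using * H1(3) by simp
      fix a u assume "a \<in> N" "u \<in> insert t0 T"
      then show "a \<odot>\<^bsub>M\<^esub> u \<in> L" using * t0H1 N.Icarr by blast
    qed
  qed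
  \<comment> \<open>\<open>L\<close> contains \<open>H\<close> and \<open>N t0\<close>, and also
    \<open>Nu\<close> for the other generators \<open>u\<close>, because these lie in
    \<open>H1\<close>. The hypothesis then yields \<open>t0 \<in> L\<close>, an equation
    \<open>s t0 = h + c t0\<close> with \<open>c\<close> in \<open>N\<close>.\<close>
  define L where "L = {y \<in> carrier M. \<exists>s \<in> carrier R - N. \<exists>h \<in> H. \<exists>c \<in> N. s \<odot>\<^bsub>M\<^esub> y = h \<oplus>\<^bsub>M\<^esub> c \<odot>\<^bsub>M\<^esub> t0}"
  note L = saturation_submodule[OF N insert.prems(2) N.is_ideal t0, folded L_def]
  have "t0 \<in> L"
  proof (rule insert.prems(4)[OF _ L(1-3)])
    fix a u assume a: "a \<in> N" and u: "u \<in> insert t0 T"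
    show "a \<odot>\<^bsub>M\<^esub> u \<in> L"
    proof (cases "u = t0")
      case True then show ?thesis using L(4) a by simp
    next
      case False
      then have "u \<in> H1" using u TH1 by auto
      then obtain s h c where *: "u \<in> carrier M" "s \<in> carrier R - N" "h \<in> H" "c \<in> carrier R"
        "s \<odot>\<^bsub>M\<^esub> u = h \<oplus>\<^bsub>M\<^esub> c \<odot>\<^bsub>M\<^esub> t0" unfolding H1_def by blast
      have hM: "h \<in> carrier M" using * H'(1) by blast
      have "s \<odot>\<^bsub>M\<^esub> (a \<odot>\<^bsub>M\<^esub> u) = a \<odot>\<^bsub>M\<^esub> (s \<odot>\<^bsub>M\<^esub> u)"
        using *(1,2) N.Icarr[OF a] by (simp add: smult_assoc1[symmetric] R.m_comm)
      also have "\<dots> = a \<odot>\<^bsub>M\<^esub> h \<oplus>\<^bsub>M\<^esub> (a \<otimes> c) \<odot>\<^bsub>M\<^esub> t0"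
        using * N.Icarr[OF a] t0 hM by (simp add: smult_assoc1 smult_r_distr)
      finally have "s \<odot>\<^bsub>M\<^esub> (a \<odot>\<^bsub>M\<^esub> u) = a \<odot>\<^bsub>M\<^esub> h \<oplus>\<^bsub>M\<^esub> (a \<otimes> c) \<odot>\<^bsub>M\<^esub> t0" .
      then show ?thesis unfolding L_def using * N.Icarr[OF a] H'(3) N.I_r_closed[OF a] by blast
    qed
  qed simp
  then obtain s h c where *: "s \<in> carrier R - N" "h \<in> H" "c \<in> N"
        "s \<odot>\<^bsub>M\<^esub> t0 = h \<oplus>\<^bsub>M\<^esub> c \<odot>\<^bsub>M\<^esub> t0" unfolding L_def by blast
  have hM: "h \<in> carrier M" using * H'(1) by blast
  have "(s \<ominus> c) \<odot>\<^bsub>M\<^esub> t0 = h"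
    using * N.Icarr t0 hM by (simp add: smult_l_minus' M.add_minus_cancel)
  \<comment> \<open>Subtracting an element of \<open>N\<close> keeps \<open>s\<close> outside
    \<open>N\<close>, so saturation allows \<open>s - c\<close> to be cancelled.\<close>
  moreover have "s \<ominus> c \<in> carrier R - N"
  proof -
    have "s = (s \<ominus> c) \<oplus> c" using * N.Icarr by (simp add: a_minus_def R.a_assoc R.l_neg)
    then have "s \<ominus> c \<notin> N" using * N.a_closed by (metis DiffD2)
    then show ?thesis using * N.Icarr by simp
  qed
  ultimately have t0H: "t0 \<in> H" using insert.prems(3) *(2) t0 unfolding saturated_def by blast
  have "H1 \<subseteq> H"
  proof
    fix y assume "y \<in> H1"
    then obtain s h c where *: "y \<in> carrier M" "s \<in> carrier R - N" "h \<in> H" "c \<in> carrier R"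
        "s \<odot>\<^bsub>M\<^esub> y = h \<oplus>\<^bsub>M\<^esub> c \<odot>\<^bsub>M\<^esub> t0" unfolding H1_def by blast
    then have "s \<odot>\<^bsub>M\<^esub> y \<in> H" using H'(3,4) t0H by simp
    then show "y \<in> H" using insert.prems(3) * unfolding saturated_def by blast
  qed
  then show ?case using t0H TH1 by auto
qed

section \<open>Krull's principal ideal theorem\<close>

lemma (in cring) idealI':
  assumes "I \<subseteq> carrier R" and "\<zero> \<in> I"
    and "\<And>x y. x \<in> I \<Longrightarrow> y \<in> I \<Longrightarrow> x \<oplus> y \<in> I"
    and "\<And>a x. a \<in> carrier R \<Longrightarrow> x \<in> I \<Longrightarrow> a \<otimes> x \<in> I"
  shows "ideal I R"
proof (rule idealI)
  show "ring R" by (rule ring_axioms)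
  show "subgroup I (add_monoid R)"
  proof (rule add.subgroupI)
    show "I \<noteq> {}" using assms(2) by auto
    fix x assume x: "x \<in> I"
    have "\<ominus> x = (\<ominus> \<one>) \<otimes> x" using x assms(1) by (simp add: l_minus subsetD)
    then show "\<ominus> x \<in> I" using assms(4)[of "\<ominus> \<one>" x] x by simp
  qed (use assms in auto)
  fix a x assume "a \<in> I" "x \<in> carrier R"
  then show "x \<otimes> a \<in> I" "a \<otimes> x \<in> I" using assms m_comm[of a x] by auto
qed

lemma (in ideal) ideal_closed:
  shows "\<zero> \<in> I"
    and "\<And>a x. a \<in> carrier R \<Longrightarrow> x \<in> I \<Longrightarrow> a \<otimes> x \<in> I"
    and "\<And>x y. x \<in> I \<Longrightarrow> y \<in> I \<Longrightarrow> x \<oplus> y \<in> I"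
    and "\<And>x. x \<in> I \<Longrightarrow> \<ominus> x \<in> I"
    and "\<And>x y. x \<in> I \<Longrightarrow> y \<in> I \<Longrightarrow> x \<ominus> y \<in> I"
  by (auto simp: I_l_closed a_minus_def)

text \<open>The ring as a module over itself: its submodules are the ideals, so the results on
  saturation and Nakayama's lemma apply to ideals.\<close>

definition regular_module :: "('a, 'r) ring_scheme \<Rightarrow> ('a, 'a) module" where
  "regular_module R = \<lparr>carrier = carrier R, mult = mult R, one = one R, zero = zero R, add = add R,
     smult = mult R\<rparr>"

lemma regular_module_simps [simp]:
  "carrier (regular_module R) = carrier R" "zero (regular_module R) = zero R"
  "add (regular_module R) = add R" "smult (regular_module R) = mult R"
  by (simp_all add: regular_module_def)

lemma (in cring) regular_module_module: "module R (regular_module R)"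
proof (rule moduleI)
  show "abelian_group (regular_module R)"
    by (rule abelian_groupI) (auto simp: a_ac intro: l_neg)
qed (auto simp: cring_axioms l_distr r_distr m_assoc)

lemma (in cring) submodule_regular_iff: "submodule I R (regular_module R) \<longleftrightarrow> ideal I R"
proof
  interpret M: module R "regular_module R" by (rule regular_module_module)
  show "ideal I R" if "submodule I R (regular_module R)"
    using M.submoduleE'[OF that] by (intro idealI') auto
  show "submodule I R (regular_module R)" if "ideal I R"
  proof -
    interpret ideal I R by fact
    show ?thesis using ideal_closed Icarr by (intro M.submoduleI') auto
  qed
qed

locale noetherian_cring = noetherian_ring R + cring R for R (structure)

sublocale noetherian_local_ring \<subseteq> noetherian_cring ..

lemma (in cring) saturation_ideal:
  assumes N: "primeideal N R" and H: "ideal H R" and t: "t \<in> carrier R"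
  defines "L \<equiv> {y \<in> carrier R. \<exists>s \<in> carrier R - N. \<exists>h \<in> H. \<exists>c \<in> carrier R. s \<otimes> y = h \<oplus> c \<otimes> t}"
  shows "ideal L R" and "saturated R N (regular_module R) L" and "H \<subseteq> L" and "t \<in> L"
proof -
  interpret M: module R "regular_module R" by (rule regular_module_module)
  note * = M.saturation_submodule[OF N H[folded submodule_regular_iff] oneideal, of t, simplified,
      folded L_def, OF t]
  show "ideal L R" using *(1) by (simp add: submodule_regular_iff)
  show "saturated R N (regular_module R) L" "H \<subseteq> L" by (rule *)+
  show "t \<in> L" unfolding L_def using *(4)[OF one_closed] t by simp
qed

context noetherian_cring
begin

text \<open>The hypothesis on primes says that the localisation of \<open>R/C\<close> at \<open>N\<close> has a single prime
  ideal, and the conclusion that it is Artinian.\<close>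

lemma saturated_descending_chain:
  assumes N: "primeideal N R"
  shows "ideal C R \<Longrightarrow> saturated R N (regular_module R) C \<Longrightarrow>
    (\<And>Q. primeideal Q R \<Longrightarrow> C \<subseteq> Q \<Longrightarrow> Q \<subseteq> N \<Longrightarrow> Q = N) \<Longrightarrow>
    (\<And>n. ideal (V n) R) \<Longrightarrow> (\<And>n. saturated R N (regular_module R) (V n)) \<Longrightarrow> (\<And>n. C \<subseteq> V n) \<Longrightarrow>
    (\<And>n :: nat. V (Suc n) \<subseteq> V n) \<Longrightarrow> \<exists>n0. \<forall>n\<ge>n0. V n = V n0"
proof (induction C arbitrary: V rule: ideal_induct)
  case (step C)
  interpret N: primeideal N R by fact
  interpret C: ideal C R by (rule step(1))
  have dec: "V n \<subseteq> V m" if "m \<le> n" for m n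
    by (rule lift_Suc_antimono_le[of V, OF step(8) that])
  have sat: "x \<in> V n" if "s \<in> carrier R - N" "x \<in> carrier R" "s \<otimes> x \<in> V n" for s x n
    using step(6)[of n] that by (auto simp: saturated_def)
  \<comment> \<open>An element of \<open>V n\<close> outside \<open>N\<close> is a unit after
    localisation, so saturation brings \<open>\<one>\<close> into \<open>V n\<close>.\<close>
  have whole: "V n = carrier R" if n: "\<not> V n \<subseteq> N" for n
  proof -
    interpret V: ideal "V n" R by (rule step(5))
    obtain s where s: "s \<in> V n" "s \<notin> N" using n by auto
    then have "\<one> \<in> V n" using sat[of s \<one>] V.Icarr by simp
    then show ?thesis by (rule V.one_imp_carrier)
  qed
  show ?case
  proof (cases "C \<subseteq> N")
    case False
    then have "V n = carrier R" for n using whole[of n] step(7)[of n] by auto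
    then show ?thesis by auto
  next
    case CN: True
    show ?thesis
    proof (cases "primeideal C R")
      case True
      then have CN': "C = N" using step(4) CN by auto
      show ?thesis
      proof (cases "\<exists>n0. V n0 \<subseteq> N")
        case True
        then obtain n0 where "V n0 \<subseteq> N" by auto
        then have "V n = N" if "n \<ge> n0" for n using dec[OF that] step(7)[of n] CN' by auto
        then show ?thesis by (metis order_refl)
      next
        case False then show ?thesis using whole by auto
      qed
    next
      case False
      have "carrier R \<noteq> C" using CN N.prime_one by blast
      then obtain a b where ab: "a \<in> carrier R" "b \<in> carrier R" "a \<otimes> b \<in> C" "a \<notin> C" "b \<notin> C"
        using C.primeidealCD[OF cring_axioms False] by auto
      \<comment> \<open>With \<open>ab\<close> in \<open>C\<close> and \<open>a\<close>,
        \<open>b\<close> outside \<open>C\<close>, both \<open>T C = (C : a)\<close> and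
        \<open>S C\<close>, the contraction of \<open>C + aR\<close>, are strictly larger than
        \<open>C\<close>, since they contain \<open>b\<close> and \<open>a\<close>. The chain is
        recovered from its images under \<open>T\<close> and \<open>S\<close>, to which the
        induction hypothesis applies.\<close>
      define S where "S J = {y \<in> carrier R. \<exists>s \<in> carrier R - N. \<exists>h \<in> J. \<exists>c \<in> carrier R. s \<otimes> y = h \<oplus> c \<otimes> a}" for J
      note S = saturation_ideal[OF N _ ab(1), folded S_def]
      define T where "T J = {y \<in> carrier R. a \<otimes> y \<in> J}" for J
      have T_ideal: "ideal (T J) R" if "ideal J R" for J
        unfolding T_def by (rule ideal.helper_max_prime[OF that cring_axioms ab(1)])
      have T_sat: "saturated R N (regular_module R) (T J)"
        if "saturated R N (regular_module R) J" for J
        using that ab(1) unfolding T_def saturated_def by (auto simp: m_lcomm)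
      have T_sub: "J \<subseteq> T J" if "ideal J R" for J
      proof -
        interpret J: ideal J R by fact
        show ?thesis unfolding T_def using J.Icarr J.I_l_closed ab(1) by auto
      qed
      have "\<exists>n0. \<forall>n\<ge>n0. T (V n) = T (V n0)"
      proof (rule step(2)[of "T C"])
        show "ideal (T C) R" by (rule T_ideal[OF step(1)])
        show "C \<subset> T C" using T_sub[OF step(1)] ab unfolding T_def by auto
        show "saturated R N (regular_module R) (T C)" by (rule T_sat[OF step(3)])
        show "Q = N" if "primeideal Q R" "T C \<subseteq> Q" "Q \<subseteq> N" for Q
          using step(4)[OF that(1)] T_sub[OF step(1)] that by auto
        show "ideal (T (V n)) R" "saturated R N (regular_module R) (T (V n))" for n
          by (rule T_ideal[OF step(5)] T_sat[OF step(6)])+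
        show "T C \<subseteq> T (V n)" for n using step(7)[of n] unfolding T_def by auto
        show "T (V (Suc n)) \<subseteq> T (V n)" for n using step(8)[of n] unfolding T_def by auto
      qed
      then obtain n1 where n1: "\<And>n. n \<ge> n1 \<Longrightarrow> T (V n) = T (V n1)" by auto
      have "\<exists>n0. \<forall>n\<ge>n0. S (V n) = S (V n0)"
      proof (rule step(2)[of "S C"])
        show "ideal (S C) R" by (rule S[OF step(1)])
        show "C \<subset> S C" using S[OF step(1)] ab by auto
        show "saturated R N (regular_module R) (S C)" by (rule S[OF step(1)])
        show "Q = N" if "primeideal Q R" "S C \<subseteq> Q" "Q \<subseteq> N" for Q
          using step(4)[OF that(1)] S(3)[OF step(1)] that by auto
        show "ideal (S (V n)) R" "saturated R N (regular_module R) (S (V n))" for n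
          by (rule S[OF step(5)])+
        show "S C \<subseteq> S (V n)" for n using step(7)[of n] unfolding S_def by auto
        show "S (V (Suc n)) \<subseteq> S (V n)" for n using step(8)[of n] unfolding S_def by auto
      qed
      then obtain n2 where n2: "\<And>n. n \<ge> n2 \<Longrightarrow> S (V n) = S (V n2)" by auto
      define n0 where "n0 = max n1 n2"
      \<comment> \<open>Up to a factor outside \<open>N\<close>, an element of \<open>V n0\<close>
        is \<open>w + ca\<close> with \<open>w\<close> in \<open>V n\<close>, because
        \<open>S\<close> no longer changes. Then \<open>ca\<close> lies in \<open>V n0\<close>, so
        \<open>c\<close> lies in \<open>T (V n0) = T (V n)\<close>, and \<open>ca\<close> lies in
        \<open>V n\<close>.\<close>
      have "V n0 \<subseteq> V n" if n: "n \<ge> n0" for n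
      proof
        interpret V0: ideal "V n0" R by (rule step(5))
        interpret V: ideal "V n" R by (rule step(5))
        fix v assume v: "v \<in> V n0"
        have "S (V n0) = S (V n)" using n2[of n] n2[of n0] n by (simp add: n0_def)
        then have "v \<in> S (V n)" using v S(3)[OF step(5)[of n0]] by auto
        then obtain s w c where *: "s \<in> carrier R - N" "w \<in> V n" "c \<in> carrier R" "s \<otimes> v = w \<oplus> c \<otimes> a"
          unfolding S_def by auto
        have "c \<otimes> a = s \<otimes> v \<ominus> w"
          using * ab(1) V.Icarr by (metis DiffD1 a_comm add_minus_cancel(1) m_closed)
        moreover have "s \<otimes> v \<ominus> w \<in> V n0"
          using * v dec[OF n] by (intro V0.ideal_closed) auto
        ultimately have "c \<in> T (V n0)" unfolding T_def using * ab(1) by (simp add: m_comm)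
        moreover have "T (V n0) = T (V n)" using n1[of n] n1[of n0] n by (simp add: n0_def)
        ultimately have "c \<otimes> a \<in> V n" unfolding T_def using ab(1) by (simp add: m_comm)
        then have "s \<otimes> v \<in> V n" using * V.ideal_closed(3) by simp
        then show "v \<in> V n" using sat * v V0.Icarr by blast
      qed
      then have "\<forall>n\<ge>n0. V n = V n0" using dec by blast
      then show ?thesis by blast
    qed
  qed
qed

end

lemma saturated_regularD:
  assumes "saturated R N (regular_module R) H" "s \<in> carrier R - N" "x \<in> carrier R" "s \<otimes>\<^bsub>R\<^esub> x \<in> H"
  shows "x \<in> H"
  using assms unfolding saturated_def by simp

lemma (in ideal) multiplier_ideal:
  assumes "cring R" "x \<in> carrier R"
  shows "ideal {a \<in> carrier R. x \<otimes> a \<in> I} R"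
  by (rule helper_max_prime[OF assms])

context noetherian_cring
begin

text \<open>Krull's principal ideal theorem, in the form that \<open>N\<close> is not minimal over \<open>P + xR\<close>. For
  \<open>y \<in> Q - P\<close> the contractions \<open>W n\<close> of \<open>P + y\<^sup>nR\<close> from the localisation at \<open>Q\<close> decrease strictly,
  but modulo \<open>x\<close> they become stationary.\<close>

lemma intermediate_prime:
  assumes P: "primeideal P R" and Q: "primeideal Q R" and N: "primeideal N R"
    and PQ: "P \<subset> Q" and QN: "Q \<subset> N" and x: "x \<in> N" "x \<notin> Q"
  obtains Q' where "primeideal Q' R" "P \<subset> Q'" "Q' \<subset> N" "x \<in> Q'"
proof (rule ccontr)
  note witness = that
  assume no: "\<not> thesis"
  have none: "Q' = N" if "primeideal Q' R" "P \<subseteq> Q'" "Q' \<subseteq> N" "x \<in> Q'" for Q'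
    using witness[of Q'] no that x PQ by blast
  interpret P: primeideal P R by fact
  interpret Q: primeideal Q R by fact
  interpret N: primeideal N R by fact
  interpret M: module R "regular_module R" by (rule regular_module_module)
  have xR: "x \<in> carrier R" using x N.Icarr by auto
  obtain y where y: "y \<in> Q" "y \<notin> P" using PQ by auto
  have yR: "y \<in> carrier R" using y Q.Icarr by auto
  have yn: "y [^] n \<notin> P" for n :: nat
  proof (induction n)
    case 0 then show ?case using P.prime_one by simp
  next
    case (Suc n) then show ?case using P.I_prime[of "y [^] n" y] y yR by auto
  qed
  define W where "W n = {a \<in> carrier R. \<exists>t \<in> carrier R - Q. \<exists>p \<in> P. \<exists>c \<in> carrier R. t \<otimes> a = p \<oplus> c \<otimes> y [^] n}" for n :: nat
  have W: "ideal (W n) R" "saturated R Q (regular_module R) (W n)" "P \<subseteq> W n" "y [^] n \<in> W n" for n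
    using saturation_ideal[OF Q P.is_ideal, of "y [^] n", folded W_def] yR by auto
  \<comment> \<open>Passing from \<open>J\<close> to \<open>S J\<close> means working modulo
    \<open>x\<close> after localisation at \<open>N\<close>. By \<open>none\<close> the only prime
    between \<open>S P\<close> and \<open>N\<close> is \<open>N\<close> itself, so the chain of the
    \<open>S (W n)\<close> becomes stationary.\<close>
  define S where "S J = {a \<in> carrier R. \<exists>s \<in> carrier R - N. \<exists>h \<in> J. \<exists>c \<in> carrier R. s \<otimes> a = h \<oplus> c \<otimes> x}" for J
  note S = saturation_ideal[OF N _ xR, folded S_def]
  have W_dec: "W (Suc n) \<subseteq> W n" for n
  proof
    fix a assume "a \<in> W (Suc n)"
    then obtain t p c where *: "a \<in> carrier R" "t \<in> carrier R - Q" "p \<in> P" "c \<in> carrier R"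
      "t \<otimes> a = p \<oplus> c \<otimes> y [^] Suc n" unfolding W_def by blast
    then have "t \<otimes> a = p \<oplus> (c \<otimes> y) \<otimes> y [^] n" using yR by (simp add: m_assoc m_comm)
    then show "a \<in> W n" unfolding W_def using * yR by blast
  qed
  have "\<exists>n0. \<forall>n\<ge>n0. S (W n) = S (W n0)"
  proof (rule saturated_descending_chain[OF N, of "S P"])
    show "ideal (S P) R" "saturated R N (regular_module R) (S P)" by (rule S[OF P.is_ideal])+
    show "Q' = N" if "primeideal Q' R" "S P \<subseteq> Q'" "Q' \<subseteq> N" for Q'
      using none[OF that(1)] that(2,3) S(3,4)[OF P.is_ideal] by auto
    show "ideal (S (W n)) R" "saturated R N (regular_module R) (S (W n))" for n
      by (rule S[OF W(1)])+
    show "S P \<subseteq> S (W n)" for n using W(3)[of n] unfolding S_def by auto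
    show "S (W (Suc n)) \<subseteq> S (W n)" for n using W_dec[of n] unfolding S_def by auto
  qed
  then obtain n where n: "S (W n) = S (W (Suc n))" by (metis le_Suc_eq order_refl)
  interpret Wn: ideal "W n" R by (rule W)
  interpret Ws: ideal "W (Suc n)" R by (rule W)
  obtain T where T: "finite T" "T \<subseteq> carrier R" "W n = Idl T" using finetely_gen[OF W(1)[of n]] by auto
  \<comment> \<open>Nakayama's lemma at \<open>N\<close>, for \<open>W n\<close> inside
    \<open>W (Suc n) + x W n\<close>. In \<open>s t = h + c x\<close> the term \<open>c x\<close>
    lies in \<open>W n\<close>; as \<open>x\<close> is outside \<open>Q\<close> and
    \<open>W n\<close> is saturated at \<open>Q\<close>, so does \<open>c\<close>.\<close>
  have "T \<subseteq> W (Suc n)"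
  proof (rule M.nakayama[OF N T(1)])
    show "T \<subseteq> carrier (regular_module R)" using T by simp
    show "submodule (W (Suc n)) R (regular_module R)" using W(1) by (simp add: submodule_regular_iff)
    show "saturated R N (regular_module R) (W (Suc n))"
      using W(2)[of "Suc n"] QN unfolding saturated_def by auto
    fix t L assume t: "t \<in> T" and L: "submodule L R (regular_module R)"
      and sat: "saturated R N (regular_module R) L" and WL: "W (Suc n) \<subseteq> L"
      and NT: "\<And>a u. a \<in> N \<Longrightarrow> u \<in> T \<Longrightarrow> a \<odot>\<^bsub>regular_module R\<^esub> u \<in> L"
    interpret L: ideal L R using L by (simp add: submodule_regular_iff)
    have tW: "t \<in> W n" using t T genideal_self by blast
    then have "t \<in> S (W (Suc n))" using n S(3)[OF W(1)[of n]] by auto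
    then obtain s h c where *: "s \<in> carrier R - N" "h \<in> W (Suc n)" "c \<in> carrier R" "s \<otimes> t = h \<oplus> c \<otimes> x"
      unfolding S_def by auto
    have tR: "t \<in> carrier R" using tW Wn.Icarr by auto
    have "s \<otimes> t \<ominus> h \<in> W n" using *(1,2) tW W_dec[of n] by (intro Wn.ideal_closed) auto
    moreover have "c \<otimes> x = s \<otimes> t \<ominus> h"
      unfolding *(4) using *(2,3) xR Ws.Icarr[OF *(2)] by (simp add: add_minus_cancel a_comm[of h])
    ultimately have "c \<otimes> x \<in> W n" by simp
    then have "x \<otimes> c \<in> W n" by (subst m_comm[OF xR *(3)])
    then have c: "c \<in> W n" using saturated_regularD[OF W(2)[of n], of x c] x(2) xR *(3) by simp
    have "T \<subseteq> {a \<in> carrier R. x \<otimes> a \<in> L}" using NT x T by auto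
    then have "Idl T \<subseteq> {a \<in> carrier R. x \<otimes> a \<in> L}"
      by (rule genideal_minimal[OF L.multiplier_ideal[OF cring_axioms xR]])
    then have "x \<otimes> c \<in> L" using c T(3) by blast
    then have "c \<otimes> x \<in> L" by (subst m_comm[OF *(3) xR])
    then have "s \<otimes> t \<in> L" unfolding *(4) using *(2) WL L.ideal_closed(3) by blast
    then show "t \<in> L" by (rule saturated_regularD[OF sat *(1) tR])
  qed
  then have "W n \<subseteq> W (Suc n)" using T(3) genideal_minimal[OF W(1)] by simp
  then have "y [^] n \<in> W (Suc n)" using W(4) by auto
  then obtain t p c where *: "t \<in> carrier R - Q" "p \<in> P" "c \<in> carrier R" "t \<otimes> y [^] n = p \<oplus> c \<otimes> y [^] Suc n"
    unfolding W_def by auto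
  have pR: "p \<in> carrier R" using * P.Icarr by auto
  \<comment> \<open>As \<open>y\<close> lies in \<open>Q\<close> and \<open>t\<close> does not,
    \<open>t - cy\<close> is outside \<open>Q\<close> and hence outside \<open>P\<close>. No power
    of \<open>y\<close> is in \<open>P\<close> either, but the product below equals
    \<open>p\<close>.\<close>
  have "(t \<ominus> c \<otimes> y) \<otimes> y [^] n = t \<otimes> y [^] n \<ominus> c \<otimes> y [^] Suc n"
  proof -
    have "(t \<ominus> c \<otimes> y) \<otimes> z = t \<otimes> z \<ominus> c \<otimes> (y \<otimes> z)" if "z \<in> carrier R" for z
      using *(1,3) yR that by (simp add: a_minus_def l_distr l_minus m_assoc)
    then show ?thesis using nat_pow_Suc2[OF yR, of n] yR by simp
  qed
  also have "\<dots> = p" unfolding *(4) using *(1,3) yR pR by (simp add: add_minus_cancel)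
  finally have "(t \<ominus> c \<otimes> y) \<otimes> y [^] n \<in> P" using * by simp
  then have "t \<ominus> c \<otimes> y \<in> P" using P.I_prime[of "t \<ominus> c \<otimes> y" "y [^] n"] yn[of n] * yR by auto
  then have "(t \<ominus> c \<otimes> y) \<oplus> c \<otimes> y \<in> Q" using PQ y * Q.ideal_closed(2,3) by blast
  then have "t \<in> Q" using * yR by (simp add: add_minus_cancel)
  then show False using * by simp
qed

section \<open>Chains of prime ideals through a given element\<close>

definition prime_chain :: "nat \<Rightarrow> (nat \<Rightarrow> 'a set) \<Rightarrow> bool" where
  "prime_chain n P \<longleftrightarrow> (\<forall>i\<le>n. primeideal (P i) R) \<and> (\<forall>i<n. P i \<subset> P (Suc i))"

text \<open>The step from the principal ideal theorem to the height theorem: \<open>x\<close> is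
  pushed down from the top prime, replacing one prime after another.
  \<open>intermediate_prime\<close> supplies each replacement between the neighbours of the old
  prime, so the length and both ends are kept.\<close>

lemma prime_chain_through:
  assumes "prime_chain (Suc n) P" "x \<in> P (Suc n)"
  shows "\<exists>P'. prime_chain (Suc n) P' \<and> P' 0 = P 0 \<and> P' (Suc n) = P (Suc n) \<and> x \<in> P' (Suc 0)"
  using assms
proof (induction n arbitrary: P)
  case 0 then show ?case by auto
next
  case (Suc n)
  have P: "\<And>i. i \<le> Suc (Suc n) \<Longrightarrow> primeideal (P i) R" "\<And>i. i < Suc (Suc n) \<Longrightarrow> P i \<subset> P (Suc i)"
    using Suc.prems(1) unfolding prime_chain_def by simp_all
  have "\<exists>W. primeideal W R \<and> P n \<subset> W \<and> W \<subset> P (Suc (Suc n)) \<and> x \<in> W"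
  proof (cases "x \<in> P (Suc n)")
    case True
    moreover have "primeideal (P (Suc n)) R" "P n \<subset> P (Suc n)" "P (Suc n) \<subset> P (Suc (Suc n))"
      by (simp_all add: P)
    ultimately show ?thesis by blast
  next
    case False
    have "primeideal (P n) R" "primeideal (P (Suc n)) R" "primeideal (P (Suc (Suc n))) R"
      "P n \<subset> P (Suc n)" "P (Suc n) \<subset> P (Suc (Suc n))" by (simp_all add: P)
    then obtain W where "primeideal W R" "P n \<subset> W" "W \<subset> P (Suc (Suc n))" "x \<in> W"
      by (rule intermediate_prime[OF _ _ _ _ _ Suc.prems(2) False])
    then show ?thesis by blast
  qed
  then obtain W where W: "primeideal W R" "P n \<subset> W" "W \<subset> P (Suc (Suc n))" "x \<in> W" by auto
  have "prime_chain (Suc n) (P(Suc n := W))"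
    unfolding prime_chain_def
  proof (intro conjI allI impI)
    show "primeideal ((P(Suc n := W)) i) R" if "i \<le> Suc n" for i using that P(1)[of i] W(1) by simp
    show "(P(Suc n := W)) i \<subset> (P(Suc n := W)) (Suc i)" if "i < Suc n" for i
      using that P(2)[of i] W(2) by (cases "i = n") simp_all
  qed
  from Suc.IH[OF this] W obtain P' where P': "prime_chain (Suc n) P'" "P' 0 = P 0" "P' (Suc n) = W"
    "x \<in> P' (Suc 0)" by auto
  have "prime_chain (Suc (Suc n)) (P'(Suc (Suc n) := P (Suc (Suc n))))"
    unfolding prime_chain_def
  proof (intro conjI allI impI)
    show "primeideal ((P'(Suc (Suc n) := P (Suc (Suc n)))) i) R" if "i \<le> Suc (Suc n)" for i
      using that P(1)[of i] P'(1) by (cases "i = Suc (Suc n)") (simp_all add: prime_chain_def)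
    show "(P'(Suc (Suc n) := P (Suc (Suc n)))) i \<subset> (P'(Suc (Suc n) := P (Suc (Suc n)))) (Suc i)"
      if "i < Suc (Suc n)" for i
      using that P'(1,3) W(3) by (cases "i = Suc n") (simp_all add: prime_chain_def)
  qed
  moreover have "(P'(Suc (Suc n) := P (Suc (Suc n)))) 0 = P 0"
    "(P'(Suc (Suc n) := P (Suc (Suc n)))) (Suc (Suc n)) = P (Suc (Suc n))"
    "x \<in> (P'(Suc (Suc n) := P (Suc (Suc n)))) (Suc 0)" using P' by simp_all
  ultimately show ?case by blast
qed

lemma prime_chain_shift: "prime_chain (Suc n) P \<Longrightarrow> prime_chain n (\<lambda>i. P (Suc i))"
  by (auto simp: prime_chain_def)

end

definition adjoin :: "('a, 'r) ring_scheme \<Rightarrow> 'a set \<Rightarrow> 'a \<Rightarrow> 'a set" where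
  "adjoin R J x = {j \<oplus>\<^bsub>R\<^esub> b \<otimes>\<^bsub>R\<^esub> x | j b. j \<in> J \<and> b \<in> carrier R}"

lemma (in cring) adjoin:
  assumes "ideal J R" "x \<in> carrier R"
  shows "ideal (adjoin R J x) R" and "J \<subseteq> adjoin R J x" and "x \<in> adjoin R J x"
    and "\<And>I. ideal I R \<Longrightarrow> J \<subseteq> I \<Longrightarrow> x \<in> I \<Longrightarrow> adjoin R J x \<subseteq> I"
proof -
  interpret J: ideal J R by fact
  have J: "j \<in> J \<Longrightarrow> j \<in> carrier R" for j by (rule J.Icarr)
  have mem: "j \<oplus> b \<otimes> x \<in> adjoin R J x" if "j \<in> J" "b \<in> carrier R" for j b
    using that unfolding adjoin_def by blast
  show sub: "J \<subseteq> adjoin R J x"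
  proof
    fix j assume j: "j \<in> J"
    have "j = j \<oplus> \<zero> \<otimes> x" using j J assms(2) by simp
    then show "j \<in> adjoin R J x" using mem[OF j zero_closed] by simp
  qed
  show "x \<in> adjoin R J x" using mem[of \<zero> \<one>] assms(2) J.zero_closed by simp
  show "adjoin R J x \<subseteq> I" if "ideal I R" "J \<subseteq> I" "x \<in> I" for I
  proof -
    interpret I: ideal I R by fact
    show ?thesis unfolding adjoin_def using that I.ideal_closed(2,3) by blast
  qed
  show "ideal (adjoin R J x) R"
  proof (rule idealI')
    show "adjoin R J x \<subseteq> carrier R" unfolding adjoin_def using J assms(2) by auto
    show "\<zero> \<in> adjoin R J x" using sub J.zero_closed by auto
    fix u v assume "u \<in> adjoin R J x" "v \<in> adjoin R J x"
    then obtain j b i c where *: "u = j \<oplus> b \<otimes> x" "v = i \<oplus> c \<otimes> x" "j \<in> J" "i \<in> J"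
      "b \<in> carrier R" "c \<in> carrier R" unfolding adjoin_def by blast
    have "u \<oplus> v = (j \<oplus> i) \<oplus> (b \<oplus> c) \<otimes> x" using * J assms(2) by (simp add: l_distr a_ac)
    then show "u \<oplus> v \<in> adjoin R J x" using mem[of "j \<oplus> i" "b \<oplus> c"] * by simp
  next
    fix a u assume a: "a \<in> carrier R" and "u \<in> adjoin R J x"
    then obtain j b where *: "u = j \<oplus> b \<otimes> x" "j \<in> J" "b \<in> carrier R" unfolding adjoin_def by blast
    have "a \<otimes> u = a \<otimes> j \<oplus> (a \<otimes> b) \<otimes> x" using * a J assms(2) by (simp add: r_distr m_assoc)
    then show "a \<otimes> u \<in> adjoin R J x" using mem[of "a \<otimes> j" "a \<otimes> b"] * a J.ideal_closed(2) by simp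
  qed
qed

lemma (in cring) adjoin_genideal:
  assumes "S \<subseteq> carrier R" "x \<in> carrier R"
  shows "adjoin R (Idl S) x = Idl (insert x S)"
proof
  note * = adjoin[OF genideal_ideal[OF assms(1)] assms(2)]
  have "insert x S \<subseteq> carrier R" using assms by auto
  note ** = genideal_ideal[OF this] genideal_self[OF this]
  show "adjoin R (Idl S) x \<subseteq> Idl (insert x S)"
    by (rule *(4)) (use ** genideal_minimal[of "Idl (insert x S)" S] in auto)
  show "Idl (insert x S) \<subseteq> adjoin R (Idl S) x"
    by (rule genideal_minimal[OF *(1)]) (use * genideal_self[OF assms(1)] in auto)
qed

section \<open>Local rings: units and Nakayama's lemma\<close>

context noetherian_local_ring
begin

abbreviation max_ideal_local ("\<mm>") where "\<mm> \<equiv> max_ideal R"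

lemma max_ideal: "maximalideal \<mm> R"
  unfolding max_ideal_def by (rule theI'[OF ex1_maximalideal])

lemma max_ideal_prime: "primeideal \<mm> R"
  by (rule maximalideal_prime[OF max_ideal])

sublocale mm: primeideal \<mm> R by (rule max_ideal_prime)

lemma proper_ideal_subset_max:
  assumes "ideal I R" "\<one> \<notin> I"
  shows "I \<subseteq> \<mm>"
proof -
  interpret I: ideal I R by fact
  let ?F = "{J. ideal J R \<and> I \<subseteq> J \<and> \<one> \<notin> J}"
  have ne: "?F \<noteq> {}" using assms by auto
  obtain M where M: "M \<in> ?F" "\<And>J. J \<in> ?F \<Longrightarrow> M \<subseteq> J \<Longrightarrow> J = M"
    by (rule maximal_ideal_in_family[OF ne]) auto
  interpret M: ideal M R using M by auto
  have "maximalideal M R"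
  proof (rule maximalidealI)
    show "ideal M R" by (rule M.is_ideal)
    show "carrier R \<noteq> M" using M by auto
    fix J assume J: "ideal J R" "M \<subseteq> J" "J \<subseteq> carrier R"
    show "J = M \<or> J = carrier R"
      using J M(2)[of J] M(1) ideal.one_imp_carrier[OF J(1)] by auto
  qed
  then have "M = \<mm>" using ex1_maximalideal max_ideal by blast
  then show ?thesis using M by auto
qed

lemma unit_if_not_in_max:
  assumes "a \<in> carrier R - \<mm>"
  obtains b where "b \<in> carrier R" "b \<otimes> a = \<one>"
proof -
  have "\<one> \<in> PIdl a"
    using proper_ideal_subset_max[OF cgenideal_ideal[of a]] cgenideal_self[of a] assms by auto
  then show ?thesis using that unfolding cgenideal_def by auto
qed

text \<open>Elements outside \<open>\<mm>\<close> are already units, so saturation at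
  \<open>\<mm>\<close> is automatic and the general form of Nakayama's lemma becomes the usual
  one.\<close>

lemma saturated_max:
  assumes "module R M" "submodule H R M"
  shows "saturated R \<mm> M H"
  unfolding saturated_def
proof (intro ballI impI)
  interpret M: module R M by fact
  fix s x assume *: "s \<in> carrier R - \<mm>" "x \<in> carrier M" "s \<odot>\<^bsub>M\<^esub> x \<in> H"
  obtain b where b: "b \<in> carrier R" "b \<otimes> s = \<one>" using unit_if_not_in_max * by blast
  have "b \<odot>\<^bsub>M\<^esub> (s \<odot>\<^bsub>M\<^esub> x) = x" using * b by (simp add: M.smult_assoc1[symmetric])
  then show "x \<in> H" using M.submoduleE'(3)[OF assms(2) b(1) *(3)] by simp
qed

text \<open>Meant for ideals \<open>I\<close> from which a factor \<open>x\<close> can be cancelled: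
  writing an element of \<open>I\<close> as \<open>j + bx\<close> then forces \<open>b\<close> into
  \<open>I\<close> as well.\<close>

lemma nakayama_ideal:
  assumes I: "ideal I R" and J: "ideal J R" and x: "x \<in> \<mm>"
    and sub: "\<And>a. a \<in> I \<Longrightarrow> \<exists>j \<in> J. \<exists>b \<in> I. a = j \<oplus> b \<otimes> x"
  shows "I \<subseteq> J"
proof -
  interpret M: module R "regular_module R" by (rule regular_module_module)
  have xR: "x \<in> carrier R" using x mm.Icarr by auto
  obtain T where T: "finite T" "T \<subseteq> carrier R" "I = Idl T" using finetely_gen[OF I] by auto
  have "T \<subseteq> J"
  proof (rule M.nakayama[OF max_ideal_prime T(1)])
    show "T \<subseteq> carrier (regular_module R)" using T by simp
    show J': "submodule J R (regular_module R)" using J by (simp add: submodule_regular_iff)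
    show "saturated R \<mm> (regular_module R) J" by (rule saturated_max[OF M.module_axioms J'])
    fix t L assume t: "t \<in> T" and L: "submodule L R (regular_module R)" and JL: "J \<subseteq> L"
      and NT: "\<And>a u. a \<in> \<mm> \<Longrightarrow> u \<in> T \<Longrightarrow> a \<odot>\<^bsub>regular_module R\<^esub> u \<in> L"
    interpret L: ideal L R using L by (simp add: submodule_regular_iff)
    have "t \<in> I" using t T genideal_self by blast
    then obtain j b where *: "j \<in> J" "b \<in> I" "t = j \<oplus> b \<otimes> x" using sub by blast
    have "T \<subseteq> {a \<in> carrier R. x \<otimes> a \<in> L}" using NT x T by auto
    then have "Idl T \<subseteq> {a \<in> carrier R. x \<otimes> a \<in> L}"
      by (rule genideal_minimal[OF L.multiplier_ideal[OF cring_axioms xR]])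
    then have xb: "x \<otimes> b \<in> L" "b \<in> carrier R" using *(2) T(3) by blast+
    then have "b \<otimes> x \<in> L" by (subst m_comm[OF xb(2) xR])
    then show "t \<in> L" unfolding *(3) using *(1) JL L.ideal_closed(3) by blast
  qed
  then show ?thesis using T(3) genideal_minimal[OF J] by simp
qed

end

section \<open>Regular local rings and regular sequences\<close>

text \<open>The sequence \<open>x\<close> is regular on \<open>R/I\<close> and generates the maximal ideal of \<open>R/I\<close>.\<close>

definition regular_flag ::
  "('a, 'r) ring_scheme \<Rightarrow> 'a set \<Rightarrow> nat \<Rightarrow> (nat \<Rightarrow> 'a set) \<Rightarrow> (nat \<Rightarrow> 'a) \<Rightarrow> bool" where
  "regular_flag R I n J x \<longleftrightarrow> J 0 = I \<and> J n = max_ideal R \<and>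
     (\<forall>i<n. x i \<in> carrier R \<and> J (Suc i) = adjoin R (J i) (x i) \<and>
        (\<forall>a \<in> carrier R. x i \<otimes>\<^bsub>R\<^esub> a \<in> J i \<longrightarrow> a \<in> J i))"

context noetherian_local_ring
begin

text \<open>A \<open>regular_flag\<close> without the regularity and without a prescribed end, the
  part on which the bounds for chains of primes rest.\<close>

definition ideal_tower :: "nat \<Rightarrow> (nat \<Rightarrow> 'a set) \<Rightarrow> (nat \<Rightarrow> 'a) \<Rightarrow> bool" where
  "ideal_tower n J x \<longleftrightarrow> ideal (J 0) R \<and> (\<forall>i<n. x i \<in> carrier R \<and> J (Suc i) = adjoin R (J i) (x i))"

lemma ideal_tower:
  assumes tower: "ideal_tower n J x"
  shows "i \<le> n \<Longrightarrow> ideal (J i) R" and "i \<le> j \<Longrightarrow> j \<le> n \<Longrightarrow> J i \<subseteq> J j"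
    and "i < n \<Longrightarrow> x i \<in> J (Suc i)" and "i < n \<Longrightarrow> x i \<in> carrier R" and "i < n \<Longrightarrow> J (Suc i) = adjoin R (J i) (x i)"
proof -
  have step': "i < n \<Longrightarrow> x i \<in> carrier R" "i < n \<Longrightarrow> J (Suc i) = adjoin R (J i) (x i)" for i
    using tower by (simp_all add: ideal_tower_def)
  then show "i < n \<Longrightarrow> x i \<in> carrier R" and "i < n \<Longrightarrow> J (Suc i) = adjoin R (J i) (x i)"
    by simp_all
  have id: "i \<le> n \<Longrightarrow> ideal (J i) R" for i
  proof (induction i)
    case 0 then show ?case using tower by (simp add: ideal_tower_def)
  next
    case (Suc i) then show ?case using step'[of i] adjoin(1)[of "J i" "x i"] by simp
  qed
  then show "i \<le> n \<Longrightarrow> ideal (J i) R" .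
  show "i < n \<Longrightarrow> x i \<in> J (Suc i)" using step'[of i] adjoin(3)[OF id[of i], of "x i"] by simp
  show "i \<le> j \<Longrightarrow> j \<le> n \<Longrightarrow> J i \<subseteq> J j"
  proof (induction j rule: dec_induct)
    case base then show ?case by simp
  next
    case (step j)
    have "J j \<subseteq> J (Suc j)" using step(1,2,4) step'[of j] adjoin(2)[OF id[of j], of "x j"] by simp
    then show ?case using step by simp
  qed
qed

lemma ideal_tower_genideal:
  assumes "ideal_tower n J x" "J 0 = {\<zero>}"
  shows "i \<le> n \<Longrightarrow> J i = Idl (x ` {..<i})"
proof (induction i)
  case 0
  have "Idl {} = {\<zero>}"
    using genideal_minimal[OF zeroideal, of "{}"] ideal.ideal_closed(1)[OF genideal_ideal[of "{}"]] by auto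
  then show ?case using assms by simp
next
  case (Suc i)
  have "x ` {..<i} \<subseteq> carrier R" using ideal_tower(4)[OF assms(1)] Suc.prems by auto
  then show ?case using Suc ideal_tower(4,5)[OF assms(1), of i] adjoin_genideal[of "x ` {..<i}" "x i"]
    by (simp add: lessThan_Suc)
qed

text \<open>Each adjoined element costs one prime at most: move \<open>x k\<close> into the second
  prime of the chain and drop the first.\<close>

lemma prime_chain_above_tower:
  assumes tower: "ideal_tower n J x"
    and chain: "prime_chain m P" "J 0 \<subseteq> P 0" "J n \<subseteq> P m"
  shows "k \<le> n \<Longrightarrow> k \<le> m \<Longrightarrow> \<exists>P'. prime_chain (m - k) P' \<and> J k \<subseteq> P' 0 \<and> P' (m - k) = P m"
proof (induction k)
  case 0 then show ?case using chain by auto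
next
  case (Suc k)
  then obtain P' where P': "prime_chain (m - k) P'" "J k \<subseteq> P' 0" "P' (m - k) = P m" by auto
  obtain l where l: "m - k = Suc l" "m - Suc k = l" using Suc.prems by (cases "m - k") auto
  have k: "k < n" using Suc.prems by simp
  have "x k \<in> J (Suc k)" "J (Suc k) \<subseteq> J n"
    using ideal_tower(3)[OF tower k] ideal_tower(2)[OF tower, of "Suc k" n] k by auto
  then have xk: "x k \<in> P' (Suc l)" using P' l chain by auto
  obtain P'' where P'': "prime_chain (Suc l) P''" "P'' 0 = P' 0" "P'' (Suc l) = P' (Suc l)"
    "x k \<in> P'' (Suc 0)"
    using prime_chain_through[of l P' "x k"] P'(1) xk l by auto
  have "primeideal (P'' (Suc 0)) R" "P'' 0 \<subset> P'' (Suc 0)" using P''(1) by (simp_all add: prime_chain_def)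
  then have "J (Suc k) \<subseteq> P'' (Suc 0)"
    using ideal_tower(4,5)[OF tower k] adjoin(4)[of "J k" "x k" "P'' (Suc 0)"] P''(2,4) P'(2)
      ideal_tower(1)[OF tower, of k] k by (auto simp: primeideal_def)
  then show ?case using prime_chain_shift[OF P''(1)] P''(3) P'(3) l
    by (intro exI[of _ "\<lambda>i. P'' (Suc i)"]) simp
qed

lemma prime_subset_max: "primeideal P R \<Longrightarrow> P \<subseteq> \<mm>"
  using proper_ideal_subset_max[of P] primeideal.prime_one[of P R] by (auto simp: primeideal_def)

lemma prime_chain_length_le:
  assumes tower: "ideal_tower n J x" and zero: "J 0 = {\<zero>}"
    and top: "J n = \<mm>" and chain: "prime_chain m P"
  shows "m \<le> n"
proof (rule ccontr)
  assume "\<not> m \<le> n"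
  then obtain l where l: "m = Suc l" "n \<le> l" by (cases m) auto
  \<comment> \<open>\<open>prime_chain_above_tower\<close> wants the tower below the last prime, so
    that prime is replaced by \<open>\<mm>\<close>. After \<open>n\<close> steps a chain of positive
    length starts above \<open>\<mm>\<close>, which is impossible.\<close>
  define P1 where "P1 = P(m := \<mm>)"
  have "prime_chain m P1"
    unfolding prime_chain_def
  proof (intro conjI allI impI)
    show "primeideal (P1 i) R" if "i \<le> m" for i
      using that chain max_ideal_prime by (simp add: P1_def prime_chain_def)
    show "P1 i \<subset> P1 (Suc i)" if "i < m" for i
    proof -
      have "P i \<subset> P (Suc i)" "primeideal (P (Suc i)) R" using that chain by (simp_all add: prime_chain_def)
      then show ?thesis using that prime_subset_max[of "P (Suc i)"] by (auto simp: P1_def)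
    qed
  qed
  moreover have "J 0 \<subseteq> P1 0"
  proof -
    have "primeideal (P 0) R" using chain by (simp add: prime_chain_def)
    then show ?thesis using ideal.ideal_closed(1)[of "P 0" R] mm.ideal_closed(1)
      by (auto simp: P1_def primeideal_def zero)
  qed
  moreover have "J n \<subseteq> P1 m" using top by (simp add: P1_def)
  ultimately obtain P' where P': "prime_chain (m - n) P'" "J n \<subseteq> P' 0"
    using prime_chain_above_tower[OF tower, of m P1 n] l by auto
  have "P' 0 \<subset> P' 1" "primeideal (P' 1) R" using P' l by (simp_all add: prime_chain_def)
  then show False using prime_subset_max[of "P' 1"] P'(2) top by auto
qed

text \<open>Downward induction on \<open>k\<close>. A chain of the full length \<open>n - k\<close>
  can be led through \<open>x k\<close>, and its rest starts exactly at \<open>J (Suc k)\<close> by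
  induction. So \<open>P 0\<close> lies properly inside \<open>J (Suc k)\<close> and misses
  \<open>x k\<close>, and Nakayama's lemma collapses it to \<open>J k\<close>.\<close>

lemma tower_ideals_prime:
  assumes tower: "ideal_tower n J x" and zero: "J 0 = {\<zero>}"
    and top: "J n = \<mm>"
  shows "k \<le> n \<Longrightarrow> prime_chain (n - k) P \<Longrightarrow> J k \<subseteq> P 0 \<Longrightarrow> P (n - k) = \<mm> \<Longrightarrow>
     P 0 = J k \<and> (k < n \<longrightarrow> x k \<notin> J k)"
proof (induction "n - k" arbitrary: k P)
  case 0
  then show ?case using top by simp
next
  case (Suc l)
  note id = ideal_tower[OF tower]
  have k: "k < n" and l: "l = n - Suc k" "n - k = Suc l" using Suc.hyps by auto
  have chain: "prime_chain (Suc l) P" using Suc.prems l by simp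
  have xk: "x k \<in> carrier R" "x k \<in> \<mm>" "J (Suc k) = adjoin R (J k) (x k)"
    using id(2)[of "Suc k" n] id(3-5)[of k] k top by auto
  obtain P' where P': "prime_chain (Suc l) P'" "P' 0 = P 0" "P' (Suc l) = P (Suc l)" "x k \<in> P' (Suc 0)"
    using prime_chain_through[OF chain, of "x k"] xk Suc.prems l by auto
  have P0: "primeideal (P 0) R" "P 0 \<subset> P' (Suc 0)" "primeideal (P' (Suc 0)) R"
  proof -
    have "primeideal (P' 0) R" "P' 0 \<subset> P' (Suc 0)" "primeideal (P' (Suc 0)) R"
      using P'(1) by (simp_all add: prime_chain_def)
    then show "primeideal (P 0) R" "P 0 \<subset> P' (Suc 0)" "primeideal (P' (Suc 0)) R" using P'(2) by simp_all
  qed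
  interpret P0: primeideal "P 0" R by fact
  have Jk: "ideal (J k) R" using id k by simp
  have "J (Suc k) \<subseteq> P' (Suc 0)"
    unfolding xk(3) by (rule adjoin(4)[OF Jk xk(1)]) (use P0 P' Suc.prems in \<open>auto simp: primeideal_def\<close>)
  then have eq: "P' (Suc 0) = J (Suc k)"
    using Suc.hyps(1)[OF l(1), of "\<lambda>i. P' (Suc i)"] prime_chain_shift[OF P'(1)] k Suc.prems P'(3) l by simp
  have xP: "x k \<notin> P 0"
  proof
    assume "x k \<in> P 0"
    then have "J (Suc k) \<subseteq> P 0" unfolding xk(3) by (intro adjoin(4)[OF Jk xk(1)] P0.is_ideal Suc.prems)
    then show False using P0 eq by auto
  qed
  have "P 0 \<subseteq> J k"
  proof (rule nakayama_ideal[OF P0.is_ideal Jk xk(2)])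
    fix a assume a: "a \<in> P 0"
    then have "a \<in> adjoin R (J k) (x k)" using P0 eq xk by auto
    then obtain j b where *: "a = j \<oplus> b \<otimes> x k" "j \<in> J k" "b \<in> carrier R" unfolding adjoin_def by auto
    have j: "j \<in> P 0" "j \<in> carrier R" using * Suc.prems P0.Icarr by auto
    have "b \<otimes> x k = a \<ominus> j" using * j xk(1) by (simp add: a_comm[of j] add_minus_cancel)
    then have "b \<otimes> x k \<in> P 0" using a j P0.ideal_closed(5) by simp
    then have "b \<in> P 0" using P0.I_prime[of b "x k"] * xk xP by auto
    then show "\<exists>j\<in>J k. \<exists>b\<in>P 0. a = j \<oplus> b \<otimes> x k" using * by blast
  qed
  then show ?case using Suc.prems xP by auto
qed

lemma krull_dim_prime_chain: "krull_dim R = Sup {enat n | n. \<exists>P. prime_chain n P}"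
  unfolding krull_dim_def prime_chain_def ..

lemma krull_dim_le:
  assumes "\<And>m P. prime_chain m P \<Longrightarrow> m \<le> n"
  shows "krull_dim R \<le> enat n"
  unfolding krull_dim_prime_chain
proof (rule Sup_least)
  fix z assume "z \<in> {enat n | n. \<exists>P. prime_chain n P}"
  then obtain m P where "z = enat m" "prime_chain m P" by blast
  then show "z \<le> enat n" using assms by simp
qed

text \<open>Any numbering of a generating set of size \<open>krull_dim R\<close> works: a chain of
  that length makes every partial ideal prime, and modulo a prime that misses \<open>x k\<close>
  multiplication by \<open>x k\<close> is injective.\<close>

lemma regular_flag_of_regular:
  assumes "regular_local_ring R"
  shows "\<exists>n J x. regular_flag R {\<zero>} n J x"
proof -
  obtain S where S: "S \<subseteq> carrier R" "finite S" "Idl S = \<mm>" "enat (card S) = krull_dim R"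
    using assms unfolding regular_local_ring_def by auto
  define n where "n = card S"
  obtain x where x: "bij_betw x {..<n} S" using S(2) ex_bij_betw_nat_finite[of S]
    by (auto simp: n_def atLeast0LessThan)
  define J where "J i = Idl (x ` {..<i})" for i
  have xS: "x i \<in> S" if "i < n" for i using x that by (auto simp: bij_betw_def)
  have zero: "J 0 = {\<zero>}"
      using genideal_minimal[OF zeroideal, of "{}"] ideal.ideal_closed(1)[OF genideal_ideal[of "{}"]]
      by (auto simp: J_def)
  have "x i \<in> carrier R \<and> J (Suc i) = adjoin R (J i) (x i)" if i: "i < n" for i
  proof -
    have "x ` {..<i} \<subseteq> carrier R" "x i \<in> carrier R" using xS S(1) i by fastforce+
    then show "x i \<in> carrier R \<and> J (Suc i) = adjoin R (J i) (x i)"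
      by (simp add: J_def adjoin_genideal lessThan_Suc)
  qed
  then have tower: "ideal_tower n J x" by (simp add: ideal_tower_def zero zeroideal)
  have top: "J n = \<mm>" using x S by (simp add: J_def bij_betw_def)
  \<comment> \<open>The supremum that defines \<open>krull_dim\<close> is attained: a longer chain
    has an initial segment of length \<open>n\<close>, so if no chain had length \<open>n\<close>,
    all lengths would be at most \<open>n - 1\<close>. The chain of length 0 at \<open>\<mm>\<close>
    ensures that \<open>n - 1\<close> is a genuine predecessor.\<close>
  have "\<exists>P. prime_chain n P"
  proof (rule ccontr)
    assume none: "\<nexists>P. prime_chain n P"
    have "prime_chain 0 (\<lambda>_. \<mm>)" using max_ideal_prime by (simp add: prime_chain_def)
    then have n: "n \<noteq> 0" using none by (metis)
    have "m \<le> n - 1" if "prime_chain m P" for m P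
    proof (rule ccontr)
      assume "\<not> m \<le> n - 1"
      then have "prime_chain n P" using that by (auto simp: prime_chain_def)
      then show False using none by auto
    qed
    then have "krull_dim R \<le> enat (n - 1)" by (rule krull_dim_le)
    then show False using S(4)[symmetric] n by (simp add: n_def)
  qed
  then obtain P0 where P0: "prime_chain n P0" by auto
  define P where "P = P0(n := \<mm>)"
  have P: "prime_chain n P"
    unfolding prime_chain_def
  proof (intro conjI allI impI)
    show "primeideal (P i) R" if "i \<le> n" for i
      using that P0 max_ideal_prime by (simp add: P_def prime_chain_def)
    show "P i \<subset> P (Suc i)" if "i < n" for i
    proof -
      have "P0 i \<subset> P0 (Suc i)" "primeideal (P0 (Suc i)) R" using that P0 by (simp_all add: prime_chain_def)
      then show ?thesis using that prime_subset_max[of "P0 (Suc i)"] by (auto simp: P_def)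
    qed
  qed
  have "primeideal (P 0) R" using P by (simp add: prime_chain_def)
  then have P00: "J 0 \<subseteq> P 0" using ideal.ideal_closed(1)[of "P 0" R] by (auto simp: primeideal_def zero)
  have PJ: "primeideal (J k) R \<and> (k < n \<longrightarrow> x k \<notin> J k)" if k: "k \<le> n" for k
  proof -
    obtain P' where P': "prime_chain (n - k) P'" "J k \<subseteq> P' 0" "P' (n - k) = P n"
      using prime_chain_above_tower[OF tower P P00, of k] top k by (auto simp: P_def)
    then have "P' 0 = J k \<and> (k < n \<longrightarrow> x k \<notin> J k)"
      using tower_ideals_prime[OF tower zero top k P'(1,2)] by (simp add: P_def)
    moreover have "primeideal (P' 0) R" using P' by (simp add: prime_chain_def)
    ultimately show ?thesis by simp
  qed
  have "regular_flag R {\<zero>} n J x"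
    unfolding regular_flag_def
  proof (intro conjI allI impI ballI)
    fix i a assume i: "i < n" and "a \<in> carrier R" "x i \<otimes> a \<in> J i"
    then show "a \<in> J i" using PJ[of i] primeideal.I_prime[of "J i" R "x i" a] ideal_tower(4)[OF tower i] by auto
  qed (use ideal_tower[OF tower] zero top in auto)
  then show ?thesis by blast
qed

text \<open>The ideals \<open>J i\<close> turn out to be prime, by descent from
  \<open>\<mm>\<close>, so they form a chain of length \<open>n\<close>.
  \<open>prime_chain_length_le\<close> gives the other inequality for the dimension.\<close>

lemma regular_of_regular_flag:
  assumes flag: "regular_flag R {\<zero>} n J x"
  shows "regular_local_ring R"
proof -
  have zero: "J 0 = {\<zero>}" and tower: "ideal_tower n J x"
    and top: "J n = \<mm>" and reg: "\<And>i a. i < n \<Longrightarrow> a \<in> carrier R \<Longrightarrow> x i \<otimes> a \<in> J i \<Longrightarrow> a \<in> J i"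
    using flag by (auto simp: regular_flag_def ideal_tower_def zeroideal)
  note id = ideal_tower[OF tower]
  have one: "\<one> \<notin> J i" if "i \<le> n" for i using id(2)[of i n] that top mm.prime_one by auto
  have xJ: "x i \<notin> J i" if i: "i < n" for i
    using reg[OF i, of \<one>] one[of i] id(4)[OF i] i by auto
  have strict: "J i \<subset> J (Suc i)" if i: "i < n" for i
    using xJ[OF i] id(3)[of i] id(2)[of i "Suc i"] i by auto
  have xm: "x i \<in> \<mm>" if "i < n" for i using id(2)[of "Suc i" n] id(3)[of i] that top by auto
  have prime: "primeideal (J i) R" if "i \<le> n" for i
    using that
  proof (induction i rule: inc_induct)
    case base then show ?case using top max_ideal_prime by simp
  next
    case (step i)
    have i: "i < n" using step by simp
    interpret J: ideal "J i" R using id(1) i by simp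
    interpret J': primeideal "J (Suc i)" R by (rule step)
    have xR: "x i \<in> carrier R" using id(4)[OF i] by simp
    have Jx: "\<exists>j\<in>J i. \<exists>b\<in>carrier R. a = j \<oplus> b \<otimes> x i" if "a \<in> J (Suc i)" for a
      using that unfolding id(5)[OF i] adjoin_def by blast
    \<comment> \<open>For \<open>b\<close> outside the prime \<open>J (Suc i)\<close> put
      \<open>U = (J i : b)\<close>. Then \<open>U\<close> lies in \<open>J (Suc i)\<close>, and
      regularity of \<open>x i\<close> allows its cancellation, so \<open>U\<close> lies in
      \<open>J i + x U\<close> and Nakayama's lemma applies.\<close>
    have key: "a \<in> J i" if a: "a \<in> carrier R" and b: "b \<in> carrier R" "b \<notin> J (Suc i)" and ab: "b \<otimes> a \<in> J i" for a b
    proof -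
      have U: "ideal {a \<in> carrier R. b \<otimes> a \<in> J i} R" by (rule J.multiplier_ideal[OF cring_axioms b(1)])
      have "{a \<in> carrier R. b \<otimes> a \<in> J i} \<subseteq> J i"
      proof (rule nakayama_ideal[OF U J.is_ideal xm[OF i]])
        fix c assume "c \<in> {a \<in> carrier R. b \<otimes> a \<in> J i}"
        then have c: "c \<in> carrier R" "b \<otimes> c \<in> J i" by simp_all
        have "b \<otimes> c \<in> J (Suc i)" using c(2) strict[OF i] by blast
        then have "c \<in> J (Suc i)" using J'.I_prime[OF b(1) c(1)] b(2) by blast
        then obtain j e where *: "j \<in> J i" "e \<in> carrier R" "c = j \<oplus> e \<otimes> x i" using Jx by blast
        have j: "j \<in> carrier R" using * J.Icarr by simp
        have "x i \<otimes> (b \<otimes> e) = b \<otimes> c \<ominus> b \<otimes> j"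
          unfolding *(3) using j *(2) b(1) xR by algebra
        then have "x i \<otimes> (b \<otimes> e) \<in> J i" using c(2) *(1) b(1) J.ideal_closed(2,5) by simp
        then have "b \<otimes> e \<in> J i" using reg[OF i] b(1) *(2) by simp
        then show "\<exists>j\<in>J i. \<exists>e\<in>{a \<in> carrier R. b \<otimes> a \<in> J i}. c = j \<oplus> e \<otimes> x i" using * by blast
      qed
      then show ?thesis using a ab by blast
    qed
    show ?case
    proof (rule primeidealI[OF J.is_ideal cring_axioms])
      show "carrier R \<noteq> J i" using one[of i] i by auto
      fix a b assume a: "a \<in> carrier R" and b: "b \<in> carrier R" and ab: "a \<otimes> b \<in> J i"
      show "a \<in> J i \<or> b \<in> J i"
      proof (rule ccontr)
        assume no: "\<not> (a \<in> J i \<or> b \<in> J i)"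
        \<comment> \<open>In place of Krull's intersection theorem, \<open>b\<close> is chosen with
          \<open>J i + bR\<close> as large as possible. If \<open>b = j + c x\<close>, then
          \<open>c\<close> is a candidate too and \<open>J i + cR\<close> contains
          \<open>J i + bR\<close>, so maximality gives \<open>c = k + e b\<close>. Hence
          \<open>(\<one> - e x) c\<close> lies in \<open>J i\<close>, and its first factor is a
          unit.\<close>
        let ?F = "{adjoin R (J i) b | b. b \<in> carrier R \<and> b \<notin> J i \<and> b \<otimes> a \<in> J i}"
        have ne: "?F \<noteq> {}" using no b ab m_comm[OF a b] by auto
        obtain M where M: "M \<in> ?F" "\<And>I. I \<in> ?F \<Longrightarrow> M \<subseteq> I \<Longrightarrow> I = M"
          by (rule maximal_ideal_in_family[OF ne]) (use adjoin(1)[OF J.is_ideal] in auto)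
        then obtain b where b: "b \<in> carrier R" "b \<notin> J i" "b \<otimes> a \<in> J i" "M = adjoin R (J i) b" by auto
        show False
        proof (cases "b \<in> J (Suc i)")
          case False then show False using key[OF a b(1) _ b(3)] no by auto
        next
          case True
          then obtain j c where *: "j \<in> J i" "c \<in> carrier R" "b = j \<oplus> c \<otimes> x i" using Jx by blast
          have j: "j \<in> carrier R" using * J.Icarr by simp
          have "x i \<otimes> (c \<otimes> a) = b \<otimes> a \<ominus> a \<otimes> j"
            unfolding *(3) using j *(2) a xR by algebra
          then have "x i \<otimes> (c \<otimes> a) \<in> J i" using b(3) *(1) a J.ideal_closed(2,5) by simp
          then have ca: "c \<otimes> a \<in> J i" using reg[OF i] a *(2) by simp
          have c: "c \<notin> J i"
          proof
            assume "c \<in> J i"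
            then have "x i \<otimes> c \<in> J i" by (rule J.ideal_closed(2)[OF xR])
            then have "c \<otimes> x i \<in> J i" by (subst m_comm[OF *(2) xR])
            then show False using b(2) J.ideal_closed(3)[OF *(1)] unfolding *(3) by simp
          qed
          note adj = adjoin[OF J.is_ideal *(2)]
          interpret Jc: ideal "adjoin R (J i) c" R by (rule adj)
          have "b \<in> adjoin R (J i) c"
            unfolding *(3) using *(1) adj(2,3) Jc.I_r_closed[OF adj(3) xR] Jc.ideal_closed(3) by blast
          then have "M \<subseteq> adjoin R (J i) c" unfolding b(4) by (intro adjoin(4)[OF J.is_ideal b(1)] adj)
          then have "adjoin R (J i) c = M" using M(2) *(2) c ca by blast
          then have "c \<in> adjoin R (J i) b" using adj b by simp
          then obtain k e where e: "k \<in> J i" "e \<in> carrier R" "c = k \<oplus> e \<otimes> b" unfolding adjoin_def by auto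
          have k: "k \<in> carrier R" using e J.Icarr by simp
          have "e \<otimes> x i \<in> \<mm>" using mm.I_l_closed[OF xm[OF i] e(2)] .
          then have "\<one> \<ominus> e \<otimes> x i \<notin> \<mm>"
            using mm.ideal_closed(3)[of "\<one> \<ominus> e \<otimes> x i" "e \<otimes> x i"] mm.prime_one e xR
            by (auto simp: add_minus_cancel)
          then obtain u where u: "u \<in> carrier R" "u \<otimes> (\<one> \<ominus> e \<otimes> x i) = \<one>"
            using unit_if_not_in_max[of "\<one> \<ominus> e \<otimes> x i"] e xR by auto
          have "(\<one> \<ominus> e \<otimes> x i) \<otimes> c = c \<ominus> e \<otimes> (c \<otimes> x i)" using e(2) xR *(2) by algebra
          also have "\<dots> = (k \<oplus> e \<otimes> b) \<ominus> e \<otimes> (c \<otimes> x i)" by (rule arg_cong[OF e(3)])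
          also have "\<dots> = (k \<oplus> e \<otimes> (j \<oplus> c \<otimes> x i)) \<ominus> e \<otimes> (c \<otimes> x i)" by (simp only: *(3)[symmetric])
          also have "\<dots> = k \<oplus> e \<otimes> j" using e(2) xR *(2) j k by algebra
          finally have "(\<one> \<ominus> e \<otimes> x i) \<otimes> c \<in> J i" using e(1,2) *(1) J.ideal_closed(2,3) by simp
          then have "u \<otimes> ((\<one> \<ominus> e \<otimes> x i) \<otimes> c) \<in> J i" using u J.ideal_closed(2) by simp
          moreover have "u \<otimes> ((\<one> \<ominus> e \<otimes> x i) \<otimes> c) = c" using u e(2) xR *(2) by (simp add: m_assoc[symmetric])
          ultimately show False using c by simp
        qed
      qed
    qed
  qed
  have chain: "prime_chain n J" using prime strict by (simp add: prime_chain_def)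
  have dim: "krull_dim R = enat n"
  proof (rule antisym)
    show "krull_dim R \<le> enat n" by (rule krull_dim_le) (rule prime_chain_length_le[OF tower zero top])
    show "enat n \<le> krull_dim R" unfolding krull_dim_prime_chain using chain by (intro Sup_upper) blast
  qed
  \<comment> \<open>\<open>regular_local_ring\<close> counts a set of generators, so the sequence
    must be free of repetitions.\<close>
  have "x i \<noteq> x j" if "i < j" "j < n" for i j
    using xJ[of j] id(3)[of i] id(2)[of "Suc i" j] that by auto
  then have "inj_on x {..<n}" by (intro linorder_inj_onI) auto
  then have "card (x ` {..<n}) = n" by (simp add: card_image)
  moreover have "Idl (x ` {..<n}) = \<mm>" using ideal_tower_genideal[OF tower zero, of n] top by simp
  moreover have "x ` {..<n} \<subseteq> carrier R" using id(4) by auto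
  ultimately show ?thesis unfolding regular_local_ring_def using dim noetherian_local_ring_axioms
    by (intro conjI exI[of _ "x ` {..<n}"]) auto
qed

end

section \<open>Free modules and minimal covers\<close>

lemma mod_homsI:
  assumes "\<And>x. x \<in> carrier M \<Longrightarrow> f x \<in> carrier N"
    and "\<And>x y. x \<in> carrier M \<Longrightarrow> y \<in> carrier M \<Longrightarrow> f (x \<oplus>\<^bsub>M\<^esub> y) = f x \<oplus>\<^bsub>N\<^esub> f y"
    and "\<And>a x. a \<in> carrier R \<Longrightarrow> x \<in> carrier M \<Longrightarrow> f (a \<odot>\<^bsub>M\<^esub> x) = a \<odot>\<^bsub>N\<^esub> f x"
  shows "f \<in> mod_homs R M N"
  using assms by (auto simp: mod_homs_def hom_def)

lemma mod_homsD:
  assumes "f \<in> mod_homs R M N"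
  shows "x \<in> carrier M \<Longrightarrow> f x \<in> carrier N"
    and "x \<in> carrier M \<Longrightarrow> y \<in> carrier M \<Longrightarrow> f (x \<oplus>\<^bsub>M\<^esub> y) = f x \<oplus>\<^bsub>N\<^esub> f y"
    and "a \<in> carrier R \<Longrightarrow> x \<in> carrier M \<Longrightarrow> f (a \<odot>\<^bsub>M\<^esub> x) = a \<odot>\<^bsub>N\<^esub> f x"
  using assms by (auto simp: mod_homs_def hom_def)

lemma mod_homs_comp:
  assumes "f \<in> mod_homs R M N" "g \<in> mod_homs R N P"
  shows "(\<lambda>x. g (f x)) \<in> mod_homs R M P"
  using mod_homsD[OF assms(1)] mod_homsD[OF assms(2)] by (intro mod_homsI) simp_all

lemma mod_homs_zero:
  assumes "module R M" "module R N" "f \<in> mod_homs R M N"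
  shows "f \<zero>\<^bsub>M\<^esub> = \<zero>\<^bsub>N\<^esub>"
proof -
  interpret M: module R M by fact
  interpret N: module R N by fact
  have "f (\<zero>\<^bsub>R\<^esub> \<odot>\<^bsub>M\<^esub> \<zero>\<^bsub>M\<^esub>) = \<zero>\<^bsub>R\<^esub> \<odot>\<^bsub>N\<^esub> f \<zero>\<^bsub>M\<^esub>"
    by (rule mod_homsD(3)[OF assms(3)]) simp_all
  then show ?thesis using mod_homsD(1)[OF assms(3), of "\<zero>\<^bsub>M\<^esub>"] by simp
qed

lemma mod_homs_minus:
  assumes "module R M" "module R N" "f \<in> mod_homs R M N" "x \<in> carrier M" "y \<in> carrier M"
  shows "f (x \<ominus>\<^bsub>M\<^esub> y) = f x \<ominus>\<^bsub>N\<^esub> f y"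
proof -
  interpret M: module R M by fact
  interpret N: module R N by fact
  have "f (x \<ominus>\<^bsub>M\<^esub> y) \<oplus>\<^bsub>N\<^esub> f y = f x"
    using assms mod_homsD(2)[OF assms(3), of "x \<ominus>\<^bsub>M\<^esub> y" y] by (simp add: M.add_minus_cancel)
  then show ?thesis
    using assms mod_homsD(1)[OF assms(3)] N.add_minus_cancel(1)[of "f (x \<ominus>\<^bsub>M\<^esub> y)" "f y"] by simp
qed

lemma mod_homs_add:
  assumes "module R N" "f \<in> mod_homs R M N" "g \<in> mod_homs R M N"
  shows "(\<lambda>x. f x \<oplus>\<^bsub>N\<^esub> g x) \<in> mod_homs R M N"
proof -
  interpret N: module R N by fact
  show ?thesis using mod_homsD[OF assms(2)] mod_homsD[OF assms(3)]
    by (intro mod_homsI) (simp_all add: N.a_ac N.smult_r_distr)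
qed

lemma mod_homs_uminus:
  assumes "module R N" "f \<in> mod_homs R M N"
  shows "(\<lambda>x. \<ominus>\<^bsub>N\<^esub> f x) \<in> mod_homs R M N"
proof -
  interpret N: module R N by fact
  show ?thesis using mod_homsD[OF assms(2)]
    by (intro mod_homsI) (simp_all add: N.minus_add N.a_comm N.smult_r_minus)
qed

lemma mod_homs_diff:
  assumes "module R N" "f \<in> mod_homs R M N" "g \<in> mod_homs R M N"
  shows "(\<lambda>x. f x \<ominus>\<^bsub>N\<^esub> g x) \<in> mod_homs R M N"
  using mod_homs_add[OF assms(1,2) mod_homs_uminus[OF assms(1,3)]] by (simp add: a_minus_def)

lemma mod_homs_finsum:
  assumes "module R M" "module R N" "f \<in> mod_homs R M N" "finite A" "g \<in> A \<rightarrow> carrier M"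
  shows "f (finsum M g A) = finsum N (\<lambda>i. f (g i)) A"
proof -
  interpret M: module R M by fact
  interpret N: module R N by fact
  show ?thesis using assms(4,5)
  proof (induction A rule: finite_induct)
    case empty then show ?case using mod_homs_zero[OF assms(1-3)] by simp
  next
    case (insert a A)
    then have "g \<in> A \<rightarrow> carrier M" "g a \<in> carrier M" by auto
    moreover from this have "(\<lambda>i. f (g i)) \<in> A \<rightarrow> carrier N" using mod_homsD(1)[OF assms(3)] by auto
    ultimately show ?case using insert mod_homsD(1,2)[OF assms(3)] by simp
  qed
qed

lemma kernel_submodule:
  assumes "module R M" "module R N" "f \<in> mod_homs R M N"
  shows "submodule (a_kernel M N f) R M"
proof -
  interpret M: module R M by fact
  interpret N: module R N by fact
  show ?thesis using mod_homsD[OF assms(3)] mod_homs_zero[OF assms]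
    by (intro M.submoduleI') (auto simp: a_kernel_def')
qed

lemma image_submodule:
  assumes "module R M" "module R N" "f \<in> mod_homs R M N" "submodule H R M"
  shows "submodule (f ` H) R N"
proof -
  interpret M: module R M by fact
  interpret N: module R N by fact
  note H = M.submoduleE'[OF assms(4)]
  show ?thesis
  proof (rule N.submoduleI')
    show "f ` H \<subseteq> carrier N" using H(1) mod_homsD(1)[OF assms(3)] by blast
    show "\<zero>\<^bsub>N\<^esub> \<in> f ` H" using H(2) mod_homs_zero[OF assms(1-3)] by force
    fix x y assume "x \<in> f ` H" "y \<in> f ` H"
    then obtain u v where *: "u \<in> H" "v \<in> H" "x = f u" "y = f v" by blast
    then have "x \<oplus>\<^bsub>N\<^esub> y = f (u \<oplus>\<^bsub>M\<^esub> v)" using H(1) mod_homsD(2)[OF assms(3)] by (simp add: subsetD)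
    then show "x \<oplus>\<^bsub>N\<^esub> y \<in> f ` H" using H(4) * by blast
  next
    fix a x assume a: "a \<in> carrier R" "x \<in> f ` H"
    then obtain u where *: "u \<in> H" "x = f u" by blast
    then have "a \<odot>\<^bsub>N\<^esub> x = f (a \<odot>\<^bsub>M\<^esub> u)" using a H(1) mod_homsD(3)[OF assms(3)] by (simp add: subsetD)
    then show "a \<odot>\<^bsub>N\<^esub> x \<in> f ` H" using H(3) * a by blast
  qed
qed

lemma submodule_module: "module R M \<Longrightarrow> submodule H R M \<Longrightarrow> module R (M\<lparr>carrier := H\<rparr>)"
  by (rule submodule.submodule_is_module)

lemma (in module) submodule_restrict:
  assumes K: "submodule K R M"
  shows "submodule H R (M\<lparr>carrier := K\<rparr>) \<longleftrightarrow> submodule H R M \<and> H \<subseteq> K"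
proof -
  interpret K: module R "M\<lparr>carrier := K\<rparr>" by (rule submodule.submodule_is_module[OF K module_axioms])
  show ?thesis
  proof
    assume H: "submodule H R (M\<lparr>carrier := K\<rparr>)"
    note * = K.submoduleE'(1-4)[OF H, simplified]
    show "submodule H R M \<and> H \<subseteq> K"
      using * submoduleE'(1)[OF K] by (auto intro!: submoduleI')
  next
    assume H: "submodule H R M \<and> H \<subseteq> K"
    then show "submodule H R (M\<lparr>carrier := K\<rparr>)"
      using submoduleE'[of H] by (intro K.submoduleI') auto
  qed
qed

lemma mod_homs_restrict:
  assumes "f \<in> mod_homs R M N" "H \<subseteq> carrier M" "\<And>x. x \<in> H \<Longrightarrow> f x \<in> K"
  shows "f \<in> mod_homs R (M\<lparr>carrier := H\<rparr>) (N\<lparr>carrier := K\<rparr>)"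
  using assms mod_homsD(2,3)[OF assms(1)] by (intro mod_homsI) (auto simp: subset_iff)

lemma (in module) finsum_in_submodule:
  assumes H: "submodule H R M" and "finite A" "\<And>i. i \<in> A \<Longrightarrow> g i \<in> H"
  shows "finsum M g A \<in> H"
  using assms(2,3)
proof (induction A rule: finite_induct)
  case empty then show ?case using submoduleE'[OF H] by simp
next
  case (insert a A)
  have "finsum M g (insert a A) = g a \<oplus>\<^bsub>M\<^esub> finsum M g A"
    using insert submoduleE'(1)[OF H] by (intro M.finsum_insert) auto
  then show ?case using insert submoduleE'(4)[OF H] by simp
qed

text \<open>Generation is expressed without linear combinations: \<open>T\<close> lies in no proper
  submodule. This form combines directly with Nakayama's lemma.\<close>

definition finitely_generated :: "('a, 'r) ring_scheme \<Rightarrow> ('a, 'b) module \<Rightarrow> bool" where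
  "finitely_generated R M \<longleftrightarrow> (\<exists>T \<subseteq> carrier M. finite T \<and>
     (\<forall>H. submodule H R M \<longrightarrow> T \<subseteq> H \<longrightarrow> carrier M \<subseteq> H))"

lemma fin_gen_module_finitely_generated:
  assumes "fin_gen_module R M"
  shows "finitely_generated R M"
proof -
  interpret module R M using assms by (simp add: fin_gen_module_def)
  obtain S where S: "S \<subseteq> carrier M" "finite S"
    "carrier M = {finsum M (\<lambda>s. a s \<odot>\<^bsub>M\<^esub> s) S | a. a \<in> S \<rightarrow> carrier R}"
    using assms unfolding fin_gen_module_def by blast
  have "carrier M \<subseteq> H" if H: "submodule H R M" "S \<subseteq> H" for H
  proof
    fix m assume "m \<in> carrier M"
    then obtain a where a: "m = finsum M (\<lambda>s. a s \<odot>\<^bsub>M\<^esub> s) S" "a \<in> S \<rightarrow> carrier R" using S(3) by blast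
    show "m \<in> H" unfolding a(1)
      by (rule finsum_in_submodule[OF H(1) S(2)]) (use a(2) H submoduleE'(3)[OF H(1)] in blast)
  qed
  then show ?thesis unfolding finitely_generated_def using S by blast
qed

section \<open>Free modules of finite rank\<close>

definition free_module :: "('a, 'r) ring_scheme \<Rightarrow> 'i set \<Rightarrow> ('a, 'i \<Rightarrow> 'a) module" where
  "free_module R I = \<lparr>carrier = {f. (\<forall>i. f i \<in> carrier R) \<and> (\<forall>i. i \<notin> I \<longrightarrow> f i = \<zero>\<^bsub>R\<^esub>)},
     mult = undefined, one = undefined, zero = (\<lambda>_. \<zero>\<^bsub>R\<^esub>), add = (\<lambda>f g i. f i \<oplus>\<^bsub>R\<^esub> g i),
     smult = (\<lambda>a f i. a \<otimes>\<^bsub>R\<^esub> f i)\<rparr>"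

lemma free_module_simps [simp]:
  "zero (free_module R I) = (\<lambda>_. \<zero>\<^bsub>R\<^esub>)"
  "add (free_module R I) = (\<lambda>f g i. f i \<oplus>\<^bsub>R\<^esub> g i)"
  "smult (free_module R I) = (\<lambda>a f i. a \<otimes>\<^bsub>R\<^esub> f i)"
  by (simp_all add: free_module_def)

lemma free_module_carrier:
  "f \<in> carrier (free_module R I) \<longleftrightarrow> (\<forall>i. f i \<in> carrier R) \<and> (\<forall>i. i \<notin> I \<longrightarrow> f i = \<zero>\<^bsub>R\<^esub>)"
  by (simp add: free_module_def)

definition lincomb :: "('a, 'b) module \<Rightarrow> ('i \<Rightarrow> 'b) \<Rightarrow> 'i set \<Rightarrow> ('i \<Rightarrow> 'a) \<Rightarrow> 'b" where
  "lincomb M v I f = finsum M (\<lambda>i. f i \<odot>\<^bsub>M\<^esub> v i) I"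

definition unit_vec :: "('a, 'r) ring_scheme \<Rightarrow> 'i \<Rightarrow> 'i \<Rightarrow> 'a" where
  "unit_vec R i = (\<lambda>j. if j = i then \<one>\<^bsub>R\<^esub> else \<zero>\<^bsub>R\<^esub>)"

context cring
begin

lemma free_module: "module R (free_module R I)"
proof (rule moduleI)
  show "abelian_group (free_module R I)"
  proof (rule abelian_groupI)
    fix f assume f: "f \<in> carrier (free_module R I)"
    then show "\<exists>g\<in>carrier (free_module R I). g \<oplus>\<^bsub>free_module R I\<^esub> f = \<zero>\<^bsub>free_module R I\<^esub>"
      by (intro bexI[of _ "\<lambda>i. \<ominus> f i"]) (auto simp: free_module_carrier l_neg)
  qed (auto simp: free_module_carrier a_ac)
qed (auto simp: free_module_carrier cring_axioms l_distr r_distr m_assoc)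

lemma free_module_minus:
  assumes "f \<in> carrier (free_module R I)" "g \<in> carrier (free_module R I)"
  shows "f \<ominus>\<^bsub>free_module R I\<^esub> g = (\<lambda>i. f i \<ominus> g i)"
proof -
  interpret F: module R "free_module R I" by (rule free_module)
  define h where "h = (\<lambda>i. f i \<ominus> g i)"
  have h: "h \<in> carrier (free_module R I)" using assms by (auto simp: free_module_carrier h_def a_minus_def)
  have "h \<oplus>\<^bsub>free_module R I\<^esub> g = f"
    using assms by (auto simp: free_module_carrier h_def add_minus_cancel)
  then show ?thesis using F.add_minus_cancel(1)[OF h assms(2)] h_def by simp
qed

lemma free_module_mono: "I \<subseteq> J \<Longrightarrow> carrier (free_module R I) \<subseteq> carrier (free_module R J)"
  by (fastforce simp: free_module_carrier)

lemma unit_vec_closed: "i \<in> I \<Longrightarrow> unit_vec R i \<in> carrier (free_module R I)"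
  by (auto simp: free_module_carrier unit_vec_def)

lemma finsum_free_module:
  assumes "finite A" "g \<in> A \<rightarrow> carrier (free_module R I)"
  shows "finsum (free_module R I) g A = (\<lambda>j. \<Oplus>i\<in>A. g i j)"
  using assms
proof (induction A rule: finite_induct)
  interpret F: module R "free_module R I" by (rule free_module)
  case empty
  then show ?case by (simp add: F.M.finsum_empty)
next
  interpret F: module R "free_module R I" by (rule free_module)
  case (insert a A)
  have "g i j \<in> carrier R" if "i \<in> insert a A" for i j
    using funcset_mem[OF insert.prems that] by (simp add: free_module_carrier)
  then have "(\<lambda>i. g i j) \<in> A \<rightarrow> carrier R" "g a j \<in> carrier R" for j by auto
  then show ?case using insert by (simp add: F.M.finsum_insert)
qed

lemma free_module_expand:
  assumes I: "finite I" and f: "f \<in> carrier (free_module R I)"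
  shows "f = lincomb (free_module R I) (unit_vec R) I f"
proof
  fix j
  interpret F: module R "free_module R I" by (rule free_module)
  have fR: "f i \<in> carrier R" for i using f by (simp add: free_module_carrier)
  have "(\<lambda>i. f i \<odot>\<^bsub>free_module R I\<^esub> unit_vec R i) \<in> I \<rightarrow> carrier (free_module R I)"
    by (intro funcsetI F.smult_closed fR unit_vec_closed)
  then have "lincomb (free_module R I) (unit_vec R) I f j = (\<Oplus>i\<in>I. f i \<otimes> unit_vec R i j)"
    unfolding lincomb_def by (simp only: finsum_free_module[OF I]) simp
  also have "\<dots> = (\<Oplus>i\<in>I. if j = i then f i else \<zero>)"
    by (rule add.finprod_cong') (auto simp: unit_vec_def fR)
  also have "\<dots> = f j"
  proof (cases "j \<in> I")
    case True
    then show ?thesis using add.finprod_singleton[OF True I, of f] fR by (simp add: finsum_def Pi_def)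
  next
    case False
    then have "(\<Oplus>i\<in>I. if j = i then f i else \<zero>) = (\<Oplus>i\<in>I. \<zero>)"
      by (intro add.finprod_cong') auto
    then show ?thesis using False f by (simp add: free_module_carrier)
  qed
  finally show "f j = lincomb (free_module R I) (unit_vec R) I f j" by simp
qed

end

lemma lincomb_hom:
  fixes M :: "('a, 'b) module"
  assumes M: "module R M" and I: "finite I" and v: "\<And>i. i \<in> I \<Longrightarrow> v i \<in> carrier M"
  shows "lincomb M v I \<in> mod_homs R (free_module R I) M"
proof -
  interpret module R M by fact
  have fv: "(\<lambda>i. f i \<odot>\<^bsub>M\<^esub> v i) \<in> I \<rightarrow> carrier M" if "f \<in> carrier (free_module R I)" for f
    using that v by (simp add: free_module_carrier)
  show ?thesis
  proof (rule mod_homsI)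
    fix f assume f: "f \<in> carrier (free_module R I)"
    show "lincomb M v I f \<in> carrier M" unfolding lincomb_def by (rule M.finsum_closed[OF fv[OF f]])
    fix a assume a: "a \<in> carrier R"
    show "lincomb M v I (a \<odot>\<^bsub>free_module R I\<^esub> f) = a \<odot>\<^bsub>M\<^esub> lincomb M v I f"
      unfolding lincomb_def finsum_smult_ldistr[OF I a fv[OF f]]
      by (rule M.add.finprod_cong') (use f v a in \<open>auto simp: free_module_carrier smult_assoc1\<close>)
  next
    fix f g assume f: "f \<in> carrier (free_module R I)" and g: "g \<in> carrier (free_module R I)"
    have "lincomb M v I (f \<oplus>\<^bsub>free_module R I\<^esub> g) = finsum M (\<lambda>i. f i \<odot>\<^bsub>M\<^esub> v i \<oplus>\<^bsub>M\<^esub> g i \<odot>\<^bsub>M\<^esub> v i) I"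
      unfolding lincomb_def
      by (rule M.add.finprod_cong') (use f g v in \<open>auto simp: free_module_carrier smult_l_distr\<close>)
    also have "\<dots> = lincomb M v I f \<oplus>\<^bsub>M\<^esub> lincomb M v I g"
      unfolding lincomb_def by (rule M.finsum_addf[OF fv[OF f] fv[OF g]])
    finally show "lincomb M v I (f \<oplus>\<^bsub>free_module R I\<^esub> g) = lincomb M v I f \<oplus>\<^bsub>M\<^esub> lincomb M v I g" .
  qed
qed

lemma hom_free_eq_lincomb:
  fixes M :: "('a, 'b) module"
  assumes M: "module R M" and I: "finite I" and h: "h \<in> mod_homs R (free_module R I) M"
    and f: "f \<in> carrier (free_module R I)"
  shows "h f = lincomb M (\<lambda>i. h (unit_vec R i)) I f"
proof -
  interpret module R M by fact
  interpret F: module R "free_module R I" by (rule free_module)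
  have fR: "f i \<in> carrier R" for i using f by (simp add: free_module_carrier)
  have u: "i \<in> I \<Longrightarrow> unit_vec R i \<in> carrier (free_module R I)" for i by (rule unit_vec_closed)
  have "h f = h (lincomb (free_module R I) (unit_vec R) I f)"
    using free_module_expand[OF I f] by simp
  also have "\<dots> = finsum M (\<lambda>i. h (f i \<odot>\<^bsub>free_module R I\<^esub> unit_vec R i)) I"
    unfolding lincomb_def
    by (rule mod_homs_finsum[OF free_module M h I]) (intro funcsetI F.smult_closed fR u)
  also have "\<dots> = lincomb M (\<lambda>i. h (unit_vec R i)) I f"
    unfolding lincomb_def
    by (rule M.add.finprod_cong'[OF refl])
      (simp_all only: mod_homsD(3)[OF h fR u], intro funcsetI smult_closed fR mod_homsD(1)[OF h] u)
  finally show ?thesis .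
qed

lemma lincomb_unit_vec:
  fixes M :: "('a, 'b) module"
  assumes M: "module R M" and I: "finite I" and v: "\<And>i. i \<in> I \<Longrightarrow> v i \<in> carrier M" and i: "i \<in> I"
  shows "lincomb M v I (unit_vec R i) = v i"
proof -
  interpret module R M by fact
  have "lincomb M v I (unit_vec R i) = finsum M (\<lambda>j. if i = j then v j else \<zero>\<^bsub>M\<^esub>) I"
    unfolding lincomb_def by (rule M.add.finprod_cong') (use v in \<open>auto simp: unit_vec_def\<close>)
  also have "\<dots> = v i" using M.add.finprod_singleton[OF i I, of v] v by (simp add: finsum_def Pi_def)
  finally show ?thesis .
qed

text \<open>The lifting property holds for modules \<open>X\<close> and \<open>Y\<close> on
  arbitrary types, in contrast to \<open>projective_module\<close>, which tests a single type. It
  suffices to choose preimages for the unit vectors.\<close>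

lemma free_module_lift:
  fixes X :: "('a, 'b) module" and Y :: "('a, 'c) module"
  assumes X: "module R X" and Y: "module R Y" and I: "finite I"
    and f: "f \<in> mod_homs R X Y" "f ` carrier X = carrier Y"
    and g: "g \<in> mod_homs R (free_module R I) Y"
  shows "\<exists>h \<in> mod_homs R (free_module R I) X. \<forall>x \<in> carrier (free_module R I). f (h x) = g x"
proof -
  interpret X: module R X by fact
  interpret Y: module R Y by fact
  have "\<forall>i\<in>I. \<exists>x. x \<in> carrier X \<and> f x = g (unit_vec R i)"
  proof
    fix i assume "i \<in> I"
    then have "g (unit_vec R i) \<in> f ` carrier X"
      unfolding f(2) by (intro mod_homsD(1)[OF g] X.unit_vec_closed)
    then show "\<exists>x. x \<in> carrier X \<and> f x = g (unit_vec R i)" by (auto simp: image_iff)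
  qed
  from bchoice[OF this] obtain v where v: "\<And>i. i \<in> I \<Longrightarrow> v i \<in> carrier X"
    "\<And>i. i \<in> I \<Longrightarrow> f (v i) = g (unit_vec R i)" by blast
  let ?h = "lincomb X v I"
  have h: "?h \<in> mod_homs R (free_module R I) X" by (rule lincomb_hom[OF X I v(1)])
  have "f (?h x) = g x" if x: "x \<in> carrier (free_module R I)" for x
  proof -
    have "f (?h x) = lincomb Y (\<lambda>i. f (?h (unit_vec R i))) I x"
      by (rule hom_free_eq_lincomb[OF Y I mod_homs_comp[OF h f(1)] x])
    also have "\<dots> = lincomb Y (\<lambda>i. g (unit_vec R i)) I x"
      unfolding lincomb_def[of Y]
    proof (rule Y.M.add.finprod_cong'[OF refl, folded finsum_def])
      show "(\<lambda>i. x i \<odot>\<^bsub>Y\<^esub> g (unit_vec R i)) \<in> I \<rightarrow> carrier Y"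
        using x by (intro funcsetI Y.smult_closed mod_homsD(1)[OF g] X.unit_vec_closed) (simp_all add: free_module_carrier)
      show "x i \<odot>\<^bsub>Y\<^esub> f (lincomb X v I (unit_vec R i)) = x i \<odot>\<^bsub>Y\<^esub> g (unit_vec R i)" if "i \<in> I" for i
        using lincomb_unit_vec[OF X I v(1) that] v(2)[OF that] by simp
    qed
    also have "\<dots> = g x" using hom_free_eq_lincomb[OF Y I g x] by simp
    finally show ?thesis .
  qed
  then show ?thesis using h by blast
qed

lemma a_kernel_iff: "x \<in> a_kernel M N f \<longleftrightarrow> x \<in> carrier M \<and> f x = \<zero>\<^bsub>N\<^esub>"
  by (simp add: a_kernel_def')

lemma mod_homs_free_mono:
  assumes "f \<in> mod_homs R (free_module R J) M" "carrier (free_module R I) \<subseteq> carrier (free_module R J)"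
  shows "f \<in> mod_homs R (free_module R I) M"
proof (rule mod_homsI)
  fix x y assume x: "x \<in> carrier (free_module R I)" and y: "y \<in> carrier (free_module R I)"
  then have x': "x \<in> carrier (free_module R J)" and y': "y \<in> carrier (free_module R J)" using assms(2) by auto
  show "f x \<in> carrier M" by (rule mod_homsD(1)[OF assms(1) x'])
  show "f (x \<oplus>\<^bsub>free_module R I\<^esub> y) = f x \<oplus>\<^bsub>M\<^esub> f y"
    using mod_homsD(2)[OF assms(1) x' y'] by simp
next
  fix a x assume a: "a \<in> carrier R" and "x \<in> carrier (free_module R I)"
  then have x': "x \<in> carrier (free_module R J)" using assms(2) by auto
  show "f (a \<odot>\<^bsub>free_module R I\<^esub> x) = a \<odot>\<^bsub>M\<^esub> f x"
    using mod_homsD(3)[OF assms(1) a x'] by simp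
qed

context cring
begin

text \<open>The modules for all index sets sit inside the one for \<open>UNIV\<close>. It serves as
  a common ambient module in which submodules for different index sets can be compared.\<close>

lemma free_module_restrict: "free_module R I = (free_module R UNIV)\<lparr>carrier := carrier (free_module R I)\<rparr>"
  by (simp add: free_module_def)

lemma free_module_submodule: "submodule (carrier (free_module R I)) R (free_module R UNIV)"
proof -
  interpret F: module R "free_module R UNIV" by (rule free_module)
  show ?thesis by (rule F.submoduleI') (auto simp: free_module_carrier)
qed

lemma submodule_free_iff:
  "submodule K R (free_module R I) \<longleftrightarrow>
    submodule K R (free_module R UNIV) \<and> K \<subseteq> carrier (free_module R I)"
proof -
  interpret F: module R "free_module R UNIV" by (rule free_module)
  show ?thesis
    by (subst free_module_restrict) (rule F.submodule_restrict[OF free_module_submodule])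
qed

lemma coordinate_ideal:
  assumes "submodule K R (free_module R UNIV)"
  shows "ideal ((\<lambda>f. f j) ` K) R"
proof -
  interpret F: module R "free_module R UNIV" by (rule free_module)
  note K = F.submoduleE'[OF assms]
  show ?thesis
  proof (rule idealI')
    show "(\<lambda>f. f j) ` K \<subseteq> carrier R" using K(1) by (auto simp: free_module_carrier)
    show "\<zero> \<in> (\<lambda>f. f j) ` K" using K(2) by force
    fix x y assume "x \<in> (\<lambda>f. f j) ` K" "y \<in> (\<lambda>f. f j) ` K"
    then obtain f g where *: "f \<in> K" "g \<in> K" "x = f j" "y = g j" by blast
    have "x \<oplus> y = (f \<oplus>\<^bsub>free_module R UNIV\<^esub> g) j" using * by simp
    then show "x \<oplus> y \<in> (\<lambda>f. f j) ` K" using K(4)[OF *(1,2)] by blast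
  next
    fix a x assume a: "a \<in> carrier R" "x \<in> (\<lambda>f. f j) ` K"
    then obtain f where *: "f \<in> K" "x = f j" by blast
    have "a \<otimes> x = (a \<odot>\<^bsub>free_module R UNIV\<^esub> f) j" using * by simp
    then show "a \<otimes> x \<in> (\<lambda>f. f j) ` K" using K(3)[OF a(1) *(1)] by blast
  qed
qed

end

text \<open>Induction on the rank: the \<open>j\<close>-th coordinates of \<open>K\<close> form a
  finitely generated ideal, and the elements whose \<open>j\<close>-th coordinate vanishes lie in
  the smaller free module.\<close>

lemma (in noetherian_cring) free_submodule_generators:
  assumes "finite I"
  shows "submodule K R (free_module R UNIV) \<Longrightarrow> K \<subseteq> carrier (free_module R I) \<Longrightarrow>
    \<exists>T \<subseteq> K. finite T \<and> (\<forall>H. submodule H R (free_module R UNIV) \<longrightarrow> T \<subseteq> H \<longrightarrow> K \<subseteq> H)"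
  using assms
proof (induction I arbitrary: K rule: finite_induct)
  case empty
  interpret F: module R "free_module R UNIV" by (rule free_module)
  have "K \<subseteq> {\<lambda>_. \<zero>}" using empty.prems(2) by (force simp: free_module_carrier)
  then show ?case using F.submoduleE'(2) by (intro exI[of _ "{}"]) auto
next
  case (insert j I)
  interpret F: module R "free_module R UNIV" by (rule free_module)
  note K = F.submoduleE'[OF insert.prems(1)]
  obtain A where A: "A \<subseteq> carrier R" "finite A" "(\<lambda>f. f j) ` K = Idl A"
    using finetely_gen[OF coordinate_ideal[OF insert.prems(1)]] by blast
  have "A \<subseteq> (\<lambda>f. f j) ` K" unfolding A(3) by (rule genideal_self[OF A(1)])
  then have "\<forall>a\<in>A. \<exists>f. f \<in> K \<and> f j = a" by blast
  from bchoice[OF this] obtain g where g: "\<And>a. a \<in> A \<Longrightarrow> g a \<in> K" "\<And>a. a \<in> A \<Longrightarrow> g a j = a" by blast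
  define K0 where "K0 = K \<inter> carrier (free_module R I)"
  note FI = F.submoduleE'[OF free_module_submodule[of I]]
  have K0: "submodule K0 R (free_module R UNIV)"
    unfolding K0_def using K(1-4) FI(1-4) by (intro F.submoduleI') auto
  have "K0 \<subseteq> carrier (free_module R I)" by (simp add: K0_def)
  from insert.IH[OF K0 this] obtain T where T: "T \<subseteq> K0" "finite T"
    "\<And>H. submodule H R (free_module R UNIV) \<Longrightarrow> T \<subseteq> H \<Longrightarrow> K0 \<subseteq> H" by blast
  have "K \<subseteq> H" if H: "submodule H R (free_module R UNIV)" "T \<union> g ` A \<subseteq> H" for H
  proof
    fix f assume f: "f \<in> K"
    note H' = F.submoduleE'[OF H(1)]
    \<comment> \<open>\<open>H \<inter> K\<close> already realises all \<open>j\<close>-th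
      coordinates of \<open>K\<close>, so \<open>f\<close> can be corrected by some \<open>h\<close>
      in it to an element of \<open>K0\<close>.\<close>
    have HK: "submodule (H \<inter> K) R (free_module R UNIV)"
    proof (rule F.submoduleI')
      show "H \<inter> K \<subseteq> carrier (free_module R UNIV)" using K(1) by blast
      show "\<zero>\<^bsub>free_module R UNIV\<^esub> \<in> H \<inter> K" using K(2) H'(2) by blast
    qed (use K(3,4) H'(3,4) in \<open>blast+\<close>)
    have "A \<subseteq> (\<lambda>f. f j) ` (H \<inter> K)"
    proof
      fix a assume a: "a \<in> A"
      have "g a \<in> H \<inter> K" using g(1)[OF a] H(2) a by blast
      then show "a \<in> (\<lambda>f. f j) ` (H \<inter> K)" using g(2)[OF a] by (metis image_eqI)
    qed
    then have "Idl A \<subseteq> (\<lambda>f. f j) ` (H \<inter> K)" by (rule genideal_minimal[OF coordinate_ideal[OF HK]])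
    then obtain h where h: "h \<in> H" "h \<in> K" "f j = h j" using f A(3) by blast
    define k where "k = f \<ominus>\<^bsub>free_module R UNIV\<^esub> h"
    have kK: "k \<in> K" unfolding k_def by (rule K(6)[OF f h(2)])
    have "k j = \<zero>"
      using f h K(1) by (subst k_def, subst free_module_minus) (auto simp: free_module_carrier a_minus_def r_neg)
    then have "k \<in> K0"
      unfolding K0_def using kK insert.prems(2) by (fastforce simp: free_module_carrier)
    then have "k \<in> H" using T(3)[OF H(1)] H(2) by blast
    then have "k \<oplus>\<^bsub>free_module R UNIV\<^esub> h \<in> H" by (rule H'(4)[OF _ h(1)])
    moreover have "k \<oplus>\<^bsub>free_module R UNIV\<^esub> h = f"
      unfolding k_def by (rule F.M.add_minus_cancel(2)) (use f h K(1) in blast)+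
    ultimately show "f \<in> H" by simp
  qed
  then show ?case using T A(2) g(1) by (intro exI[of _ "T \<union> g ` A"]) (auto simp: K0_def)
qed

lemma (in noetherian_cring) free_submodule_finitely_generated:
  assumes "finite I" "submodule K R (free_module R I)"
  shows "finitely_generated R ((free_module R I)\<lparr>carrier := K\<rparr>)"
proof -
  interpret F: module R "free_module R I" by (rule free_module)
  have K: "submodule K R (free_module R UNIV)" "K \<subseteq> carrier (free_module R I)"
    using assms(2) submodule_free_iff by blast+
  obtain T where T: "T \<subseteq> K" "finite T"
    "\<And>H. submodule H R (free_module R UNIV) \<Longrightarrow> T \<subseteq> H \<Longrightarrow> K \<subseteq> H"
    using free_submodule_generators[OF assms(1) K] by blast
  show ?thesis
    unfolding finitely_generated_def
  proof (intro exI[of _ T] conjI allI impI)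
    show "T \<subseteq> carrier ((free_module R I)\<lparr>carrier := K\<rparr>)" using T by simp
    fix H assume H: "submodule H R ((free_module R I)\<lparr>carrier := K\<rparr>)" "T \<subseteq> H"
    then have "submodule H R (free_module R I)" using F.submodule_restrict[OF assms(2)] by blast
    then have "submodule H R (free_module R UNIV)" using submodule_free_iff[of H I] by blast
    then show "carrier ((free_module R I)\<lparr>carrier := K\<rparr>) \<subseteq> H" using T(3) H(2) by simp
  qed (rule T)
qed

text \<open>The generators are numbered, so the free module consists of functions on the natural
  numbers whatever the type of \<open>M\<close>. All later syzygies can then stay on that one
  type.\<close>

lemma finitely_generated_cover:
  fixes M :: "('a, 'b) module"
  assumes M: "module R M" "finitely_generated R M"
  obtains I :: "nat set" and e where "finite I" "e \<in> mod_homs R (free_module R I) M"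
    "e ` carrier (free_module R I) = carrier M"
proof -
  interpret module R M by fact
  obtain T where T: "T \<subseteq> carrier M" "finite T" "\<And>H. submodule H R M \<Longrightarrow> T \<subseteq> H \<Longrightarrow> carrier M \<subseteq> H"
    using M(2) unfolding finitely_generated_def by blast
  obtain v :: "nat \<Rightarrow> 'b" where v: "bij_betw v {0..<card T} T" using ex_bij_betw_nat_finite[OF T(2)] by blast
  define I where "I = {0..<card T}"
  have I: "finite I" by (simp add: I_def)
  have vM: "v i \<in> carrier M" if "i \<in> I" for i using that v T(1) by (auto simp: I_def bij_betw_def)
  let ?e = "lincomb M v I"
  have e: "?e \<in> mod_homs R (free_module R I) M" by (rule lincomb_hom[OF M(1) I vM])
  have "T \<subseteq> ?e ` carrier (free_module R I)"
  proof
    fix t assume "t \<in> T"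
    then have "t \<in> v ` I" using v by (simp add: I_def bij_betw_def)
    then obtain i where i: "i \<in> I" "t = v i" by blast
    then have "t = ?e (unit_vec R i)" using lincomb_unit_vec[OF M(1) I vM] by simp
    then show "t \<in> ?e ` carrier (free_module R I)" using unit_vec_closed[OF i(1)] by blast
  qed
  moreover have "submodule (?e ` carrier (free_module R I)) R M"
  proof -
    interpret F: module R "free_module R I" by (rule free_module)
    show ?thesis by (rule image_submodule[OF F.module_axioms M(1) e F.carrier_is_submodule])
  qed
  ultimately have "carrier M \<subseteq> ?e ` carrier (free_module R I)" using T(3) by blast
  then have "?e ` carrier (free_module R I) = carrier M" using mod_homsD(1)[OF e] by blast
  then show ?thesis using that I e by blast
qed

definition minimal_cover ::
  "('a, 'r) ring_scheme \<Rightarrow> ('a, 'b) module \<Rightarrow> nat set \<Rightarrow> ((nat \<Rightarrow> 'a) \<Rightarrow> 'b) \<Rightarrow> bool" where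
  "minimal_cover R M I e \<longleftrightarrow> finite I \<and> e \<in> mod_homs R (free_module R I) M \<and>
     e ` carrier (free_module R I) = carrier M \<and>
     (\<forall>f \<in> a_kernel (free_module R I) M e. \<forall>i. f i \<in> max_ideal R)"

text \<open>A cover with the least number of generators is minimal: a relation with a unit as
  \<open>j\<close>-th coefficient would express the \<open>j\<close>-th generator by the
  others.\<close>

lemma (in noetherian_local_ring) minimal_cover_exists:
  assumes M: "module R M" "finitely_generated R M"
  obtains I e where "minimal_cover R M I e"
proof -
  interpret M: module R M by fact
  define P where "P n \<longleftrightarrow> (\<exists>(I :: nat set) e. finite I \<and> card I = n \<and> e \<in> mod_homs R (free_module R I) M \<and>
     e ` carrier (free_module R I) = carrier M)" for n
  obtain I0 :: "nat set" and e0 where "finite I0" "e0 \<in> mod_homs R (free_module R I0) M"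
    "e0 ` carrier (free_module R I0) = carrier M" by (rule finitely_generated_cover[OF M])
  then have "P (card I0)" unfolding P_def by blast
  define k where "k = (LEAST n. P n)"
  have "P k" unfolding k_def by (rule LeastI) fact
  then obtain I :: "nat set" and e where I: "finite I" "card I = k" and e: "e \<in> mod_homs R (free_module R I) M"
     "e ` carrier (free_module R I) = carrier M" unfolding P_def by blast
  have "f j \<in> \<mm>" if f: "f \<in> a_kernel (free_module R I) M e" for f j
  proof (rule ccontr)
    interpret F: module R "free_module R I" by (rule free_module)
    assume fj: "f j \<notin> \<mm>"
    have fF: "f \<in> carrier (free_module R I)" and ef: "e f = \<zero>\<^bsub>M\<^esub>" using f by (simp_all add: a_kernel_iff)
    have fR: "f i \<in> carrier R" for i using fF by (simp add: free_module_carrier)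
    have "f j \<noteq> \<zero>" using fj mm.ideal_closed(1) by metis
    then have jI: "j \<in> I" using fF by (auto simp: free_module_carrier)
    obtain u where u: "u \<in> carrier R" "u \<otimes> f j = \<one>" using unit_if_not_in_max[of "f j"] fj fR[of j] by blast
    have sub: "carrier (free_module R (I - {j})) \<subseteq> carrier (free_module R I)" by (rule free_module_mono) auto
    have e': "e \<in> mod_homs R (free_module R (I - {j})) M" by (rule mod_homs_free_mono[OF e(1) sub])
    have "carrier M \<subseteq> e ` carrier (free_module R (I - {j}))"
    proof
      fix m assume "m \<in> carrier M"
      then obtain g where g: "g \<in> carrier (free_module R I)" "m = e g" using e(2) by auto
      have gR: "g i \<in> carrier R" for i using g by (simp add: free_module_carrier)
      \<comment> \<open>Subtracting this multiple of the relation \<open>f\<close> clears the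
        coordinate \<open>j\<close> and leaves the image under \<open>e\<close> unchanged.\<close>
      define h where "h = g \<ominus>\<^bsub>free_module R I\<^esub> (g j \<otimes> u) \<odot>\<^bsub>free_module R I\<^esub> f"
      have cF: "(g j \<otimes> u) \<odot>\<^bsub>free_module R I\<^esub> f \<in> carrier (free_module R I)"
        by (rule F.smult_closed[OF _ fF]) (simp add: gR u)
      have hF: "h \<in> carrier (free_module R I)" unfolding h_def by (rule F.M.minus_closed[OF g(1) cF])
      have "h j = g j \<ominus> (g j \<otimes> u) \<otimes> f j" unfolding h_def free_module_minus[OF g(1) cF] by simp
      also have "\<dots> = \<zero>" using u gR fR by (simp add: m_assoc a_minus_def r_neg)
      finally have "h j = \<zero>" .
      then have hF': "h \<in> carrier (free_module R (I - {j}))"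
        using hF by (fastforce simp: free_module_carrier)
      have "e h = m \<ominus>\<^bsub>M\<^esub> (g j \<otimes> u) \<odot>\<^bsub>M\<^esub> \<zero>\<^bsub>M\<^esub>"
        unfolding h_def mod_homs_minus[OF free_module M(1) e(1) g(1) cF]
        using mod_homsD(3)[OF e(1) _ fF, of "g j \<otimes> u"] gR u ef g by simp
      also have "\<dots> = m" using gR u \<open>m \<in> carrier M\<close> by (simp add: a_minus_def)
      finally show "m \<in> e ` carrier (free_module R (I - {j}))" using hF' by blast
    qed
    then have "e ` carrier (free_module R (I - {j})) = carrier M" using mod_homsD(1)[OF e'] by blast
    then have "P (card (I - {j}))" unfolding P_def using I(1) e' by blast
    then have "card I \<le> card (I - {j})" unfolding I(2) k_def by (rule Least_le)
    then show False using jI I(1) card_Diff1_less[of I j] by simp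
  qed
  then have "minimal_cover R M I e" unfolding minimal_cover_def using I(1) e by blast
  then show ?thesis by (rule that)
qed

section \<open>Finite resolutions and stable retracts\<close>

text \<open>Lifting along a single given map, so that no quantification over modules, and hence over
  types, is involved.\<close>

definition lifts ::
  "('a, 'r) ring_scheme \<Rightarrow> ('a, 'p) module \<Rightarrow> ('a, 'b) module \<Rightarrow> ('a, 'c) module \<Rightarrow> ('b \<Rightarrow> 'c) \<Rightarrow> bool" where
  "lifts R P X Y f \<longleftrightarrow> (\<forall>g \<in> mod_homs R P Y. \<exists>h \<in> mod_homs R P X. \<forall>x \<in> carrier P. f (h x) = g x)"

text \<open>\<open>M\<close> is a retract of \<open>G\<close> in the stable category: the identity of \<open>M\<close> factors through \<open>G\<close>
  up to a map that factors through the projective \<open>F\<close>.\<close>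

definition stable_retract ::
  "('a, 'r) ring_scheme \<Rightarrow> ('a, 'm) module \<Rightarrow> ('a, 'g) module \<Rightarrow> ('a, 'f) module \<Rightarrow> ('f \<Rightarrow> 'm) \<Rightarrow> bool" where
  "stable_retract R M G F e \<longleftrightarrow> (\<exists>i \<in> mod_homs R M G. \<exists>p \<in> mod_homs R G M. \<exists>t \<in> mod_homs R M F.
     \<forall>m \<in> carrier M. p (i m) = m \<oplus>\<^bsub>M\<^esub> e (t m))"

abbreviation kernel_module ::
  "('a, 'f) module \<Rightarrow> ('a, 'm) module \<Rightarrow> ('f \<Rightarrow> 'm) \<Rightarrow> ('a, 'f) module" where
  "kernel_module F M e \<equiv> F\<lparr>carrier := a_kernel F M e\<rparr>"

text \<open>Comparison of resolutions. The maps \<open>i\<close> and \<open>p\<close> lift to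
  \<open>i1\<close> and \<open>p1\<close> on the covers. The error \<open>p1 i1 - id - t e\<close>
  lands in the kernel of \<open>e\<close>, so it factors through the cover \<open>F'\<close> of that
  kernel. On the kernel itself the term \<open>t e\<close> vanishes, which leaves a stable retract
  of syzygies.\<close>

lemma stable_retract_syzygy:
  fixes M :: "('a, 'm) module" and G :: "('a, 'g) module"
    and F :: "('a, 'f) module" and P :: "('a, 'p) module" and F' :: "('a, 'h) module"
  assumes mods: "module R M" "module R G" "module R F" "module R P" "module R F'"
    and e: "e \<in> mod_homs R F M" and q: "q \<in> mod_homs R P G"
    and e': "e' \<in> mod_homs R F' (kernel_module F M e)"
    and lift1: "lifts R F P G q" and lift2: "lifts R P F M e"
    and lift3: "lifts R F F' (kernel_module F M e) e'"
    and ret: "stable_retract R M G F e"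
  shows "stable_retract R (kernel_module F M e) (kernel_module P G q) F' e'"
proof -
  interpret M: module R M by fact
  interpret G: module R G by fact
  interpret F: module R F by fact
  interpret P: module R P by fact
  let ?K = "a_kernel F M e" and ?L = "a_kernel P G q"
  have KF: "?K \<subseteq> carrier F" and LP: "?L \<subseteq> carrier P" by (auto simp: a_kernel_iff)
  obtain i p t where i: "i \<in> mod_homs R M G" and p: "p \<in> mod_homs R G M" and t: "t \<in> mod_homs R M F"
    and pit: "\<And>m. m \<in> carrier M \<Longrightarrow> p (i m) = m \<oplus>\<^bsub>M\<^esub> e (t m)"
    using ret unfolding stable_retract_def by blast
  obtain i1 where i1: "i1 \<in> mod_homs R F P" "\<And>x. x \<in> carrier F \<Longrightarrow> q (i1 x) = i (e x)"
    using bspec[OF lift1[unfolded lifts_def] mod_homs_comp[OF e i]] by auto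
  obtain p1 where p1: "p1 \<in> mod_homs R P F" "\<And>x. x \<in> carrier P \<Longrightarrow> e (p1 x) = p (q x)"
    using bspec[OF lift2[unfolded lifts_def] mod_homs_comp[OF q p]] by auto
  define n where "n x = (p1 (i1 x) \<ominus>\<^bsub>F\<^esub> x) \<ominus>\<^bsub>F\<^esub> t (e x)" for x
  have idF: "(\<lambda>x. x) \<in> mod_homs R F F" by (rule mod_homsI) simp_all
  have n: "n \<in> mod_homs R F F"
    unfolding n_def by (intro mod_homs_diff mods mod_homs_comp[OF i1(1) p1(1)] idF mod_homs_comp[OF e t])
  have nK: "n x \<in> ?K" if x: "x \<in> carrier F" for x
  proof -
    note closed = mod_homsD(1)[OF i1(1) x] mod_homsD(1)[OF p1(1)] mod_homsD(1)[OF e] mod_homsD(1)[OF t]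
    have "e (n x) = (e (p1 (i1 x)) \<ominus>\<^bsub>M\<^esub> e x) \<ominus>\<^bsub>M\<^esub> e (t (e x))"
      unfolding n_def using closed x by (simp add: mod_homs_minus[OF mods(3,1) e])
    also have "e (p1 (i1 x)) = e x \<oplus>\<^bsub>M\<^esub> e (t (e x))"
      using p1(2) i1(2)[OF x] closed x pit by simp
    also have "(e x \<oplus>\<^bsub>M\<^esub> e (t (e x)) \<ominus>\<^bsub>M\<^esub> e x) \<ominus>\<^bsub>M\<^esub> e (t (e x)) = \<zero>\<^bsub>M\<^esub>"
      using closed x by (simp add: M.a_comm[of "e x"] M.add_minus_cancel) (simp add: a_minus_def M.r_neg)
    finally show ?thesis using mod_homsD(1)[OF n x] by (simp add: a_kernel_iff)
  qed
  have n': "n \<in> mod_homs R F (kernel_module F M e)"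
    using nK mod_homsD(2,3)[OF n] by (intro mod_homsI) simp_all
  obtain n1 where n1: "n1 \<in> mod_homs R F F'" "\<And>x. x \<in> carrier F \<Longrightarrow> e' (n1 x) = n x"
    using bspec[OF lift3[unfolded lifts_def] n'] by auto
  have e0: "e x = \<zero>\<^bsub>M\<^esub>" "x \<in> carrier F" if "x \<in> ?K" for x using that by (simp_all add: a_kernel_iff)
  have "i1 \<in> mod_homs R (kernel_module F M e) (kernel_module P G q)"
  proof (rule mod_homs_restrict[OF i1(1) KF])
    fix x assume x: "x \<in> ?K"
    show "i1 x \<in> ?L" using i1(2)[OF e0(2)[OF x]] e0[OF x] mod_homs_zero[OF mods(1,2) i] mod_homsD(1)[OF i1(1)]
      by (simp add: a_kernel_iff)
  qed
  moreover have "p1 \<in> mod_homs R (kernel_module P G q) (kernel_module F M e)"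
  proof (rule mod_homs_restrict[OF p1(1) LP])
    fix x assume "x \<in> ?L"
    then have x: "x \<in> carrier P" "q x = \<zero>\<^bsub>G\<^esub>" by (simp_all add: a_kernel_iff)
    show "p1 x \<in> ?K" using p1(2)[OF x(1)] x mod_homs_zero[OF mods(2,1) p] mod_homsD(1)[OF p1(1)]
      by (simp add: a_kernel_iff)
  qed
  moreover have "n1 \<in> mod_homs R (kernel_module F M e) F'"
    using mod_homs_restrict[OF n1(1) KF, of "carrier F'"] mod_homsD(1)[OF n1(1)] KF by auto
  moreover have "p1 (i1 x) = x \<oplus>\<^bsub>F\<^esub> e' (n1 x)" if x: "x \<in> ?K" for x
  proof -
    note xF = e0[OF x]
    have y: "p1 (i1 x) \<in> carrier F" by (intro mod_homsD(1)[OF p1(1)] mod_homsD(1)[OF i1(1)] xF)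
    have "n x = p1 (i1 x) \<ominus>\<^bsub>F\<^esub> x"
      unfolding n_def xF(1) mod_homs_zero[OF mods(1,3) t] using y xF by (simp add: a_minus_def)
    then show ?thesis using n1(2)[OF xF(2)] y xF F.add_minus_cancel(2) F.M.a_comm
      by (simp add: F.M.a_comm[of x])
  qed
  ultimately show ?thesis
    unfolding stable_retract_def
    by (intro bexI[of _ i1] bexI[of _ p1] bexI[of _ n1]) simp_all
qed

text \<open>Every kernel lives on the type of the covering free module, so fixing that type for
  \<open>M\<close> closes the predicate under syzygies. A module on another type enters through its
  first syzygy.\<close>

inductive finite_minimal_resolution :: "('a, 'r) ring_scheme \<Rightarrow> ('a, nat \<Rightarrow> 'a) module \<Rightarrow> bool"
  for R :: "('a, 'r) ring_scheme" where
  zero: "module R M \<Longrightarrow> carrier M = {\<zero>\<^bsub>M\<^esub>} \<Longrightarrow> finite_minimal_resolution R M"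
| step: "module R M \<Longrightarrow> minimal_cover R M I e \<Longrightarrow>
    finite_minimal_resolution R (kernel_module (free_module R I) M e) \<Longrightarrow> finite_minimal_resolution R M"

text \<open>The modules in the resolution are only required to lift along finite free covers, which is
  the part of projectivity that does not quantify over a large type.\<close>

definition lifts_covers :: "('a, 'r) ring_scheme \<Rightarrow> ('a, 'p) module \<Rightarrow> bool" where
  "lifts_covers R P \<longleftrightarrow> (\<forall>(I :: nat set) (M :: ('a, nat \<Rightarrow> 'a) module) e. finite I \<longrightarrow> module R M \<longrightarrow>
     e \<in> mod_homs R (free_module R I) M \<longrightarrow> e ` carrier (free_module R I) = carrier M \<longrightarrow>
     lifts R P (free_module R I) M e)"

text \<open>The terms \<open>P\<close> share the type of \<open>G\<close>, as the recursion
  continues with a kernel inside \<open>P\<close>.\<close>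

inductive finite_lifting_resolution :: "('a, 'r) ring_scheme \<Rightarrow> ('a, 'p) module \<Rightarrow> bool"
  for R :: "('a, 'r) ring_scheme" where
  zero: "module R G \<Longrightarrow> carrier G = {\<zero>\<^bsub>G\<^esub>} \<Longrightarrow> finite_lifting_resolution R G"
| step: "module R G \<Longrightarrow> module R P \<Longrightarrow> lifts_covers R P \<Longrightarrow> q \<in> mod_homs R P G \<Longrightarrow>
    q ` carrier P = carrier G \<Longrightarrow> finite_lifting_resolution R (kernel_module P G q) \<Longrightarrow>
    finite_lifting_resolution R G"

lemma free_module_lifts:
  assumes "module R X" "module R Y" "finite I" "f \<in> mod_homs R X Y" "f ` carrier X = carrier Y"
  shows "lifts R (free_module R I) X Y f"
  unfolding lifts_def using free_module_lift[OF assms] by blast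

lemma (in cring) free_module_lifts_covers:
  assumes "finite I"
  shows "lifts_covers R (free_module R I)"
  unfolding lifts_covers_def using free_module_lifts[OF free_module _ assms] by blast

context noetherian_local_ring
begin

text \<open>The map \<open>n = id + t e\<close> projects the free module \<open>F\<close> onto the
  kernel \<open>K\<close> and is the identity there. Since \<open>K\<close> lies in
  \<open>\<mm>F\<close>, applying \<open>n\<close> gives \<open>K = \<mm>K\<close>, and
  \<open>K\<close> vanishes by Nakayama's lemma.\<close>

lemma kernel_zero_if_split:
  fixes M :: "('a, 'm) module"
  assumes M: "module R M" and e: "minimal_cover R M I e"
    and t: "t \<in> mod_homs R M (free_module R I)" "\<And>m. m \<in> carrier M \<Longrightarrow> e (t m) = \<ominus>\<^bsub>M\<^esub> m"
  shows "a_kernel (free_module R I) M e = {\<zero>\<^bsub>free_module R I\<^esub>}"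
proof -
  interpret M: module R M by fact
  let ?F = "free_module R I"
  interpret F: module R ?F by (rule free_module)
  let ?K = "a_kernel ?F M e"
  have I: "finite I" and eh: "e \<in> mod_homs R ?F M" and min: "\<And>f i. f \<in> ?K \<Longrightarrow> f i \<in> \<mm>"
    using e by (auto simp: minimal_cover_def)
  have K: "submodule ?K R ?F" by (rule kernel_submodule[OF F.module_axioms M eh])
  note K' = F.submoduleE'[OF K]
  define n where "n f = f \<oplus>\<^bsub>?F\<^esub> t (e f)" for f
  have idF: "(\<lambda>x. x) \<in> mod_homs R ?F ?F" by (rule mod_homsI) simp_all
  have n: "n \<in> mod_homs R ?F ?F"
    unfolding n_def by (intro mod_homs_add F.module_axioms idF mod_homs_comp[OF eh t(1)])
  have nK: "n f \<in> ?K" if f: "f \<in> carrier ?F" for f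
  proof -
    have "e (n f) = e f \<oplus>\<^bsub>M\<^esub> e (t (e f))"
      unfolding n_def by (intro mod_homsD[OF eh] mod_homsD(1)[OF t(1)] f)
    then have "e (n f) = \<zero>\<^bsub>M\<^esub>" using t(2) mod_homsD(1)[OF eh f] by (simp add: M.r_neg)
    then show ?thesis using mod_homsD(1)[OF n f] by (simp add: a_kernel_iff)
  qed
  have nfix: "n f = f" if "f \<in> ?K" for f
  proof -
    have f: "f \<in> carrier ?F" "e f = \<zero>\<^bsub>M\<^esub>" using that by (simp_all add: a_kernel_iff)
    have "n f = f \<oplus>\<^bsub>?F\<^esub> \<zero>\<^bsub>?F\<^esub>"
      unfolding n_def f(2) mod_homs_zero[OF M F.module_axioms t(1)] ..
    then show ?thesis using F.M.r_zero[OF f(1)] by simp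
  qed
  have "submodule ?K R (free_module R UNIV)" "?K \<subseteq> carrier (free_module R I)"
    using K submodule_free_iff by blast+
  from free_submodule_generators[OF I this] obtain T where T: "T \<subseteq> ?K" "finite T"
    "\<And>H. submodule H R (free_module R UNIV) \<Longrightarrow> T \<subseteq> H \<Longrightarrow> ?K \<subseteq> H" by blast
  have zero: "submodule {\<zero>\<^bsub>?F\<^esub>} R ?F" by (rule F.submoduleI') (simp_all add: free_module_carrier)
  have "T \<subseteq> {\<zero>\<^bsub>?F\<^esub>}"
  proof (rule F.nakayama[OF max_ideal_prime T(2)])
    show "T \<subseteq> carrier ?F" using T(1) K'(1) by blast
    show "submodule {\<zero>\<^bsub>?F\<^esub>} R ?F" by (rule zero)
    show "saturated R \<mm> ?F {\<zero>\<^bsub>?F\<^esub>}" by (rule saturated_max[OF F.module_axioms zero])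
    fix s L assume s: "s \<in> T" and L: "submodule L R ?F" and TL: "\<And>a u. a \<in> \<mm> \<Longrightarrow> u \<in> T \<Longrightarrow> a \<odot>\<^bsub>?F\<^esub> u \<in> L"
    \<comment> \<open>The hypothesis on \<open>L\<close> concerns generators only. The elements
      \<open>u\<close> with \<open>a u\<close> in \<open>L\<close> form a submodule, so it extends
      to all of \<open>K\<close>.\<close>
    have KL: "a \<odot>\<^bsub>?F\<^esub> u \<in> L" if a: "a \<in> \<mm>" and u: "u \<in> ?K" for a u
    proof -
      have aR: "a \<in> carrier R" using a mm.Icarr by simp
      let ?H = "{u \<in> carrier ?F. a \<odot>\<^bsub>?F\<^esub> u \<in> L}"
      note L' = F.submoduleE'[OF L]
      have H: "submodule ?H R ?F"
      proof (rule F.submoduleI')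
        show "\<zero>\<^bsub>?F\<^esub> \<in> ?H" unfolding mem_Collect_eq F.smult_r_null[OF aR] using L'(2) F.M.zero_closed by blast
        show "x \<oplus>\<^bsub>?F\<^esub> y \<in> ?H" if "x \<in> ?H" "y \<in> ?H" for x y
          using that F.smult_r_distr[OF aR, of x y] L'(4) F.M.add.m_closed by (simp only: mem_Collect_eq)
        show "b \<odot>\<^bsub>?F\<^esub> x \<in> ?H" if b: "b \<in> carrier R" and "x \<in> ?H" for b x
        proof -
          have x: "x \<in> carrier ?F" "a \<odot>\<^bsub>?F\<^esub> x \<in> L" using that by simp_all
          have "a \<odot>\<^bsub>?F\<^esub> (b \<odot>\<^bsub>?F\<^esub> x) = b \<odot>\<^bsub>?F\<^esub> (a \<odot>\<^bsub>?F\<^esub> x)"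
            unfolding F.smult_assoc1[OF aR b x(1), symmetric] F.smult_assoc1[OF b aR x(1), symmetric]
            by (simp only: m_comm[OF aR b])
          then show ?thesis using L'(3)[OF b x(2)] F.smult_closed[OF b x(1)] by (simp only: mem_Collect_eq)
        qed
      qed auto
      have "T \<subseteq> ?H" using TL[OF a] T(1) K'(1) by blast
      moreover have "submodule ?H R (free_module R UNIV)" using H submodule_free_iff by blast
      ultimately show ?thesis using T(3)[of ?H] u by blast
    qed
    have sK: "s \<in> ?K" using s T(1) by blast
    then have sF: "s \<in> carrier ?F" using K'(1) by blast
    have "s = n s" using nfix[OF sK] by simp
    also have "\<dots> = lincomb ?F (\<lambda>i. n (unit_vec R i)) I s"
      by (rule hom_free_eq_lincomb[OF F.module_axioms I n sF])
    \<comment> \<open>The coefficients of \<open>s\<close> are in \<open>\<mm>\<close> by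
      minimality, and the vectors \<open>n (unit_vec R i)\<close> are in \<open>K\<close>.\<close>
    also have "\<dots> \<in> L"
      unfolding lincomb_def
      by (rule F.finsum_in_submodule[OF L I]) (intro KL min[OF sK] nK unit_vec_closed)
    finally show "s \<in> L" .
  qed
  moreover have "submodule {\<zero>\<^bsub>?F\<^esub>} R (free_module R UNIV)" using zero submodule_free_iff by blast
  ultimately have "?K \<subseteq> {\<zero>\<^bsub>?F\<^esub>}" using T(3)[of "{\<zero>\<^bsub>?F\<^esub>}"] by blast
  then show ?thesis using K'(2) by blast
qed

lemma kernel_minimal_cover_exists:
  fixes M :: "('a, 'm) module"
  assumes M: "module R M" and e: "minimal_cover R M I e"
  obtains J e' where "minimal_cover R (kernel_module (free_module R I) M e) J e'"
proof -
  have I: "finite I" and eh: "e \<in> mod_homs R (free_module R I) M" using e by (auto simp: minimal_cover_def)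
  have K: "submodule (a_kernel (free_module R I) M e) R (free_module R I)"
    by (rule kernel_submodule[OF free_module M eh])
  show ?thesis
    by (rule minimal_cover_exists[OF submodule_module[OF free_module K]
      free_submodule_finitely_generated[OF I K]]) (rule that)
qed

lemma stable_retract_syzygy_minimal:
  fixes M :: "('a, 'm) module" and G :: "('a, 'g) module" and P :: "('a, 'p) module"
  assumes M: "module R M" and e: "minimal_cover R M I e"
    and G: "module R G" and P: "module R P" and q: "q \<in> mod_homs R P G" "q ` carrier P = carrier G"
    and lift: "lifts R P (free_module R I) M e"
    and e': "minimal_cover R (kernel_module (free_module R I) M e) J e'"
    and ret: "stable_retract R M G (free_module R I) e"
  shows "stable_retract R (kernel_module (free_module R I) M e) (kernel_module P G q) (free_module R J) e'"
proof (rule stable_retract_syzygy[OF M G free_module P free_module _ q(1) _ _ lift _ ret])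
  have I: "finite I" and eh: "e \<in> mod_homs R (free_module R I) M"
    using e by (auto simp: minimal_cover_def)
  show "e \<in> mod_homs R (free_module R I) M" by (rule eh)
  have e'h: "e' \<in> mod_homs R (free_module R J) (kernel_module (free_module R I) M e)"
     "e' ` carrier (free_module R J) = carrier (kernel_module (free_module R I) M e)"
    using e' by (simp_all add: minimal_cover_def)
  show "e' \<in> mod_homs R (free_module R J) (kernel_module (free_module R I) M e)" by (rule e'h)
  show "lifts R (free_module R I) P G q" by (rule free_module_lifts[OF P G I q])
  have "module R (kernel_module (free_module R I) M e)"
    by (rule submodule_module[OF free_module kernel_submodule[OF free_module M eh]])
  then show "lifts R (free_module R I) (free_module R J) (kernel_module (free_module R I) M e) e'"
    by (rule free_module_lifts[OF free_module _ I e'h])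
qed

text \<open>Induction along the resolution of \<open>G\<close>, with \<open>M\<close> replaced by
  its syzygy at each step. When \<open>G\<close> has become zero, minus the identity of
  \<open>M\<close> factors through the minimal cover. This cover therefore has zero kernel, and the
  minimal resolution stops.\<close>

theorem finite_minimal_resolution_of_stable_retract:
  assumes "finite_lifting_resolution R G"
    and "module R M" "minimal_cover R M I e" "stable_retract R M G (free_module R I) e"
  shows "finite_minimal_resolution R M"
  using assms
proof (induction arbitrary: M I e rule: finite_lifting_resolution.induct)
  case (zero G)
  note M = zero.prems(1) and e = zero.prems(2)
  interpret M: module R M by fact
  interpret G: module R G by fact
  have I: "finite I" and eh: "e \<in> mod_homs R (free_module R I) M" using e by (auto simp: minimal_cover_def)
  obtain i p t where i: "i \<in> mod_homs R M G" and p: "p \<in> mod_homs R G M" and t: "t \<in> mod_homs R M (free_module R I)"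
    and pit: "\<And>m. m \<in> carrier M \<Longrightarrow> p (i m) = m \<oplus>\<^bsub>M\<^esub> e (t m)"
    using zero.prems(3) unfolding stable_retract_def by blast
  have "e (t m) = \<ominus>\<^bsub>M\<^esub> m" if m: "m \<in> carrier M" for m
  proof -
    have "i m = \<zero>\<^bsub>G\<^esub>" using mod_homsD(1)[OF i m] zero.hyps by simp
    then have "m \<oplus>\<^bsub>M\<^esub> e (t m) = \<zero>\<^bsub>M\<^esub>" using pit[OF m] mod_homs_zero[OF zero.hyps(1) M p] by simp
    then show ?thesis
      using M.minus_equality[of "e (t m)" m] m mod_homsD(1)[OF eh mod_homsD(1)[OF t m]] by (simp add: M.M.a_comm)
  qed
  then have K: "a_kernel (free_module R I) M e = {\<zero>\<^bsub>free_module R I\<^esub>}"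
    by (intro kernel_zero_if_split[OF M e t])
  have "module R (kernel_module (free_module R I) M e)"
    by (rule submodule_module[OF free_module kernel_submodule[OF free_module M eh]])
  then have "finite_minimal_resolution R (kernel_module (free_module R I) M e)"
    by (rule finite_minimal_resolution.zero) (simp add: K)
  then show ?case by (rule finite_minimal_resolution.step[OF M e])
next
  case (step G P q)
  note M = step.prems(1) and e = step.prems(2)
  have I: "finite I" and eh: "e \<in> mod_homs R (free_module R I) M"
    "e ` carrier (free_module R I) = carrier M" using e by (auto simp: minimal_cover_def)
  obtain J e' where e': "minimal_cover R (kernel_module (free_module R I) M e) J e'"
    by (rule kernel_minimal_cover_exists[OF M e])
  have lift: "lifts R P (free_module R I) M e"
    using step.hyps(3) I M eh unfolding lifts_covers_def by blast
  have "stable_retract R (kernel_module (free_module R I) M e) (kernel_module P G q) (free_module R J) e'"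
    by (rule stable_retract_syzygy_minimal[OF M e step.hyps(1,2,4,5) lift e' step.prems(3)])
  moreover have "module R (kernel_module (free_module R I) M e)"
    by (rule submodule_module[OF free_module kernel_submodule[OF free_module M eh(1)]])
  ultimately have "finite_minimal_resolution R (kernel_module (free_module R I) M e)"
    by (intro step.IH[OF _ e'])
  then show ?case by (rule finite_minimal_resolution.step[OF M e])
qed

text \<open>In depth zero a finite minimal resolution has length zero: its last map would embed a
  free module into \<open>\<mm>F\<close>, which the socle element \<open>z\<close> annihilates.\<close>

lemma free_zero_if_socle:
  fixes J :: "'j set"
  assumes z: "z \<in> carrier R" "z \<noteq> \<zero>" "\<And>a. a \<in> \<mm> \<Longrightarrow> z \<otimes> a = \<zero>"
    and K: "submodule K R (free_module R I)" "\<And>f i. f \<in> K \<Longrightarrow> f i \<in> \<mm>"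
    and b: "b \<in> mod_homs R (free_module R J) ((free_module R I)\<lparr>carrier := K\<rparr>)"
      "bij_betw b (carrier (free_module R J)) K"
  shows "K = {\<zero>\<^bsub>free_module R I\<^esub>}"
proof -
  interpret FJ: module R "free_module R J" by (rule free_module)
  have b0: "b \<zero>\<^bsub>free_module R J\<^esub> = \<zero>\<^bsub>free_module R I\<^esub>"
    using mod_homs_zero[OF free_module submodule_module[OF free_module K(1)] b(1)] by simp
  have "J = {}"
  proof (rule ccontr)
    assume "J \<noteq> {}"
    then obtain j where j: "j \<in> J" by blast
    have uJ: "unit_vec R j \<in> carrier (free_module R J)" by (rule unit_vec_closed[OF j])
    have "b (unit_vec R j) \<in> K" using mod_homsD(1)[OF b(1) uJ] by simp
    then have "z \<odot>\<^bsub>free_module R I\<^esub> b (unit_vec R j) = \<zero>\<^bsub>free_module R I\<^esub>" using z(3) K(2) by simp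
    then have "b (z \<odot>\<^bsub>free_module R J\<^esub> unit_vec R j) = b \<zero>\<^bsub>free_module R J\<^esub>"
      using mod_homsD(3)[OF b(1) z(1) uJ] b0 by simp
    then have "z \<odot>\<^bsub>free_module R J\<^esub> unit_vec R j = \<zero>\<^bsub>free_module R J\<^esub>"
      using b(2) FJ.smult_closed[OF z(1) uJ] FJ.M.zero_closed by (auto simp: bij_betw_def dest: inj_onD)
    then have "(z \<odot>\<^bsub>free_module R J\<^esub> unit_vec R j) j = \<zero>" by simp
    then show False using z by (simp add: unit_vec_def)
  qed
  then have "carrier (free_module R J) = {\<zero>\<^bsub>free_module R J\<^esub>}" by (auto simp: free_module_carrier)
  then show ?thesis using b(2) b0 by (auto simp: bij_betw_def)
qed

text \<open>Seen from its end, the resolution collapses: each kernel is free by induction and has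
  its coordinates in \<open>\<mm>\<close>, so \<open>free_zero_if_socle\<close> makes it zero and
  the cover is an isomorphism.\<close>

lemma free_if_socle:
  assumes z: "z \<in> carrier R" "z \<noteq> \<zero>" "\<And>a. a \<in> \<mm> \<Longrightarrow> z \<otimes> a = \<zero>"
    and res: "finite_minimal_resolution R M"
  shows "\<exists>(I :: nat set) b. b \<in> mod_homs R (free_module R I) M \<and> finite I \<and> bij_betw b (carrier (free_module R I)) (carrier M)"
  using res
proof (induction rule: finite_minimal_resolution.induct)
  case (zero M)
  interpret M: module R M by fact
  have "carrier (free_module R ({} :: nat set)) = {\<lambda>_. \<zero>}" by (auto simp: free_module_carrier)
  moreover have "(\<lambda>_. \<zero>\<^bsub>M\<^esub>) \<in> mod_homs R (free_module R ({} :: nat set)) M" by (rule mod_homsI) simp_all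
  ultimately show ?case using zero
    by (intro exI[of _ "{} :: nat set"] exI[of _ "\<lambda>_. \<zero>\<^bsub>M\<^esub>"]) (simp add: bij_betw_def)
next
  case (step M I e)
  interpret M: module R M by fact
  interpret F: module R "free_module R I" by (rule free_module)
  obtain J :: "nat set" and b where b: "b \<in> mod_homs R (free_module R J) (kernel_module (free_module R I) M e)"
   "bij_betw b (carrier (free_module R J)) (a_kernel (free_module R I) M e)" using step.IH by auto
  have K: "a_kernel (free_module R I) M e = {\<zero>\<^bsub>free_module R I\<^esub>}"
  proof (rule free_zero_if_socle[OF z(1,2) _ _ _ b])
    show "submodule (a_kernel (free_module R I) M e) R (free_module R I)"
      using step.hyps(2) by (intro kernel_submodule[OF free_module step.hyps(1)]) (simp add: minimal_cover_def)
    show "f i \<in> \<mm>" if "f \<in> a_kernel (free_module R I) M e" for f i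
      using step.hyps(2) that by (simp add: minimal_cover_def)
  qed (rule z(3))
  have e: "finite I" "e \<in> mod_homs R (free_module R I) M" "e ` carrier (free_module R I) = carrier M"
    using step.hyps(2) by (simp_all add: minimal_cover_def)
  have "inj_on e (carrier (free_module R I))"
  proof (rule inj_onI)
    fix f g assume f: "f \<in> carrier (free_module R I)" and g: "g \<in> carrier (free_module R I)" and eq: "e f = e g"
    have "e (f \<ominus>\<^bsub>free_module R I\<^esub> g) = \<zero>\<^bsub>M\<^esub>"
      unfolding mod_homs_minus[OF free_module step.hyps(1) e(2) f g] eq
      using mod_homsD(1)[OF e(2) g] by (simp add: a_minus_def M.M.r_neg)
    then have "f \<ominus>\<^bsub>free_module R I\<^esub> g \<in> a_kernel (free_module R I) M e"
      unfolding a_kernel_iff by (intro conjI F.M.minus_closed[OF f g])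
    then have "f \<ominus>\<^bsub>free_module R I\<^esub> g = \<zero>\<^bsub>free_module R I\<^esub>" unfolding K by (rule singletonD)
    then show "f = g" using F.M.add_minus_cancel(2)[OF f g] F.M.l_zero[OF g] by simp
  qed
  then have "bij_betw e (carrier (free_module R I)) (carrier M)" using e(3) by (simp add: bij_betw_def)
  then show ?case using e by blast
qed

lemma zero_if_socle:
  assumes z: "z \<in> carrier R" "z \<noteq> \<zero>" "\<And>a. a \<in> \<mm> \<Longrightarrow> z \<otimes> a = \<zero>"
    and K: "submodule K R (free_module R I)" "\<And>f i. f \<in> K \<Longrightarrow> f i \<in> \<mm>"
    and res: "finite_minimal_resolution R ((free_module R I)\<lparr>carrier := K\<rparr>)"
  shows "K = {\<zero>\<^bsub>free_module R I\<^esub>}"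
proof -
  obtain J :: "nat set" and b where b: "b \<in> mod_homs R (free_module R J) ((free_module R I)\<lparr>carrier := K\<rparr>)"
    "bij_betw b (carrier (free_module R J)) K"
    using free_if_socle[OF z res] by auto
  show ?thesis by (rule free_zero_if_socle[OF z(1,2) _ K(1) _ b]) (use z(3) K(2) in auto)
qed

end

section \<open>Regular elements\<close>

context noetherian_local_ring
begin

lemma one_minus_max_unit:
  assumes "a \<in> \<mm>"
  obtains u where "u \<in> carrier R" "u \<otimes> (\<one> \<ominus> a) = \<one>"
proof -
  have a: "a \<in> carrier R" using assms mm.Icarr by simp
  have "\<one> \<ominus> a \<notin> \<mm>"
  proof
    assume "\<one> \<ominus> a \<in> \<mm>"
    then have "(\<one> \<ominus> a) \<oplus> a \<in> \<mm>" by (rule mm.ideal_closed(3)[OF _ assms])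
    then show False using mm.prime_one a by (simp add: add_minus_cancel)
  qed
  then show ?thesis using that unit_if_not_in_max[of "\<one> \<ominus> a"] a by blast
qed

lemma power_in_max: "y \<in> \<mm> \<Longrightarrow> 0 < n \<Longrightarrow> y [^] (n :: nat) \<in> \<mm>"
  using mm.Icarr mm.ideal_closed(2)[of "y [^] (n - 1)" y] by (cases n) simp_all

text \<open>If \<open>a + y\<^sup>n\<close> killed some \<open>z\<^sub>n\<close> outside the \<open>y\<close>-torsion for every \<open>n \<ge> 2\<close>, then by the
  ascending chain condition some \<open>z\<^sub>N\<close> is a combination of the earlier ones, so the product of the
  earlier \<open>a + y\<^sup>k\<close> kills it. But on \<open>z\<^sub>N\<close> the element \<open>a + y\<^sup>k\<close> acts as \<open>y\<^sup>k\<close> times a unit.\<close>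

lemma power_perturbation:
  assumes a: "a \<in> carrier R" and y: "y \<in> \<mm>"
  obtains n :: nat where "n \<ge> 2"
    "\<And>z. z \<in> carrier R \<Longrightarrow> (a \<oplus> y [^] n) \<otimes> z = \<zero> \<Longrightarrow> \<exists>m :: nat. y [^] m \<otimes> z = \<zero>"
proof (rule ccontr)
  note witness = that
  assume no: "\<not> thesis"
  have yR: "y \<in> carrier R" using y mm.Icarr by simp
  \<comment> \<open>The shift by 2 keeps the exponents at least 2, which later places
    \<open>y [^] n\<close> in \<open>\<mm>\<^sup>2\<close>.\<close>
  define b where "b n = a \<oplus> y [^] (n + 2)" for n :: nat
  define G where "G w \<longleftrightarrow> (\<exists>m :: nat. y [^] m \<otimes> w = \<zero>)" for w
  have bR: "b n \<in> carrier R" for n using a yR by (simp add: b_def)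
  have "\<exists>z. z \<in> carrier R \<and> b n \<otimes> z = \<zero> \<and> \<not> G z" for n
    using witness[of "n + 2"] no unfolding b_def G_def by auto
  then obtain z where z: "\<And>n. z n \<in> carrier R" "\<And>n. b n \<otimes> z n = \<zero>" "\<And>n. \<not> G (z n)" by metis
  have zs: "z ` {..<n} \<subseteq> carrier R" for n :: nat using z(1) by auto
  let ?F = "range (\<lambda>n :: nat. Idl (z ` {..<n}))"
  have ne: "?F \<noteq> {}" by simp
  obtain M where M: "M \<in> ?F" "\<And>J. J \<in> ?F \<Longrightarrow> M \<subseteq> J \<Longrightarrow> J = M"
    by (rule maximal_ideal_in_family[OF ne]) (use genideal_ideal[OF zs] in auto)
  then obtain N where N: "M = Idl (z ` {..<N})" by blast
  have "M \<subseteq> Idl (z ` {..<Suc N})"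
    unfolding N by (rule subset_Idl_subset[OF zs]) (auto simp: less_Suc_eq)
  then have "Idl (z ` {..<Suc N}) = M" by (intro M(2)) auto
  moreover have "z N \<in> Idl (z ` {..<Suc N})" using genideal_self[OF zs[of "Suc N"]] by auto
  ultimately have zN: "z N \<in> Idl (z ` {..<N})" using N by simp
  define p where "p = rec_nat \<one> (\<lambda>k r. b k \<otimes> r)"
  have p: "p 0 = \<one>" "p (Suc k) = b k \<otimes> p k" for k by (simp_all add: p_def)
  have pR: "p k \<in> carrier R" for k by (induction k) (simp_all add: p bR)
  have pz: "p k \<otimes> z i = \<zero>" if "i < k" for i k
    using that
  proof (induction k)
    case (Suc k)
    show ?case
    proof (cases "i = k")
      case True
      have "p (Suc k) \<otimes> z k = p k \<otimes> (b k \<otimes> z k)" unfolding p(2) using bR[of k] pR[of k] z(1)[of k] by algebra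
      then show ?thesis using True z(2) pR by simp
    next
      case False
      then show ?thesis using Suc bR[of k] pR[of k] z(1)[of i] by (simp add: p m_assoc)
    qed
  qed simp
  interpret Z: ideal "{\<zero>}" R by (rule zeroideal)
  have "z ` {..<N} \<subseteq> {w \<in> carrier R. p N \<otimes> w \<in> {\<zero>}}" using pz z(1) by auto
  then have "Idl (z ` {..<N}) \<subseteq> {w \<in> carrier R. p N \<otimes> w \<in> {\<zero>}}"
    by (rule genideal_minimal[OF Z.multiplier_ideal[OF cring_axioms pR]])
  then have pN: "p N \<otimes> z N = \<zero>" using zN by blast
  \<comment> \<open>On an element \<open>w\<close> killed by \<open>b N\<close>, \<open>a\<close>
    acts as \<open>- y [^] (N + 2)\<close>, so \<open>b k\<close> acts as
    \<open>y [^] (k + 2)\<close> times \<open>\<one> - y [^] (N - k)\<close>. The second factor is a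
    unit because \<open>k < N\<close>.\<close>
  have descend: "G w" if w: "w \<in> carrier R" "b N \<otimes> w = \<zero>" "G (b k \<otimes> w)" and k: "k < N" for w k
  proof -
    obtain m :: nat where m: "y [^] m \<otimes> (b k \<otimes> w) = \<zero>" using w(3) unfolding G_def by blast
    define v where "v = y [^] (k + 2)"
    define c where "c = y [^] (N - k)"
    have vc: "v \<in> carrier R" "c \<in> carrier R" using yR by (simp_all add: v_def c_def)
    have vc3: "v \<otimes> c = y [^] (N + 2)"
      unfolding v_def c_def nat_pow_mult[OF yR] using k by simp
    have "a \<otimes> w = \<ominus> ((v \<otimes> c) \<otimes> w)"
    proof -
      have "a \<otimes> w \<oplus> (v \<otimes> c) \<otimes> w = \<zero>" using w(2) a w(1) yR unfolding b_def vc3[symmetric] using vc by (simp add: l_distr)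
      then show ?thesis using minus_equality[of "a \<otimes> w" "(v \<otimes> c) \<otimes> w"] a w(1) vc(1,2) by simp
    qed
    then have "b k \<otimes> w = \<ominus> ((v \<otimes> c) \<otimes> w) \<oplus> v \<otimes> w"
      unfolding b_def v_def[symmetric] using a w(1) vc(1) by (simp add: l_distr)
    also have "\<dots> = v \<otimes> ((\<one> \<ominus> c) \<otimes> w)" using vc(1,2) w(1) by algebra
    finally have bw: "b k \<otimes> w = v \<otimes> ((\<one> \<ominus> c) \<otimes> w)" .
    have "c \<in> \<mm>" unfolding c_def using power_in_max[OF y] k by simp
    then obtain u where u: "u \<in> carrier R" "u \<otimes> (\<one> \<ominus> c) = \<one>" by (rule one_minus_max_unit)
    have ym: "y [^] m \<in> carrier R" using yR by simp
    have "y [^] (m + (k + 2)) \<otimes> w = (y [^] m \<otimes> v) \<otimes> ((u \<otimes> (\<one> \<ominus> c)) \<otimes> w)"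
      unfolding u(2) v_def nat_pow_mult[OF yR] using yR w(1) by simp
    also have "\<dots> = u \<otimes> (y [^] m \<otimes> (v \<otimes> ((\<one> \<ominus> c) \<otimes> w)))" using u(1) vc(1,2) w(1) ym by algebra
    also have "\<dots> = \<zero>" using m bw u(1) by simp
    finally show ?thesis unfolding G_def by blast
  qed
  have "G (p k \<otimes> z N)" if "k \<le> N" for k
    using that
  proof (induction k rule: inc_induct)
    case base
    have "y [^] (0 :: nat) \<otimes> (p N \<otimes> z N) = \<zero>" using pN by simp
    then show ?case unfolding G_def by blast
  next
    case (step k)
    show ?case
    proof (rule descend)
      show "p k \<otimes> z N \<in> carrier R" using pR z(1) by simp
      have "b N \<otimes> (p k \<otimes> z N) = p k \<otimes> (b N \<otimes> z N)" using bR[of N] pR[of k] z(1)[of N] by algebra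
      then show "b N \<otimes> (p k \<otimes> z N) = \<zero>" using z(2) pR by simp
      show "G (b k \<otimes> (p k \<otimes> z N))" using step by (simp add: p m_assoc bR pR z(1))
      show "k < N" using step by simp
    qed
  qed
  from this[of 0] show False using z(1,3)[of N] by (simp add: p)
qed

text \<open>A substitute for prime avoidance over the associated primes. Let \<open>y\<close> be
  regular on the part \<open>W2\<close> of \<open>W\<close> that \<open>x\<close> kills. If
  \<open>x + y [^] n\<close> kills some \<open>z\<close> in \<open>W\<close>, then a power of
  \<open>y\<close> kills \<open>z\<close>, and so does a power of \<open>x\<close>, because
  \<open>x z\<close> is a multiple of \<open>y z\<close>. If \<open>z\<close> were not zero, the
  last non-zero product of \<open>z\<close> with a power of \<open>x\<close> would lie in
  \<open>W2\<close> and be killed by a power of \<open>y\<close>.\<close>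

lemma socle_or_regular_on_ideal:
  assumes "finite T" "T \<subseteq> \<mm>"
  shows "ideal W R \<Longrightarrow> (\<exists>z \<in> W. z \<noteq> \<zero> \<and> (\<forall>t \<in> T. t \<otimes> z = \<zero>)) \<or>
    (\<exists>y \<in> Idl T. \<forall>w \<in> W. y \<otimes> w = \<zero> \<longrightarrow> w = \<zero>)"
  using assms
proof (induction T arbitrary: W rule: finite_induct)
  case empty
  show ?case
  proof (cases "W = {\<zero>}")
    case True
    have "\<zero> \<in> Idl {}" using ideal.ideal_closed(1)[OF genideal_ideal[of "{}"]] by simp
    then show ?thesis using True by auto
  next
    case False
    then show ?thesis using ideal.ideal_closed(1)[OF empty.prems(1)] by auto
  qed
next
  case (insert x T)
  interpret W: ideal W R by (rule insert.prems)
  have x: "x \<in> \<mm>" "x \<in> carrier R" and T: "T \<subseteq> \<mm>" "insert x T \<subseteq> carrier R" "T \<subseteq> carrier R"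
    using insert.prems mm.Icarr by auto
  define W2 where "W2 = {w \<in> W. x \<otimes> w = \<zero>}"
  have "ideal W2 R"
  proof (rule idealI')
    show "W2 \<subseteq> carrier R" using W.Icarr by (auto simp: W2_def)
    show "\<zero> \<in> W2" using x by (simp add: W2_def)
    show "u \<oplus> v \<in> W2" if "u \<in> W2" "v \<in> W2" for u v
      using that x W.Icarr W.ideal_closed(3) by (simp add: W2_def r_distr)
    show "c \<otimes> u \<in> W2" if "c \<in> carrier R" "u \<in> W2" for c u
      using that x W.Icarr W.ideal_closed(2) by (simp add: W2_def m_lcomm)
  qed
  from insert.IH[OF this T(1)] show ?case
  proof
    assume "\<exists>z\<in>W2. z \<noteq> \<zero> \<and> (\<forall>t\<in>T. t \<otimes> z = \<zero>)"
    then show ?thesis unfolding W2_def by auto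
  next
    assume "\<exists>y\<in>Idl T. \<forall>w\<in>W2. y \<otimes> w = \<zero> \<longrightarrow> w = \<zero>"
    then obtain y where y: "y \<in> Idl T" "\<And>w. w \<in> W2 \<Longrightarrow> y \<otimes> w = \<zero> \<Longrightarrow> w = \<zero>" by blast
    have ym: "y \<in> \<mm>" using y(1) genideal_minimal[OF mm.is_ideal T(1)] by blast
    have yR: "y \<in> carrier R" using ym mm.Icarr by simp
    obtain n :: nat where n: "n \<ge> 2"
      "\<And>z. z \<in> carrier R \<Longrightarrow> (x \<oplus> y [^] n) \<otimes> z = \<zero> \<Longrightarrow> \<exists>m :: nat. y [^] m \<otimes> z = \<zero>"
      by (rule power_perturbation[OF x(2) ym]) blast
    interpret IT: ideal "Idl (insert x T)" R by (rule genideal_ideal[OF T(2)])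
    have "Idl T \<subseteq> Idl (insert x T)" by (rule subset_Idl_subset[OF T(2)]) auto
    then have "y \<in> Idl (insert x T)" using y(1) by blast
    then have "y [^] (n - 1) \<otimes> y \<in> Idl (insert x T)" using yR by (intro IT.ideal_closed(2)) simp_all
    moreover have "y [^] (n - 1) \<otimes> y = y [^] n" using n(1) by (cases n) simp_all
    moreover have "x \<in> Idl (insert x T)" using genideal_self[OF T(2)] by blast
    ultimately have mem: "x \<oplus> y [^] n \<in> Idl (insert x T)" by (simp add: IT.ideal_closed(3))
    have "z = \<zero>" if z: "z \<in> W" "(x \<oplus> y [^] n) \<otimes> z = \<zero>" for z
    proof (rule ccontr)
      assume z0: "z \<noteq> \<zero>"
      have zR: "z \<in> carrier R" using z(1) W.Icarr by simp
      obtain m :: nat where m: "y [^] m \<otimes> z = \<zero>" using n(2)[OF zR z(2)] by blast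
      have xz: "x \<otimes> z = \<ominus> (y [^] n \<otimes> z)"
        using z(2) minus_equality[of "x \<otimes> z" "y [^] n \<otimes> z"] x yR zR by (simp add: l_distr)
      have ymult: "y [^] m \<otimes> (x [^] j \<otimes> z) = \<zero>" for j :: nat
        using m x yR zR by (simp add: m_lcomm)
      have "y [^] i \<otimes> z = \<zero>" if "i \<ge> m" for i :: nat
      proof -
        have "y [^] i \<otimes> z = y [^] (i - m) \<otimes> (y [^] m \<otimes> z)"
          using that yR zR by (simp add: m_assoc[symmetric] nat_pow_mult)
        then show ?thesis using m yR by simp
      qed
      \<comment> \<open>On \<open>z\<close> each factor \<open>x\<close> is traded for
        \<open>- y [^] n\<close>, which supplies at least one factor \<open>y\<close>.\<close>
      moreover have "\<exists>c \<in> carrier R. x [^] j \<otimes> z = c \<otimes> (y [^] j \<otimes> z)" for j :: nat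
      proof (induction j)
        case 0 show ?case using zR by (intro bexI[of _ \<one>]) simp_all
      next
        case (Suc j)
        then obtain c where c: "c \<in> carrier R" "x [^] j \<otimes> z = c \<otimes> (y [^] j \<otimes> z)" by blast
        have yj: "y [^] j \<in> carrier R" "x [^] j \<in> carrier R" "y [^] (n - 1) \<in> carrier R" using x yR by simp_all
        have yn: "y [^] n = y [^] (n - 1) \<otimes> y" using n(1) by (cases n) simp_all
        have "x [^] Suc j \<otimes> z = x \<otimes> (x [^] j \<otimes> z)" using x zR by (simp add: m_ac)
        also have "\<dots> = c \<otimes> (y [^] j \<otimes> (x \<otimes> z))" unfolding c(2) using c(1) yj(1) x(2) zR by algebra
        also have "\<dots> = (\<ominus> (c \<otimes> y [^] (n - 1))) \<otimes> ((y [^] j \<otimes> y) \<otimes> z)"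
          unfolding xz yn using c(1) yj(1,3) yR zR by algebra
        finally have "x [^] Suc j \<otimes> z = (\<ominus> (c \<otimes> y [^] (n - 1))) \<otimes> (y [^] Suc j \<otimes> z)" by simp
        moreover have "\<ominus> (c \<otimes> y [^] (n - 1)) \<in> carrier R" using c(1) yj(3) by simp
        ultimately show ?case by blast
      qed
      ultimately have xm0: "x [^] m \<otimes> z = \<zero>" by (metis order_refl r_null)
      define j where "j = (LEAST j :: nat. x [^] j \<otimes> z = \<zero>)"
      have j: "x [^] j \<otimes> z = \<zero>" unfolding j_def by (rule LeastI[of _ m]) (rule xm0)
      have "j \<noteq> 0" using j z0 zR by (metis l_one nat_pow_0)
      then obtain i where i: "j = Suc i" by (cases j) auto
      have xi: "x [^] i \<otimes> z \<noteq> \<zero>" using not_less_Least[of i "\<lambda>j. x [^] j \<otimes> z = \<zero>"] i j_def by auto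
      have "x [^] i \<otimes> z \<in> W" using z(1) x by (intro W.ideal_closed(2)) simp_all
      moreover have "x \<otimes> (x [^] i \<otimes> z) = \<zero>" using j x zR unfolding i by (simp add: m_ac)
      ultimately have w: "x [^] i \<otimes> z \<in> W2" by (simp add: W2_def)
      have "y [^] k \<otimes> (x [^] i \<otimes> z) \<noteq> \<zero>" for k :: nat
      proof (induction k)
        case 0 then show ?case using xi x zR by simp
      next
        case (Suc k)
        have "y [^] k \<otimes> (x [^] i \<otimes> z) \<in> W2"
          using ideal.ideal_closed(2)[OF \<open>ideal W2 R\<close> _ w] yR by simp
        then have "y \<otimes> (y [^] k \<otimes> (x [^] i \<otimes> z)) \<noteq> \<zero>" using Suc y(2) by blast
        moreover have "y \<otimes> (y [^] k \<otimes> (x [^] i \<otimes> z)) = y [^] Suc k \<otimes> (x [^] i \<otimes> z)"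
          using yR x zR by (simp add: m_assoc[symmetric] m_comm[of y])
        ultimately show ?case by simp
      qed
      then show False using ymult by blast
    qed
    then show ?thesis using mem by blast
  qed
qed

text \<open>The alternative between depth zero and positive depth.\<close>

lemma socle_or_regular_element:
  obtains (socle) z where "z \<in> carrier R" "z \<noteq> \<zero>" "\<And>a. a \<in> \<mm> \<Longrightarrow> z \<otimes> a = \<zero>"
  | (regular) y where "y \<in> \<mm>" "\<And>w. w \<in> carrier R \<Longrightarrow> y \<otimes> w = \<zero> \<Longrightarrow> w = \<zero>"
proof -
  obtain T where T: "T \<subseteq> carrier R" "finite T" "\<mm> = Idl T" using finetely_gen[OF mm.is_ideal] by blast
  have "T \<subseteq> \<mm>" using genideal_self[OF T(1)] T(3) by simp
  from socle_or_regular_on_ideal[OF T(2) this oneideal] show ?thesis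
  proof
    assume "\<exists>z\<in>carrier R. z \<noteq> \<zero> \<and> (\<forall>t\<in>T. t \<otimes> z = \<zero>)"
    then obtain z where z: "z \<in> carrier R" "z \<noteq> \<zero>" "\<And>t. t \<in> T \<Longrightarrow> t \<otimes> z = \<zero>" by blast
    have "T \<subseteq> {a \<in> carrier R. z \<otimes> a \<in> {\<zero>}}" using z T(1) m_comm by (auto simp: subset_iff)
    then have "Idl T \<subseteq> {a \<in> carrier R. z \<otimes> a \<in> {\<zero>}}"
      by (rule genideal_minimal[OF ideal.multiplier_ideal[OF zeroideal cring_axioms z(1)]])
    then show ?thesis using socle[OF z(1,2)] T(3) by blast
  next
    assume "\<exists>y\<in>Idl T. \<forall>w\<in>carrier R. y \<otimes> w = \<zero> \<longrightarrow> w = \<zero>"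
    then show ?thesis using regular T(3) by blast
  qed
qed

section \<open>Elements outside the square of the maximal ideal\<close>

lemma max_not_subset_square:
  assumes "\<mm> \<noteq> {\<zero>}"
  shows "\<not> \<mm> \<subseteq> \<mm> \<cdot> \<mm>"
proof
  assume sub: "\<mm> \<subseteq> \<mm> \<cdot> \<mm>"
  interpret M: module R "regular_module R" by (rule regular_module_module)
  obtain T where T: "T \<subseteq> carrier R" "finite T" "\<mm> = Idl T" using finetely_gen[OF mm.is_ideal] by blast
  have Tm: "T \<subseteq> \<mm>" using genideal_self[OF T(1)] T(3) by simp
  have "T \<subseteq> {\<zero>}"
  proof (rule M.nakayama[OF max_ideal_prime T(2)])
    show "T \<subseteq> carrier (regular_module R)" using T by simp
    show Z: "submodule {\<zero>} R (regular_module R)" using zeroideal by (simp add: submodule_regular_iff)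
    show "saturated R \<mm> (regular_module R) {\<zero>}" by (rule saturated_max[OF M.module_axioms Z])
    fix t L assume t: "t \<in> T" and L: "submodule L R (regular_module R)"
      and NT: "\<And>a u. a \<in> \<mm> \<Longrightarrow> u \<in> T \<Longrightarrow> a \<odot>\<^bsub>regular_module R\<^esub> u \<in> L"
    interpret L: ideal L R using L by (simp add: submodule_regular_iff)
    have prod: "a \<otimes> u \<in> L" if a: "a \<in> \<mm>" and u: "u \<in> \<mm>" for a u
    proof -
      have aR: "a \<in> carrier R" using a mm.Icarr by simp
      have "T \<subseteq> {u \<in> carrier R. a \<otimes> u \<in> L}" using NT[OF a] T(1) by auto
      then have "Idl T \<subseteq> {u \<in> carrier R. a \<otimes> u \<in> L}"
        by (rule genideal_minimal[OF L.multiplier_ideal[OF cring_axioms aR]])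
      then show ?thesis using u T(3) by blast
    qed
    have "t \<in> \<mm> \<cdot> \<mm>" using t Tm sub by blast
    then show "t \<in> L" by (induction rule: ideal_prod.induct) (simp_all add: prod L.ideal_closed(3))
  qed
  then have "\<mm> \<subseteq> {\<zero>}" using T(3) genideal_minimal[OF zeroideal] by simp
  then show False using assms mm.ideal_closed(1) by blast
qed

text \<open>Start from any \<open>a\<close> in \<open>\<mm>\<close> outside
  \<open>\<mm>\<^sup>2\<close> and add a power of \<open>y\<close> with exponent at least 2: the sum
  stays outside, and what it kills is killed by a power of the regular element
  \<open>y\<close>.\<close>

lemma regular_element_outside_square:
  assumes y: "y \<in> \<mm>" "\<And>w. w \<in> carrier R \<Longrightarrow> y \<otimes> w = \<zero> \<Longrightarrow> w = \<zero>" and m0: "\<mm> \<noteq> {\<zero>}"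
  obtains x where "x \<in> \<mm>" "x \<notin> \<mm> \<cdot> \<mm>" "\<And>w. w \<in> carrier R \<Longrightarrow> x \<otimes> w = \<zero> \<Longrightarrow> w = \<zero>"
proof -
  have yR: "y \<in> carrier R" using y(1) mm.Icarr by simp
  interpret S: ideal "\<mm> \<cdot> \<mm>" R by (rule ideal_prod_is_ideal[OF mm.is_ideal mm.is_ideal])
  obtain a where a: "a \<in> \<mm>" "a \<notin> \<mm> \<cdot> \<mm>" using max_not_subset_square[OF m0] by blast
  have aR: "a \<in> carrier R" using a mm.Icarr by simp
  obtain n :: nat where n: "n \<ge> 2"
    "\<And>z. z \<in> carrier R \<Longrightarrow> (a \<oplus> y [^] n) \<otimes> z = \<zero> \<Longrightarrow> \<exists>m :: nat. y [^] m \<otimes> z = \<zero>"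
    by (rule power_perturbation[OF aR y(1)]) blast
  obtain k where k: "n = Suc k" "k > 0" using n(1) by (cases n) auto
  have yn: "y [^] n \<in> \<mm> \<cdot> \<mm>" unfolding k(1) using ideal_prod.prod[OF power_in_max[OF y(1) k(2)] y(1), of R] by simp
  have ynR: "y [^] n \<in> carrier R" using yR by simp
  have tor: "z = \<zero>" if "y [^] m \<otimes> z = \<zero>" "z \<in> carrier R" for z and m :: nat
    using that
  proof (induction m arbitrary: z)
    case (Suc m)
    have "y [^] m \<otimes> (y \<otimes> z) = \<zero>" using Suc.prems yR by (simp add: m_assoc)
    then have "y \<otimes> z = \<zero>" using Suc.IH Suc.prems(2) yR by simp
    then show ?case using y(2) Suc.prems(2) by simp
  qed simp
  show ?thesis
  proof (rule that[of "a \<oplus> y [^] n"])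
    show "a \<oplus> y [^] n \<in> \<mm>" by (rule mm.ideal_closed(3)[OF a(1) power_in_max[OF y(1)]]) (use k in simp)
    show "a \<oplus> y [^] n \<notin> \<mm> \<cdot> \<mm>"
    proof
      assume "a \<oplus> y [^] n \<in> \<mm> \<cdot> \<mm>"
      then have "(a \<oplus> y [^] n) \<ominus> y [^] n \<in> \<mm> \<cdot> \<mm>" by (rule S.ideal_closed(5)[OF _ yn])
      then show False using a(2) aR ynR by (simp add: add_minus_cancel)
    qed
    show "w = \<zero>" if "w \<in> carrier R" "(a \<oplus> y [^] n) \<otimes> w = \<zero>" for w
      using n(2)[OF that] tor that(1) by blast
  qed
qed

text \<open>\<open>L\<close> is the kernel of a linear form on \<open>\<mm>/\<mm>\<^sup>2\<close> that takes the value \<open>1\<close> at \<open>x\<close>.\<close>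

lemma complement_in_max:
  assumes x: "x \<in> \<mm>" "x \<notin> \<mm> \<cdot> \<mm>"
  obtains L where "ideal L R" "\<And>v. v \<in> \<mm> \<Longrightarrow> \<exists>a \<in> carrier R. v \<ominus> a \<otimes> x \<in> L"
    "\<And>a. a \<in> carrier R \<Longrightarrow> a \<otimes> x \<in> L \<Longrightarrow> a \<in> \<mm>"
proof -
  have xR: "x \<in> carrier R" using x mm.Icarr by simp
  \<comment> \<open>An ideal that is maximal among those that contain the square and miss
    \<open>x\<close> corresponds to a complement of the line through \<open>x\<close> in
    \<open>\<mm>/\<mm>\<^sup>2\<close>.\<close>
  let ?F = "{L. ideal L R \<and> \<mm> \<cdot> \<mm> \<subseteq> L \<and> x \<notin> L}"
  have "\<mm> \<cdot> \<mm> \<in> ?F" using x ideal_prod_is_ideal[OF mm.is_ideal mm.is_ideal] by simp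
  then have ne: "?F \<noteq> {}" by blast
  obtain L where L: "L \<in> ?F" "\<And>J. J \<in> ?F \<Longrightarrow> L \<subseteq> J \<Longrightarrow> J = L"
    by (rule maximal_ideal_in_family[OF ne]) auto
  interpret L: ideal L R using L by simp
  have ax: "a \<in> \<mm>" if a: "a \<in> carrier R" "a \<otimes> x \<in> L" for a
  proof (rule ccontr)
    assume "a \<notin> \<mm>"
    then obtain u where u: "u \<in> carrier R" "u \<otimes> a = \<one>" using unit_if_not_in_max[of a] a by blast
    have "u \<otimes> (a \<otimes> x) \<in> L" by (rule L.ideal_closed(2)[OF u(1) a(2)])
    then show False using L(1) u a xR by (simp add: m_assoc[symmetric])
  qed
  have "\<exists>a \<in> carrier R. v \<ominus> a \<otimes> x \<in> L" if v: "v \<in> \<mm>" for v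
  proof (cases "v \<in> L")
    case True
    have "v \<ominus> \<zero> \<otimes> x \<in> L" using True L.Icarr xR by (simp add: a_minus_def)
    then show ?thesis by blast
  next
    case False
    have vR: "v \<in> carrier R" using v mm.Icarr by simp
    note adj = adjoin[OF L.is_ideal vR]
    have "adjoin R L v \<notin> ?F" using L(2)[of "adjoin R L v"] adj(2,3) False by blast
    then have "x \<in> adjoin R L v" using adj(1,2) L(1) by blast
    then obtain l c where lc: "l \<in> L" "c \<in> carrier R" "x = l \<oplus> c \<otimes> v" unfolding adjoin_def by blast
    have lR: "l \<in> carrier R" using lc L.Icarr by simp
    \<comment> \<open>A coefficient \<open>c\<close> in \<open>\<mm>\<close> would put
      \<open>c v\<close> into the square and hence \<open>x\<close> into \<open>L\<close>. So
      \<open>c\<close> is a unit, and \<open>v\<close> is congruent to a multiple of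
      \<open>x\<close>.\<close>
    have "c \<notin> \<mm>"
    proof
      assume "c \<in> \<mm>"
      then have "c \<otimes> v \<in> \<mm> \<cdot> \<mm>" by (rule ideal_prod.prod[OF _ v])
      then have "l \<oplus> c \<otimes> v \<in> L" using L(1) lc(1) L.ideal_closed(3) by blast
      then show False using L(1) unfolding lc(3)[symmetric] by simp
    qed
    then obtain u where u: "u \<in> carrier R" "u \<otimes> c = \<one>" using unit_if_not_in_max[of c] lc by blast
    have "v \<ominus> u \<otimes> x = v \<ominus> u \<otimes> (l \<oplus> c \<otimes> v)" using lc(3) by simp
    also have "\<dots> = v \<ominus> (u \<otimes> l \<oplus> (u \<otimes> c) \<otimes> v)" using u(1) lc(2) lR vR by algebra
    also have "\<dots> = \<ominus> (u \<otimes> l)" unfolding u(2) using u(1) lR vR by algebra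
    finally have "v \<ominus> u \<otimes> x \<in> L" using L.ideal_closed(2,4) u(1) lc(1) by simp
    then show ?thesis using u(1) by blast
  qed
  then show ?thesis using that[OF L.is_ideal _ ax] by blast
qed

end

section \<open>Reduction modulo a regular element\<close>

text \<open>Ideals of \<open>R'\<close> pull back to ideals of \<open>R\<close>, which transfers
  finite generation. A proper one pulls back into \<open>\<mm>\<close>, which makes the image of
  \<open>\<mm>\<close> the only maximal ideal.\<close>

lemma (in noetherian_local_ring) surjective_image:
  assumes R': "cring R'" "\<one>\<^bsub>R'\<^esub> \<noteq> \<zero>\<^bsub>R'\<^esub>" and h: "h \<in> ring_hom R R'" "h ` carrier R = carrier R'"
  shows "noetherian_local_ring R'" and "max_ideal R' = h ` \<mm>"
proof -
  interpret R': cring R' by fact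
  interpret h: ring_hom_cring R R' h
    by (intro ring_hom_cring.intro cring_axioms R' ring_hom_cring_axioms.intro h)
  have sub: "carrier R' \<subseteq> h ` carrier R" using h by simp
  let ?pre = "\<lambda>I. {r \<in> carrier R. h r \<in> I}"
  have pre: "ideal (?pre I) R" if "ideal I R'" for I
    by (rule ring_hom_ring.ideal_vimage[OF ring_hom_ringI2[OF ring_axioms R'.ring_axioms h(1)] that])
  have pre_image: "I = h ` ?pre I" if "ideal I R'" for I
    using ideal.Icarr[OF that] sub by blast
  have image: "ideal (h ` I) R'" if I: "ideal I R" for I
  proof (rule R'.idealI')
    interpret I: ideal I R by fact
    show "h ` I \<subseteq> carrier R'" using I.Icarr by auto
    show "\<zero>\<^bsub>R'\<^esub> \<in> h ` I" using I.ideal_closed(1) h.hom_zero by (metis image_eqI)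
    fix u v assume "u \<in> h ` I" "v \<in> h ` I"
    then obtain a b where *: "a \<in> I" "b \<in> I" "u = h a" "v = h b" by blast
    then have "u \<oplus>\<^bsub>R'\<^esub> v = h (a \<oplus> b)" using I.Icarr by simp
    then show "u \<oplus>\<^bsub>R'\<^esub> v \<in> h ` I" using I.ideal_closed(3)[OF *(1,2)] by blast
  next
    interpret I: ideal I R by fact
    fix c u assume "c \<in> carrier R'" "u \<in> h ` I"
    then obtain a b where *: "a \<in> carrier R" "b \<in> I" "c = h a" "u = h b" using sub by blast
    then have "c \<otimes>\<^bsub>R'\<^esub> u = h (a \<otimes> b)" using I.Icarr by simp
    then show "c \<otimes>\<^bsub>R'\<^esub> u \<in> h ` I" using I.ideal_closed(2)[OF *(1,2)] by blast
  qed
  have pre_max: "?pre I \<subseteq> \<mm>" if I: "ideal I R'" "I \<noteq> carrier R'" for I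
  proof (rule proper_ideal_subset_max[OF pre[OF I(1)]])
    show "\<one> \<notin> ?pre I" using ideal.one_imp_carrier[OF I(1)] I(2) by auto
  qed
  have proper: "\<one>\<^bsub>R'\<^esub> \<notin> h ` \<mm>"
  proof
    assume "\<one>\<^bsub>R'\<^esub> \<in> h ` \<mm>"
    then obtain a where a: "a \<in> \<mm>" "h a = \<one>\<^bsub>R'\<^esub>" by auto
    have aR: "a \<in> carrier R" using a mm.Icarr by simp
    have "h (\<one> \<ominus> a) = \<zero>\<^bsub>R'\<^esub>" using aR a(2) by (simp add: a_minus_def R'.r_neg)
    then have "\<one> \<ominus> a \<in> ?pre {\<zero>\<^bsub>R'\<^esub>}" using aR by simp
    moreover have "{\<zero>\<^bsub>R'\<^esub>} \<noteq> carrier R'" using R'(2) R'.one_closed by blast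
    ultimately have "\<one> \<ominus> a \<in> \<mm>" using pre_max[OF R'.zeroideal] by blast
    then have "(\<one> \<ominus> a) \<oplus> a \<in> \<mm>" using a mm.ideal_closed(3) by blast
    then show False using aR mm.prime_one by (simp add: add_minus_cancel)
  qed
  have hm: "ideal (h ` \<mm>) R'" by (rule image[OF mm.is_ideal])
  have below: "I \<subseteq> h ` \<mm>" if I: "ideal I R'" "I \<noteq> carrier R'" for I
    using pre_image[OF I(1)] pre_max[OF I] by blast
  have max: "maximalideal (h ` \<mm>) R'"
  proof (rule maximalidealI[OF hm])
    show "carrier R' \<noteq> h ` \<mm>" using proper by auto
    show "J = h ` \<mm> \<or> J = carrier R'" if "ideal J R'" "h ` \<mm> \<subseteq> J" for J using below[OF that(1)] that(2) by blast
  qed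
  have unique: "N = h ` \<mm>" if "maximalideal N R'" for N
  proof -
    interpret N: maximalideal N R' by fact
    show ?thesis using below[OF N.is_ideal] N.I_maximal[OF hm] N.I_notcarr proper ideal.Icarr[OF hm] by blast
  qed
  show "noetherian_local_ring R'"
  proof (intro noetherian_local_ring.intro noetherian_local_ring_axioms.intro R'.noetherian_ringI R'.cring_axioms)
    show "\<exists>!N. maximalideal N R'" using max unique by blast
    fix I assume I: "ideal I R'"
    obtain A where A: "A \<subseteq> carrier R" "finite A" "?pre I = Idl A" using finetely_gen[OF pre[OF I]] by blast
    have hA: "h ` A \<subseteq> carrier R'" using A(1) by auto
    have "Idl A \<subseteq> ?pre (genideal R' (h ` A))"
      using A(1) R'.genideal_self[OF hA] by (intro genideal_minimal pre R'.genideal_ideal[OF hA]) auto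
    then have "h ` (Idl A) \<subseteq> genideal R' (h ` A)" by blast
    then have "I \<subseteq> genideal R' (h ` A)" using pre_image[OF I] A(3) by simp
    moreover have "h ` A \<subseteq> I" using genideal_self[OF A(1)] A(3) by blast
    ultimately have "I = genideal R' (h ` A)" using R'.genideal_minimal[OF I] by blast
    then show "\<exists>A\<subseteq>carrier R'. finite A \<and> I = genideal R' A" using hA A(2) by blast
  qed
  show "max_ideal R' = h ` \<mm>"
    unfolding max_ideal_def[of R'] using max unique by (rule the_equality)
qed

text \<open>A copy of \<open>\<mm>\<close> inside the free module of rank one, since
  \<open>finite_minimal_resolution\<close> speaks of modules of functions on the natural
  numbers.\<close>

definition max_ideal_module :: "('a, 'r) ring_scheme \<Rightarrow> ('a, nat \<Rightarrow> 'a) module" where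
  "max_ideal_module R = (free_module R {0})\<lparr>carrier := {f \<in> carrier (free_module R {0}). f 0 \<in> max_ideal R}\<rparr>"

context noetherian_local_ring
begin

lemma max_ideal_submodule: "submodule {f \<in> carrier (free_module R {0 :: nat}). f 0 \<in> \<mm>} R (free_module R {0})"
proof -
  interpret F: module R "free_module R {0 :: nat}" by (rule free_module)
  show ?thesis
    by (rule F.submoduleI')
      (use mm.ideal_closed(1-3) in \<open>auto simp: free_module_carrier\<close>)
qed

lemma max_ideal_module: "module R (max_ideal_module R)"
  unfolding max_ideal_module_def by (rule submodule_module[OF free_module max_ideal_submodule])

lemma max_ideal_module_finitely_generated: "finitely_generated R (max_ideal_module R)"
  unfolding max_ideal_module_def
  by (rule free_submodule_finitely_generated[OF _ max_ideal_submodule]) simp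

end

text \<open>\<open>R'\<close> is \<open>R/xR\<close>, given by a map \<open>h\<close> and not as a
  factor ring. This admits the passage from one factor ring of a fixed ring to a smaller
  one.\<close>

locale regular_quotient = R?: noetherian_local_ring R + R': noetherian_local_ring R'
  for R (structure) and R' +
  fixes h x
  assumes h: "h \<in> ring_hom R R'" and h_surj: "h ` carrier R = carrier R'"
    and xR: "x \<in> carrier R"
    and ker: "\<And>a. a \<in> carrier R \<Longrightarrow> h a = \<zero>\<^bsub>R'\<^esub> \<longleftrightarrow> (\<exists>b \<in> carrier R. a = x \<otimes> b)"
    and reg: "\<And>a. a \<in> carrier R \<Longrightarrow> x \<otimes> a = \<zero> \<Longrightarrow> a = \<zero>"
begin

sublocale h: ring_hom_cring R R' h
  by (intro ring_hom_cring.intro R.cring_axioms R'.cring_axioms ring_hom_cring_axioms.intro h)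

definition reduce :: "('i \<Rightarrow> 'a) \<Rightarrow> 'i \<Rightarrow> 'c" where "reduce f = (\<lambda>i. h (f i))"

lemma reduce:
  shows "f \<in> carrier (free_module R I) \<Longrightarrow> reduce f \<in> carrier (free_module R' I)"
    and "g \<in> carrier (free_module R' I) \<Longrightarrow> \<exists>f \<in> carrier (free_module R I). reduce f = g"
    and "f \<in> carrier (free_module R I) \<Longrightarrow> f' \<in> carrier (free_module R I) \<Longrightarrow>
      reduce (f \<oplus>\<^bsub>free_module R I\<^esub> f') = reduce f \<oplus>\<^bsub>free_module R' I\<^esub> reduce f'"
    and "f \<in> carrier (free_module R I) \<Longrightarrow> a \<in> carrier R \<Longrightarrow>
      reduce (a \<odot>\<^bsub>free_module R I\<^esub> f) = h a \<odot>\<^bsub>free_module R' I\<^esub> reduce f"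
    and "f \<in> carrier (free_module R I) \<Longrightarrow> reduce f = \<zero>\<^bsub>free_module R' I\<^esub> \<longleftrightarrow>
      (\<exists>f' \<in> carrier (free_module R I). f = x \<odot>\<^bsub>free_module R I\<^esub> f')"
proof -
  show "f \<in> carrier (free_module R I) \<Longrightarrow> reduce f \<in> carrier (free_module R' I)"
    by (simp add: free_module_carrier reduce_def)
  show "\<exists>f \<in> carrier (free_module R I). reduce f = g" if g: "g \<in> carrier (free_module R' I)"
  proof -
    have "\<exists>a. a \<in> carrier R \<and> h a = g i \<and> (i \<notin> I \<longrightarrow> a = \<zero>)" for i
    proof (cases "i \<in> I")
      case True
      have "g i \<in> h ` carrier R" using g h_surj by (simp add: free_module_carrier)
      then obtain a where "g i = h a" "a \<in> carrier R" by (rule imageE)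
      then show ?thesis using True by (intro exI[of _ a]) simp
    next
      case False then show ?thesis using g by (intro exI[of _ \<zero>]) (simp add: free_module_carrier)
    qed
    then obtain f where f: "\<And>i. f i \<in> carrier R \<and> h (f i) = g i \<and> (i \<notin> I \<longrightarrow> f i = \<zero>)"
      using choice[of "\<lambda>i a. a \<in> carrier R \<and> h a = g i \<and> (i \<notin> I \<longrightarrow> a = \<zero>)"] by blast
    then have "f \<in> carrier (free_module R I)" "reduce f = g" by (simp_all add: free_module_carrier reduce_def)
    then show ?thesis by blast
  qed
  show "f \<in> carrier (free_module R I) \<Longrightarrow> f' \<in> carrier (free_module R I) \<Longrightarrow>
      reduce (f \<oplus>\<^bsub>free_module R I\<^esub> f') = reduce f \<oplus>\<^bsub>free_module R' I\<^esub> reduce f'"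
    by (simp add: free_module_carrier reduce_def)
  show "f \<in> carrier (free_module R I) \<Longrightarrow> a \<in> carrier R \<Longrightarrow>
      reduce (a \<odot>\<^bsub>free_module R I\<^esub> f) = h a \<odot>\<^bsub>free_module R' I\<^esub> reduce f"
    by (simp add: free_module_carrier reduce_def)
  show "reduce f = \<zero>\<^bsub>free_module R' I\<^esub> \<longleftrightarrow>
      (\<exists>f' \<in> carrier (free_module R I). f = x \<odot>\<^bsub>free_module R I\<^esub> f')" if f: "f \<in> carrier (free_module R I)"
  proof
    assume "reduce f = \<zero>\<^bsub>free_module R' I\<^esub>"
    then have "h (f i) = \<zero>\<^bsub>R'\<^esub>" for i by (simp add: reduce_def fun_eq_iff)
    then have "\<exists>b. b \<in> carrier R \<and> f i = x \<otimes> b" for i using ker[of "f i"] f by (auto simp: free_module_carrier)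
    then obtain f' where f': "\<And>i. f' i \<in> carrier R \<and> f i = x \<otimes> f' i"
      using choice[of "\<lambda>i b. b \<in> carrier R \<and> f i = x \<otimes> b"] by blast
    \<comment> \<open>Outside \<open>I\<close> the equation \<open>x f' i = \<zero>\<close> forces
      \<open>f' i = \<zero>\<close>, because \<open>x\<close> is regular.\<close>
    then have "f' \<in> carrier (free_module R I)"
      using f reg by (simp add: free_module_carrier)
    moreover have "f = x \<odot>\<^bsub>free_module R I\<^esub> f'" using f' by (simp add: fun_eq_iff)
    ultimately show "\<exists>f' \<in> carrier (free_module R I). f = x \<odot>\<^bsub>free_module R I\<^esub> f'" by blast
  next
    assume "\<exists>f' \<in> carrier (free_module R I). f = x \<odot>\<^bsub>free_module R I\<^esub> f'"
    then obtain f' where "f' \<in> carrier (free_module R I)" "f = x \<odot>\<^bsub>free_module R I\<^esub> f'" by (rule bexE)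
    then have f': "\<And>i. f' i \<in> carrier R" "\<And>i. f i = x \<otimes> f' i" by (simp_all add: free_module_carrier)
    have "h (x \<otimes> f' i) = \<zero>\<^bsub>R'\<^esub>" for i using ker[of "x \<otimes> f' i"] f'(1) xR by blast
    then show "reduce f = \<zero>\<^bsub>free_module R' I\<^esub>" using f'(2) by (simp add: reduce_def)
  qed
qed

text \<open>\<open>G\<close> is \<open>M/xM\<close>, given by its projection \<open>q\<close>.\<close>

definition reduction :: "('a, 'm) module \<Rightarrow> ('c, 'g) module \<Rightarrow> ('m \<Rightarrow> 'g) \<Rightarrow> bool" where
  "reduction M G q \<longleftrightarrow> q ` carrier M = carrier G \<and>
     (\<forall>m \<in> carrier M. \<forall>n \<in> carrier M. q (m \<oplus>\<^bsub>M\<^esub> n) = q m \<oplus>\<^bsub>G\<^esub> q n) \<and>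
     (\<forall>a \<in> carrier R. \<forall>m \<in> carrier M. q (a \<odot>\<^bsub>M\<^esub> m) = h a \<odot>\<^bsub>G\<^esub> q m) \<and>
     (\<forall>m \<in> carrier M. q m = \<zero>\<^bsub>G\<^esub> \<longleftrightarrow> (\<exists>n \<in> carrier M. m = x \<odot>\<^bsub>M\<^esub> n)) \<and>
     (\<forall>m \<in> carrier M. x \<odot>\<^bsub>M\<^esub> m = \<zero>\<^bsub>M\<^esub> \<longrightarrow> m = \<zero>\<^bsub>M\<^esub>)"

lemma reductionD:
  assumes "reduction M G q"
  shows "q ` carrier M = carrier G"
    and "m \<in> carrier M \<Longrightarrow> n \<in> carrier M \<Longrightarrow> q (m \<oplus>\<^bsub>M\<^esub> n) = q m \<oplus>\<^bsub>G\<^esub> q n"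
    and "a \<in> carrier R \<Longrightarrow> m \<in> carrier M \<Longrightarrow> q (a \<odot>\<^bsub>M\<^esub> m) = h a \<odot>\<^bsub>G\<^esub> q m"
    and "m \<in> carrier M \<Longrightarrow> q m = \<zero>\<^bsub>G\<^esub> \<longleftrightarrow> (\<exists>n \<in> carrier M. m = x \<odot>\<^bsub>M\<^esub> n)"
    and "m \<in> carrier M \<Longrightarrow> x \<odot>\<^bsub>M\<^esub> m = \<zero>\<^bsub>M\<^esub> \<Longrightarrow> m = \<zero>\<^bsub>M\<^esub>"
  using assms unfolding reduction_def by simp_all

text \<open>As \<open>x\<close> is regular on \<open>M\<close>, an element \<open>x f'\<close> of
  the kernel has \<open>f'\<close> in the kernel, so the reduced kernel is the kernel modulo
  \<open>x\<close>. This is the vanishing of the first Tor module of \<open>M\<close> and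
  \<open>R/xR\<close>.\<close>

lemma kernel_reduction:
  assumes M: "module R M" and e: "e \<in> mod_homs R (free_module R I) M"
    and tf: "\<And>m. m \<in> carrier M \<Longrightarrow> x \<odot>\<^bsub>M\<^esub> m = \<zero>\<^bsub>M\<^esub> \<Longrightarrow> m = \<zero>\<^bsub>M\<^esub>"
    and L: "L = reduce ` a_kernel (free_module R I) M e"
  shows "reduction (kernel_module (free_module R I) M e) ((free_module R' I)\<lparr>carrier := L\<rparr>) reduce"
  unfolding reduction_def
proof (intro conjI ballI impI)
  let ?K = "a_kernel (free_module R I) M e"
  have KF: "f \<in> carrier (free_module R I)" if "f \<in> carrier (kernel_module (free_module R I) M e)" for f
    using that by (simp add: a_kernel_iff)
  show "reduce ` carrier (kernel_module (free_module R I) M e) = carrier ((free_module R' I)\<lparr>carrier := L\<rparr>)"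
    using L by simp
  fix f assume f: "f \<in> carrier (kernel_module (free_module R I) M e)"
  show "reduce (f \<oplus>\<^bsub>kernel_module (free_module R I) M e\<^esub> g) =
      reduce f \<oplus>\<^bsub>(free_module R' I)\<lparr>carrier := L\<rparr>\<^esub> reduce g"
    if g: "g \<in> carrier (kernel_module (free_module R I) M e)" for g
    using reduce(3)[OF KF[OF f] KF[OF g]] by simp
  show "f = \<zero>\<^bsub>kernel_module (free_module R I) M e\<^esub>"
    if "x \<odot>\<^bsub>kernel_module (free_module R I) M e\<^esub> f = \<zero>\<^bsub>kernel_module (free_module R I) M e\<^esub>"
    using that KF[OF f] reg by (simp add: free_module_carrier fun_eq_iff)
  show "reduce f = \<zero>\<^bsub>(free_module R' I)\<lparr>carrier := L\<rparr>\<^esub> \<longleftrightarrow>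
     (\<exists>n\<in>carrier (kernel_module (free_module R I) M e). f = x \<odot>\<^bsub>kernel_module (free_module R I) M e\<^esub> n)"
  proof -
    have "f' \<in> ?K" if f': "f' \<in> carrier (free_module R I)" "f = x \<odot>\<^bsub>free_module R I\<^esub> f'" for f'
    proof -
      have "x \<odot>\<^bsub>M\<^esub> e f' = e f" unfolding f'(2) by (rule mod_homsD(3)[OF e xR f'(1), symmetric])
      also have "\<dots> = \<zero>\<^bsub>M\<^esub>" using f by (simp add: a_kernel_iff)
      finally show ?thesis using tf mod_homsD(1)[OF e f'(1)] f'(1) by (simp add: a_kernel_iff)
    qed
    then have "(\<exists>n\<in>?K. f = x \<odot>\<^bsub>free_module R I\<^esub> n) \<longleftrightarrow> (\<exists>n\<in>carrier (free_module R I). f = x \<odot>\<^bsub>free_module R I\<^esub> n)"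
      using a_kernel_iff[of _ "free_module R I" M e] by blast
    then show ?thesis using reduce(5)[OF KF[OF f]] by simp
  qed
next
  fix a f assume a: "a \<in> carrier R" and f: "f \<in> carrier (kernel_module (free_module R I) M e)"
  have "f \<in> carrier (free_module R I)" using f by (simp add: a_kernel_iff)
  then show "reduce (a \<odot>\<^bsub>kernel_module (free_module R I) M e\<^esub> f) = h a \<odot>\<^bsub>(free_module R' I)\<lparr>carrier := L\<rparr>\<^esub> reduce f"
    using reduce(4)[of f I a] a by simp
qed

text \<open>Reduction modulo an element that is regular on \<open>M\<close> keeps a free resolution
  exact: \<open>x\<close> is again regular on each kernel, a submodule of a free module, so the
  argument repeats.\<close>

theorem finite_lifting_resolution_reduction:
  assumes "finite_minimal_resolution R M"
    and "module R' G" "reduction M G q"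
  shows "finite_lifting_resolution R' (G :: ('c, nat \<Rightarrow> 'c) module)"
  using assms
proof (induction arbitrary: G q rule: finite_minimal_resolution.induct)
  case (zero M)
  interpret M: module R M by fact
  have "q \<zero>\<^bsub>M\<^esub> = \<zero>\<^bsub>G\<^esub>"
    using reductionD(4)[OF zero.prems(2) M.M.zero_closed] M.smult_r_null[OF xR, symmetric] M.M.zero_closed by blast
  then have "carrier G = {\<zero>\<^bsub>G\<^esub>}" using reductionD(1)[OF zero.prems(2)] zero.hyps(2) by simp
  then show ?case by (rule finite_lifting_resolution.zero[OF zero.prems(1)])
next
  case (step M I e)
  note red = reductionD[OF step.prems(2)] and M = step.hyps(1)
  interpret M: module R M by fact
  interpret G: module R' G by (rule step.prems(1))
  interpret F: module R "free_module R I" by (rule R.free_module)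
  have I: "finite I" and e: "e \<in> mod_homs R (free_module R I) M" "e ` carrier (free_module R I) = carrier M"
    using step.hyps(2) by (auto simp: minimal_cover_def)
  define s where "s g = (SOME f. f \<in> carrier (free_module R I) \<and> reduce f = g)" for g
  have s: "s g \<in> carrier (free_module R I)" "reduce (s g) = g" if "g \<in> carrier (free_module R' I)" for g
    using someI_ex[OF reduce(2)[OF that, unfolded Bex_def]] unfolding s_def by blast+
  \<comment> \<open>The map that \<open>e\<close> induces on the reduced modules: \<open>s\<close>
    chooses representatives, and \<open>q_diff\<close> shows that the choice does not
    matter.\<close>
  define p where "p g = q (e (s g))" for g
  have q_diff: "q (e f) = q (e f')"
    if f: "f \<in> carrier (free_module R I)" "f' \<in> carrier (free_module R I)" "reduce f = reduce f'" for f f'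
  proof -
    define k where "k = f \<ominus>\<^bsub>free_module R I\<^esub> f'"
    have k: "k \<in> carrier (free_module R I)" unfolding k_def by (rule F.M.minus_closed[OF f(1,2)])
    have "h (f i) = h (f' i)" "f i \<in> carrier R" "f' i \<in> carrier R" for i
      using f by (auto simp: reduce_def fun_eq_iff free_module_carrier)
    then have "reduce k = \<zero>\<^bsub>free_module R' I\<^esub>"
      unfolding k_def R.free_module_minus[OF f(1,2)] reduce_def
      by (simp add: a_minus_def R'.r_neg)
    then obtain k' where k': "k' \<in> carrier (free_module R I)" "k = x \<odot>\<^bsub>free_module R I\<^esub> k'"
      using reduce(5)[OF k] by blast
    have ek: "e k = x \<odot>\<^bsub>M\<^esub> e k'" unfolding k'(2) by (rule mod_homsD(3)[OF e(1) xR k'(1)])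
    have "q (e k) = \<zero>\<^bsub>G\<^esub>" using red(4)[OF mod_homsD(1)[OF e(1) k]] ek mod_homsD(1)[OF e(1) k'(1)] by blast
    moreover have "e f = e k \<oplus>\<^bsub>M\<^esub> e f'"
      using mod_homsD(2)[OF e(1) k f(2)] F.M.add_minus_cancel(2)[OF f(1,2)] by (simp add: k_def)
    moreover have "q (e f') \<in> carrier G" using red(1) mod_homsD(1)[OF e(1) f(2)] by blast
    ultimately show ?thesis using red(2) mod_homsD(1)[OF e(1)] k f(2) by simp
  qed
  have p_reduce: "p (reduce f) = q (e f)" if f: "f \<in> carrier (free_module R I)" for f
    unfolding p_def by (rule q_diff) (use s[OF reduce(1)[OF f]] f in auto)
  have p: "p \<in> mod_homs R' (free_module R' I) G"
  proof (rule mod_homsI)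
    fix g assume g: "g \<in> carrier (free_module R' I)"
    obtain f where f: "f \<in> carrier (free_module R I)" "g = reduce f" using reduce(2)[OF g] by blast
    note ef = mod_homsD(1)[OF e(1) f(1)]
    show "p g \<in> carrier G" unfolding f(2) p_reduce[OF f(1)] using red(1) ef by blast
    show "p (g \<oplus>\<^bsub>free_module R' I\<^esub> g') = p g \<oplus>\<^bsub>G\<^esub> p g'" if g': "g' \<in> carrier (free_module R' I)" for g'
    proof -
      obtain f' where f': "f' \<in> carrier (free_module R I)" "g' = reduce f'" using reduce(2)[OF g'] by blast
      have "p (g \<oplus>\<^bsub>free_module R' I\<^esub> g') = p (reduce (f \<oplus>\<^bsub>free_module R I\<^esub> f'))"
        unfolding f(2) f'(2) reduce(3)[OF f(1) f'(1)] ..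
      also have "\<dots> = q (e f \<oplus>\<^bsub>M\<^esub> e f')"
        unfolding p_reduce[OF F.M.add.m_closed[OF f(1) f'(1)]] mod_homsD(2)[OF e(1) f(1) f'(1)] ..
      finally show ?thesis
        unfolding f(2) f'(2) p_reduce[OF f(1)] p_reduce[OF f'(1)] red(2)[OF ef mod_homsD(1)[OF e(1) f'(1)]] .
    qed
    show "p (a \<odot>\<^bsub>free_module R' I\<^esub> g) = a \<odot>\<^bsub>G\<^esub> p g" if "a \<in> carrier R'" for a
    proof -
      have "a \<in> h ` carrier R" using that h_surj by simp
      then obtain b where b: "b \<in> carrier R" "a = h b" by (rule imageE)
      have "p (a \<odot>\<^bsub>free_module R' I\<^esub> g) = p (reduce (b \<odot>\<^bsub>free_module R I\<^esub> f))"
        unfolding f(2) b(2) reduce(4)[OF f(1) b(1)] ..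
      also have "\<dots> = q (b \<odot>\<^bsub>M\<^esub> e f)"
        unfolding p_reduce[OF F.smult_closed[OF b(1) f(1)]] mod_homsD(3)[OF e(1) b(1) f(1)] ..
      finally show ?thesis unfolding red(3)[OF b(1) ef] f(2) b(2) p_reduce[OF f(1)] .
    qed
  qed
  have p_surj: "p ` carrier (free_module R' I) = carrier G"
  proof
    show "p ` carrier (free_module R' I) \<subseteq> carrier G" using mod_homsD(1)[OF p] by blast
    show "carrier G \<subseteq> p ` carrier (free_module R' I)"
    proof
      fix y assume "y \<in> carrier G"
      then have "y \<in> q ` e ` carrier (free_module R I)" unfolding e(2) red(1) .
      then obtain f where f: "f \<in> carrier (free_module R I)" "y = q (e f)" by blast
      then have "y = p (reduce f)" using p_reduce by simp
      then show "y \<in> p ` carrier (free_module R' I)" using reduce(1)[OF f(1)] by blast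
    qed
  qed
  have kernel: "a_kernel (free_module R' I) G p = reduce ` a_kernel (free_module R I) M e"
  proof
    show "reduce ` a_kernel (free_module R I) M e \<subseteq> a_kernel (free_module R' I) G p"
    proof
      fix g assume "g \<in> reduce ` a_kernel (free_module R I) M e"
      then obtain f where f: "f \<in> carrier (free_module R I)" "e f = \<zero>\<^bsub>M\<^esub>" "g = reduce f"
        by (auto simp: a_kernel_iff)
      have "q \<zero>\<^bsub>M\<^esub> = \<zero>\<^bsub>G\<^esub>" using red(4)[OF M.M.zero_closed] M.smult_r_null[OF xR, symmetric] M.M.zero_closed by blast
      then show "g \<in> a_kernel (free_module R' I) G p"
        using reduce(1)[OF f(1)] p_reduce[OF f(1)] f by (simp add: a_kernel_iff)
    qed
    show "a_kernel (free_module R' I) G p \<subseteq> reduce ` a_kernel (free_module R I) M e"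
    proof
      fix g assume "g \<in> a_kernel (free_module R' I) G p"
      then have g: "g \<in> carrier (free_module R' I)" "p g = \<zero>\<^bsub>G\<^esub>" by (simp_all add: a_kernel_iff)
      obtain f where f: "f \<in> carrier (free_module R I)" "g = reduce f" using reduce(2)[OF g(1)] by blast
      have "q (e f) = \<zero>\<^bsub>G\<^esub>" using g(2) p_reduce[OF f(1)] f(2) by simp
      then obtain m where m: "m \<in> carrier M" "e f = x \<odot>\<^bsub>M\<^esub> m" using red(4)[OF mod_homsD(1)[OF e(1) f(1)]] by blast
      have "m \<in> e ` carrier (free_module R I)" using m(1) e(2) by simp
      then obtain f' where f': "f' \<in> carrier (free_module R I)" "m = e f'" by blast
      \<comment> \<open>Since \<open>q\<close> kills \<open>e f\<close>, there is \<open>f'\<close>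
        with \<open>e f = x e f'\<close>. Subtracting \<open>x f'\<close> from \<open>f\<close>
        gives an element of the kernel of \<open>e\<close> with the same reduction.\<close>
      define k where "k = x \<odot>\<^bsub>free_module R I\<^esub> f'"
      have k: "k \<in> carrier (free_module R I)" unfolding k_def by (rule F.smult_closed[OF xR f'(1)])
      have ek: "e k = e f" unfolding k_def mod_homsD(3)[OF e(1) xR f'(1)] m(2) f'(2) ..
      have "reduce k = \<zero>\<^bsub>free_module R' I\<^esub>" using reduce(5)[OF k] f'(1) k_def by blast
      then have rk: "h (k i) = \<zero>\<^bsub>R'\<^esub>" for i by (simp add: reduce_def fun_eq_iff)
      have "reduce (f \<ominus>\<^bsub>free_module R I\<^esub> k) = g"
        unfolding R.free_module_minus[OF f(1) k] f(2) reduce_def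
        using f(1) k rk by (simp add: free_module_carrier a_minus_def)
      moreover have "e (f \<ominus>\<^bsub>free_module R I\<^esub> k) = \<zero>\<^bsub>M\<^esub>"
        unfolding mod_homs_minus[OF R.free_module M e(1) f(1) k] ek
        using mod_homsD(1)[OF e(1) f(1)] by (simp add: a_minus_def M.M.r_neg)
      then have "f \<ominus>\<^bsub>free_module R I\<^esub> k \<in> a_kernel (free_module R I) M e"
        unfolding a_kernel_iff using F.M.minus_closed[OF f(1) k] by blast
      ultimately show "g \<in> reduce ` a_kernel (free_module R I) M e" by blast
    qed
  qed
  have "finite_lifting_resolution R' (kernel_module (free_module R' I) G p)"
  proof (rule step.IH)
    show "module R' (kernel_module (free_module R' I) G p)"
      by (rule submodule_module[OF R'.free_module kernel_submodule[OF R'.free_module step.prems(1) p]])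
    show "reduction (kernel_module (free_module R I) M e) (kernel_module (free_module R' I) G p) reduce"
      by (rule kernel_reduction[OF M e(1) red(5) kernel])
  qed
  then show ?case
    by (rule finite_lifting_resolution.step[OF step.prems(1) R'.free_module R'.free_module_lifts_covers[OF I] p p_surj])
qed

end

lemma (in cring) finsum_regular_module:
  assumes "finite A" "g \<in> A \<rightarrow> carrier R"
  shows "finsum (regular_module R) g A = finsum R g A"
  using assms
proof (induction A rule: finite_induct)
  interpret M: module R "regular_module R" by (rule regular_module_module)
  case empty
  then show ?case using M.M.finsum_empty[of g] by simp
next
  interpret M: module R "regular_module R" by (rule regular_module_module)
  case (insert a A)
  then have g: "g \<in> A \<rightarrow> carrier R" "g a \<in> carrier R" by auto
  then show ?case using insert M.M.finsum_insert[of A a g] by simp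
qed

context cring
begin

lemma unit_multiple:
  assumes "f \<in> carrier (free_module R {0 :: nat})"
  shows "f = f 0 \<odot>\<^bsub>free_module R {0 :: nat}\<^esub> unit_vec R 0"
  using assms by (auto simp: free_module_carrier unit_vec_def fun_eq_iff)

end

context regular_quotient
begin

text \<open>The class of \<open>x\<close> spans a copy of the residue field in
  \<open>\<mm>/x\<mm>\<close>, and a linear form with value 1 at \<open>x\<close> splits it off. The
  claim lies one syzygy lower, where the reduced kernel \<open>L\<close> is a syzygy of
  \<open>\<mm>/x\<mm>\<close> and \<open>max_ideal_module R'\<close> one of the residue field. There
  inclusion and projection become the maps \<open>i\<close> and \<open>p\<close>, whose composite is
  the identity only up to a map through a free module.\<close>

theorem finite_minimal_resolution_quotient:
  assumes xm: "x \<in> max_ideal R" "x \<notin> max_ideal R \<cdot> max_ideal R"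
    and res: "finite_minimal_resolution R (max_ideal_module R)"
  shows "finite_minimal_resolution R' (max_ideal_module R')"
proof -
  let ?M = "max_ideal_module R" and ?M' = "max_ideal_module R'"
  let ?U = "free_module R {0 :: nat}" and ?U' = "free_module R' {0 :: nat}"
  interpret M: module R ?M by (rule R.max_ideal_module)
  interpret F0: module R ?U by (rule R.free_module)
  interpret F0': module R' ?U' by (rule R'.free_module)
  interpret RM: module R "regular_module R" by (rule R.regular_module_module)
  interpret RM': module R' "regular_module R'" by (rule R'.regular_module_module)
  have "\<one>\<^bsub>R'\<^esub> \<noteq> \<zero>\<^bsub>R'\<^esub>" using R'.mm.prime_one R'.mm.ideal_closed(1) by auto
  then have max': "max_ideal R' = h ` max_ideal R"
    by (rule R.surjective_image(2)[OF R'.cring_axioms _ h h_surj])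
  have M_carrier: "f \<in> carrier ?M \<longleftrightarrow> f \<in> carrier ?U \<and> f 0 \<in> max_ideal R" for f
    by (simp add: max_ideal_module_def)
  have M'_carrier: "f \<in> carrier ?M' \<longleftrightarrow> f \<in> carrier ?U' \<and> f 0 \<in> max_ideal R'" for f
    by (simp add: max_ideal_module_def)
  have M_simps: "\<zero>\<^bsub>?M\<^esub> = \<zero>\<^bsub>?U\<^esub>" "add ?M = add ?U" "smult ?M = smult ?U"
    "\<zero>\<^bsub>?M'\<^esub> = \<zero>\<^bsub>?U'\<^esub>" "add ?M' = add ?U'" "smult ?M' = smult ?U'"
    by (simp_all add: max_ideal_module_def)
  have vec: "a \<odot>\<^bsub>?U\<^esub> unit_vec R 0 \<in> carrier ?M" if "a \<in> max_ideal R" for a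
    unfolding M_carrier using that R.mm.Icarr by (auto simp: free_module_carrier unit_vec_def)
  have vec': "a \<odot>\<^bsub>?U'\<^esub> unit_vec R' 0 \<in> carrier ?M'" if "a \<in> max_ideal R'" for a
    unfolding M'_carrier using that R'.mm.Icarr by (auto simp: free_module_carrier unit_vec_def)
  have "x \<noteq> \<zero>" using reg[of \<one>] R.mm.prime_one R.mm.ideal_closed(1) by auto
  obtain I e where e: "minimal_cover R ?M I e"
    and resK: "finite_minimal_resolution R (kernel_module (free_module R I) ?M e)"
    using res
  proof (cases rule: finite_minimal_resolution.cases)
    \<comment> \<open>The resolution has at least one step, because \<open>x\<close> is a non-zero
      element of the maximal ideal.\<close>
    case zero
    then have "x \<odot>\<^bsub>?U\<^esub> unit_vec R 0 = \<zero>\<^bsub>?U\<^esub>" using vec[OF xm(1)] M_simps(1) by auto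
    then have "(x \<odot>\<^bsub>?U\<^esub> unit_vec R 0) 0 = \<zero>" by simp
    then show ?thesis using \<open>x \<noteq> \<zero>\<close> xR by (simp add: unit_vec_def)
  qed
  have I: "finite I" and eh: "e \<in> mod_homs R (free_module R I) ?M"
    "e ` carrier (free_module R I) = carrier ?M" using e by (auto simp: minimal_cover_def)
  let ?F = "free_module R I" and ?F' = "free_module R' I"
  interpret F: module R ?F by (rule R.free_module)
  interpret F': module R' ?F' by (rule R'.free_module)
  let ?K = "a_kernel ?F ?M e"
  have tf: "m = \<zero>\<^bsub>?M\<^esub>" if "m \<in> carrier ?M" "x \<odot>\<^bsub>?M\<^esub> m = \<zero>\<^bsub>?M\<^esub>" for m
    using that reg unfolding M_simps M_carrier by (auto simp: free_module_carrier fun_eq_iff)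
  define L where "L = reduce ` ?K"
  have K: "submodule ?K R ?F" by (rule kernel_submodule[OF R.free_module M.module_axioms eh(1)])
  note K' = F.submoduleE'[OF K]
  have KF: "f \<in> carrier ?F" if "f \<in> ?K" for f using that K'(1) by blast
  have Lsub: "submodule L R' ?F'"
  proof (rule F'.submoduleI')
    show "L \<subseteq> carrier ?F'" unfolding L_def using reduce(1) KF by blast
    have "reduce \<zero>\<^bsub>?F\<^esub> = \<zero>\<^bsub>?F'\<^esub>" by (simp add: reduce_def)
    then show "\<zero>\<^bsub>?F'\<^esub> \<in> L" unfolding L_def using K'(2) by (metis image_eqI)
    fix u v assume "u \<in> L" "v \<in> L"
    then obtain f g where *: "f \<in> ?K" "g \<in> ?K" "u = reduce f" "v = reduce g" unfolding L_def by blast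
    show "u \<oplus>\<^bsub>?F'\<^esub> v \<in> L"
      unfolding *(3,4) reduce(3)[OF KF[OF *(1)] KF[OF *(2)], symmetric] L_def using K'(4)[OF *(1,2)] by blast
  next
    fix a u assume a: "a \<in> carrier R'" and "u \<in> L"
    then obtain f where *: "f \<in> ?K" "u = reduce f" unfolding L_def by blast
    have "a \<in> h ` carrier R" using a h_surj by simp
    then obtain b where b: "b \<in> carrier R" "a = h b" by blast
    show "a \<odot>\<^bsub>?F'\<^esub> u \<in> L"
      unfolding *(2) b(2) reduce(4)[OF KF[OF *(1)] b(1), symmetric] L_def using K'(3)[OF b(1) *(1)] by blast
  qed
  have fin: "finite_lifting_resolution R' (?F'\<lparr>carrier := L\<rparr>)"
    by (rule finite_lifting_resolution_reduction[OF resK submodule_module[OF R'.free_module Lsub]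
      kernel_reduction[OF M.module_axioms eh(1) tf L_def]])
  obtain J e' where e': "minimal_cover R' ?M' J e'"
    by (rule R'.minimal_cover_exists[OF R'.max_ideal_module R'.max_ideal_module_finitely_generated])
  have e'h: "e' \<in> mod_homs R' (free_module R' J) ?M'" "e' ` carrier (free_module R' J) = carrier ?M'"
    using e' by (auto simp: minimal_cover_def)
  interpret FJ: module R' "free_module R' J" by (rule R'.free_module)

  obtain L1 where L1: "ideal L1 R" "\<And>v. v \<in> max_ideal R \<Longrightarrow> \<exists>a \<in> carrier R. v \<ominus> a \<otimes> x \<in> L1"
    "\<And>a. a \<in> carrier R \<Longrightarrow> a \<otimes> x \<in> L1 \<Longrightarrow> a \<in> max_ideal R"
    by (rule R.complement_in_max[OF xm]) blast
  have "\<forall>b\<in>I. \<exists>a. a \<in> carrier R \<and> e (unit_vec R b) 0 \<ominus> a \<otimes> x \<in> L1"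
  proof
    fix b assume "b \<in> I"
    then have "e (unit_vec R b) 0 \<in> max_ideal R"
      using mod_homsD(1)[OF eh(1) R.unit_vec_closed] M_carrier by blast
    then show "\<exists>a. a \<in> carrier R \<and> e (unit_vec R b) 0 \<ominus> a \<otimes> x \<in> L1" using L1(2) by blast
  qed
  from bchoice[OF this] obtain c where c: "\<And>b. b \<in> I \<Longrightarrow> c b \<in> carrier R"
    "\<And>b. b \<in> I \<Longrightarrow> e (unit_vec R b) 0 \<ominus> c b \<otimes> x \<in> L1" by blast
  \<comment> \<open>\<open>A\<close> lifts to the free module the linear form with value 1 at
    \<open>x\<close>: modulo \<open>L1\<close> the coordinate \<open>e f 0\<close> equals
    \<open>A f\<close> times \<open>x\<close>, and \<open>D\<close> is the difference.\<close>
  define A where "A = lincomb (regular_module R) c I"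
  have A: "A \<in> mod_homs R ?F (regular_module R)"
    unfolding A_def by (rule lincomb_hom[OF RM.module_axioms I]) (simp add: c)
  have AR: "A f \<in> carrier R" if "f \<in> carrier ?F" for f using mod_homsD(1)[OF A that] by simp
  define D where "D f = e f 0 \<ominus> A f \<otimes> x" for f
  have e0R: "e f 0 \<in> carrier R" if "f \<in> carrier ?F" for f
    using mod_homsD(1)[OF eh(1) that] M_carrier by (simp add: free_module_carrier)
  have D: "D \<in> mod_homs R ?F (regular_module R)"
  proof (rule mod_homsI)
    fix f assume f: "f \<in> carrier ?F"
    show "D f \<in> carrier (regular_module R)" using e0R[OF f] AR[OF f] xR by (simp add: D_def)
    show "D (f \<oplus>\<^bsub>?F\<^esub> g) = D f \<oplus>\<^bsub>regular_module R\<^esub> D g" if g: "g \<in> carrier ?F" for g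
      unfolding D_def mod_homsD(2)[OF eh(1) f g] mod_homsD(2)[OF A f g] M_simps
      using e0R[OF f] AR[OF f] e0R[OF g] AR[OF g] xR by (simp, algebra)
    show "D (a \<odot>\<^bsub>?F\<^esub> f) = a \<odot>\<^bsub>regular_module R\<^esub> D f" if a: "a \<in> carrier R" for a
      unfolding D_def mod_homsD(3)[OF eh(1) a f] mod_homsD(3)[OF A a f] M_simps
      using e0R[OF f] AR[OF f] a xR by (simp, algebra)
  qed
  have DL1: "D f \<in> L1" if f: "f \<in> carrier ?F" for f
  proof -
    have "D f = lincomb (regular_module R) (\<lambda>i. D (unit_vec R i)) I f"
      by (rule hom_free_eq_lincomb[OF RM.module_axioms I D f])
    also have "\<dots> \<in> L1"
      unfolding lincomb_def
    proof (rule RM.finsum_in_submodule[OF _ I])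
      show L1s: "submodule L1 R (regular_module R)" using L1(1) by (simp add: R.submodule_regular_iff)
      fix i assume i: "i \<in> I"
      have "A (unit_vec R i) = c i"
        unfolding A_def by (rule lincomb_unit_vec[OF RM.module_axioms I _ i]) (simp add: c)
      then have "D (unit_vec R i) \<in> L1" using c(2)[OF i] by (simp add: D_def)
      then show "f i \<odot>\<^bsub>regular_module R\<^esub> D (unit_vec R i) \<in> L1"
        using RM.submoduleE'(3)[OF L1s] f by (simp add: free_module_carrier)
    qed
    finally show ?thesis .
  qed
  interpret L1: ideal L1 R by (rule L1)
  have A_kernel: "A k \<in> max_ideal R" if k: "k \<in> ?K" for k
  proof -
    have kF: "k \<in> carrier ?F" by (rule KF[OF k])
    have "e k 0 = \<zero>" using k by (simp add: a_kernel_iff M_simps)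
    then have "D k = \<ominus> (A k \<otimes> x)" using AR[OF kF] xR by (simp add: D_def a_minus_def)
    then have "\<ominus> (\<ominus> (A k \<otimes> x)) \<in> L1" using L1.ideal_closed(4)[OF DL1[OF kF]] by simp
    then show ?thesis using L1(3)[OF AR[OF kF]] AR[OF kF] xR by simp
  qed
  have "x \<odot>\<^bsub>?U\<^esub> unit_vec R 0 \<in> e ` carrier ?F" unfolding eh(2) by (rule vec[OF xm(1)])
  \<comment> \<open>\<open>u\<close> lies over \<open>x\<close>, so its reduction covers the copy of
    the residue field in \<open>\<mm>/x\<mm>\<close>, and \<open>A u\<close> is congruent to 1
    modulo the maximal ideal.\<close>
  then obtain u where u: "u \<in> carrier ?F" "e u = x \<odot>\<^bsub>?U\<^esub> unit_vec R 0" by force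
  have Au: "A u \<ominus> \<one> \<in> max_ideal R"
  proof (rule L1(3))
    show "A u \<ominus> \<one> \<in> carrier R" using AR[OF u(1)] by simp
    have "D u = x \<ominus> A u \<otimes> x" unfolding D_def u(2) using xR by (simp add: unit_vec_def)
    then have "(A u \<ominus> \<one>) \<otimes> x = \<ominus> D u" using AR[OF u(1)] xR by (simp, algebra)
    then show "(A u \<ominus> \<one>) \<otimes> x \<in> L1" using L1.ideal_closed(4)[OF DL1[OF u(1)]] by simp
  qed

  define B where "B = lincomb (regular_module R') (\<lambda>b. h (c b)) I"
  have B: "B \<in> mod_homs R' ?F' (regular_module R')"
    unfolding B_def by (rule lincomb_hom[OF RM'.module_axioms I]) (simp add: c)
  have BA: "B (reduce f) = h (A f)" if f: "f \<in> carrier ?F" for f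
  proof -
    have fR: "f i \<in> carrier R" for i using f by (simp add: free_module_carrier)
    have fin: "(\<lambda>i. f i \<otimes> c i) \<in> I \<rightarrow> carrier R" "(\<lambda>i. h (f i) \<otimes>\<^bsub>R'\<^esub> h (c i)) \<in> I \<rightarrow> carrier R'"
      using fR c(1) by auto
    have "h (A f) = h (\<Oplus>i\<in>I. f i \<otimes> c i)"
      unfolding A_def lincomb_def using R.finsum_regular_module[OF I fin(1)] by simp
    also have "\<dots> = (\<Oplus>\<^bsub>R'\<^esub>i\<in>I. (h \<circ> (\<lambda>i. f i \<otimes> c i)) i)"
      using h.hom_finsum[OF fin(1)] by (simp add: comp_def)
    also have "\<dots> = (\<Oplus>\<^bsub>R'\<^esub>i\<in>I. h (f i) \<otimes>\<^bsub>R'\<^esub> h (c i))"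
      by (rule R'.add.finprod_cong'[OF refl fin(2), folded finsum_def]) (use fR c(1) in simp)
    also have "\<dots> = B (reduce f)"
      unfolding B_def lincomb_def reduce_def using R'.finsum_regular_module[OF I fin(2)] by simp
    finally show ?thesis by simp
  qed
  \<comment> \<open>The defect \<open>A u - \<one>\<close> need not vanish, but it lies in the
    maximal ideal. Multiplication by its image \<open>\<nu>\<close> on
    \<open>max_ideal_module R'\<close> factors through the free cover: \<open>w\<close> lies over
    \<open>\<nu>\<close>, and \<open>t\<close> sends \<open>g\<close> to \<open>g 0\<close> times
    \<open>w\<close>.\<close>
  define \<nu> where "\<nu> = h (A u \<ominus> \<one>)"
  have \<nu>: "\<nu> \<in> max_ideal R'" unfolding \<nu>_def max' using Au by blast
  have \<nu>R: "\<nu> \<in> carrier R'" using \<nu> R'.mm.Icarr by simp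
  have hAu: "h (A u) = \<one>\<^bsub>R'\<^esub> \<oplus>\<^bsub>R'\<^esub> \<nu>"
  proof -
    have "A u = \<one> \<oplus> (A u \<ominus> \<one>)" using AR[OF u(1)] by algebra
    then have "h (A u) = h (\<one> \<oplus> (A u \<ominus> \<one>))" by simp
    then show ?thesis unfolding \<nu>_def using AR[OF u(1)] by simp
  qed
  have "\<nu> \<odot>\<^bsub>?U'\<^esub> unit_vec R' 0 \<in> e' ` carrier (free_module R' J)" unfolding e'h(2) by (rule vec'[OF \<nu>])
  then obtain w where w: "w \<in> carrier (free_module R' J)" "e' w = \<nu> \<odot>\<^bsub>?U'\<^esub> unit_vec R' 0" by force
  have ru: "reduce u \<in> carrier ?F'" by (rule reduce(1)[OF u(1)])
  have M'0: "g 0 \<in> carrier R'" if "g \<in> carrier ?M'" for g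
    using that M'_carrier by (simp add: free_module_carrier)

  \<comment> \<open>\<open>i\<close> restricts the map that sends 1 to \<open>reduce u\<close>, a
    lift of the inclusion of the residue field; \<open>p\<close> restricts \<open>B\<close>, the
    reduction of \<open>A\<close>.\<close>
  define i where "i g = g 0 \<odot>\<^bsub>?F'\<^esub> reduce u" for g :: "nat \<Rightarrow> 'c"
  define p where "p g = B g \<odot>\<^bsub>?U'\<^esub> unit_vec R' 0" for g
  define t where "t g = g 0 \<odot>\<^bsub>free_module R' J\<^esub> w" for g :: "nat \<Rightarrow> 'c"
  have i: "i \<in> mod_homs R' ?M' (?F'\<lparr>carrier := L\<rparr>)"
  proof (rule mod_homsI)
    fix g assume g: "g \<in> carrier ?M'"
    then have "g 0 \<in> h ` max_ideal R" using M'_carrier max' by blast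
    then obtain \<alpha> where \<alpha>: "\<alpha> \<in> max_ideal R" "g 0 = h \<alpha>" by blast
    have \<alpha>R: "\<alpha> \<in> carrier R" using \<alpha> R.mm.Icarr by simp
    have "\<alpha> \<odot>\<^bsub>?U\<^esub> unit_vec R 0 \<in> e ` carrier ?F" unfolding eh(2) by (rule vec[OF \<alpha>(1)])
    then obtain v where v: "v \<in> carrier ?F" "e v = \<alpha> \<odot>\<^bsub>?U\<^esub> unit_vec R 0" by force
    \<comment> \<open>\<open>\<alpha> u\<close> and \<open>x v\<close> have the same image
      \<open>\<alpha> x\<close> under \<open>e\<close>, so \<open>k\<close> is in the kernel, and it
      has the same reduction as \<open>\<alpha> u\<close>. This puts the values of \<open>i\<close>
      into \<open>L\<close>.\<close>
    define k where "k = \<alpha> \<odot>\<^bsub>?F\<^esub> u \<ominus>\<^bsub>?F\<^esub> x \<odot>\<^bsub>?F\<^esub> v"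
    have au: "\<alpha> \<odot>\<^bsub>?F\<^esub> u \<in> carrier ?F" and xv: "x \<odot>\<^bsub>?F\<^esub> v \<in> carrier ?F"
      by (rule F.smult_closed[OF \<alpha>R u(1)] F.smult_closed[OF xR v(1)])+
    have "e (\<alpha> \<odot>\<^bsub>?F\<^esub> u) = e (x \<odot>\<^bsub>?F\<^esub> v)"
      unfolding mod_homsD(3)[OF eh(1) \<alpha>R u(1)] mod_homsD(3)[OF eh(1) xR v(1)] u(2) v(2) M_simps
      using \<alpha>R xR by (auto simp: unit_vec_def fun_eq_iff R.m_lcomm)
    then have "e k = \<zero>\<^bsub>?M\<^esub>"
      unfolding k_def mod_homs_minus[OF R.free_module M.module_axioms eh(1) au xv]
      using mod_homsD(1)[OF eh(1) xv] by (simp add: a_minus_def M.M.r_neg)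
    then have kK: "k \<in> ?K" unfolding a_kernel_iff k_def using F.M.minus_closed[OF au xv] by blast
    have "reduce (x \<odot>\<^bsub>?F\<^esub> v) = \<zero>\<^bsub>?F'\<^esub>" using reduce(5)[OF xv] v(1) by blast
    then have "h ((x \<odot>\<^bsub>?F\<^esub> v) j) = \<zero>\<^bsub>R'\<^esub>" for j unfolding reduce_def by (simp add: fun_eq_iff)
    then have "reduce k = reduce (\<alpha> \<odot>\<^bsub>?F\<^esub> u)"
      unfolding k_def R.free_module_minus[OF au xv] unfolding reduce_def
      using au xv by (simp add: free_module_carrier a_minus_def del: free_module_simps)
    then have "reduce k = i g" unfolding i_def \<alpha>(2) reduce(4)[OF u(1) \<alpha>R] .
    moreover have "reduce k \<in> L" unfolding L_def by (rule imageI[OF kK])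
    ultimately show "i g \<in> carrier (?F'\<lparr>carrier := L\<rparr>)" by simp
    show "i (g \<oplus>\<^bsub>?M'\<^esub> g') = i g \<oplus>\<^bsub>?F'\<lparr>carrier := L\<rparr>\<^esub> i g'" if g': "g' \<in> carrier ?M'" for g'
      unfolding i_def M_simps using F'.smult_l_distr[OF M'0[OF g] M'0[OF g'] ru] by simp
    show "i (a \<odot>\<^bsub>?M'\<^esub> g) = a \<odot>\<^bsub>?F'\<lparr>carrier := L\<rparr>\<^esub> i g" if a: "a \<in> carrier R'" for a
      unfolding i_def M_simps using F'.smult_assoc1[OF a M'0[OF g] ru] by simp
  qed
  have LF: "g \<in> carrier ?F'" if "g \<in> L" for g using that F'.submoduleE'(1)[OF Lsub] by blast
  have BR: "B g \<in> carrier R'" if "g \<in> carrier ?F'" for g using mod_homsD(1)[OF B that] by simp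
  have unit': "unit_vec R' 0 \<in> carrier ?U'" by (rule R'.unit_vec_closed) simp
  have p: "p \<in> mod_homs R' (?F'\<lparr>carrier := L\<rparr>) ?M'"
  proof (rule mod_homsI)
    fix g assume "g \<in> carrier (?F'\<lparr>carrier := L\<rparr>)"
    then have gL: "g \<in> L" by simp
    then obtain k where k: "k \<in> ?K" "g = reduce k" unfolding L_def by blast
    have "B g \<in> max_ideal R'"
      unfolding k(2) BA[OF KF[OF k(1)]] max' using A_kernel[OF k(1)] by blast
    then show "p g \<in> carrier ?M'" unfolding p_def by (rule vec')
    show "p (g \<oplus>\<^bsub>?F'\<lparr>carrier := L\<rparr>\<^esub> g') = p g \<oplus>\<^bsub>?M'\<^esub> p g'"
      if "g' \<in> carrier (?F'\<lparr>carrier := L\<rparr>)" for g'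
    proof -
      have g'L: "g' \<in> L" using that by simp
      have "B (g \<oplus>\<^bsub>?F'\<^esub> g') = B g \<oplus>\<^bsub>R'\<^esub> B g'" using mod_homsD(2)[OF B LF[OF gL] LF[OF g'L]] by simp
      then show ?thesis
        unfolding p_def M_simps using F0'.smult_l_distr[OF BR[OF LF[OF gL]] BR[OF LF[OF g'L]] unit'] by simp
    qed
    show "p (a \<odot>\<^bsub>?F'\<lparr>carrier := L\<rparr>\<^esub> g) = a \<odot>\<^bsub>?M'\<^esub> p g" if a: "a \<in> carrier R'" for a
    proof -
      have "B (a \<odot>\<^bsub>?F'\<^esub> g) = a \<otimes>\<^bsub>R'\<^esub> B g" using mod_homsD(3)[OF B a LF[OF gL]] by simp
      then show ?thesis
        unfolding p_def M_simps using F0'.smult_assoc1[OF a BR[OF LF[OF gL]] unit'] by simp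
    qed
  qed
  have t: "t \<in> mod_homs R' ?M' (free_module R' J)"
  proof (rule mod_homsI)
    fix g assume g: "g \<in> carrier ?M'"
    show "t g \<in> carrier (free_module R' J)" unfolding t_def by (rule FJ.smult_closed[OF M'0[OF g] w(1)])
    show "t (g \<oplus>\<^bsub>?M'\<^esub> g') = t g \<oplus>\<^bsub>free_module R' J\<^esub> t g'" if g': "g' \<in> carrier ?M'" for g'
      unfolding t_def M_simps using FJ.smult_l_distr[OF M'0[OF g] M'0[OF g'] w(1)] by simp
    show "t (a \<odot>\<^bsub>?M'\<^esub> g) = a \<odot>\<^bsub>free_module R' J\<^esub> t g" if a: "a \<in> carrier R'" for a
      unfolding t_def M_simps using FJ.smult_assoc1[OF a M'0[OF g] w(1)] by simp
  qed
  have pit: "p (i g) = g \<oplus>\<^bsub>?M'\<^esub> e' (t g)" if g: "g \<in> carrier ?M'" for g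
  proof -
    have g0: "g 0 \<in> carrier R'" by (rule M'0[OF g])
    have "B (i g) = g 0 \<otimes>\<^bsub>R'\<^esub> (\<one>\<^bsub>R'\<^esub> \<oplus>\<^bsub>R'\<^esub> \<nu>)"
      unfolding i_def hAu[symmetric] BA[OF u(1), symmetric] using mod_homsD(3)[OF B g0 ru] by simp
    also have "\<dots> = g 0 \<oplus>\<^bsub>R'\<^esub> g 0 \<otimes>\<^bsub>R'\<^esub> \<nu>" using g0 \<nu>R by (simp add: R'.r_distr)
    finally have Bi: "B (i g) = g 0 \<oplus>\<^bsub>R'\<^esub> g 0 \<otimes>\<^bsub>R'\<^esub> \<nu>" .
    have "p (i g) = g 0 \<odot>\<^bsub>?U'\<^esub> unit_vec R' 0 \<oplus>\<^bsub>?U'\<^esub> (g 0 \<otimes>\<^bsub>R'\<^esub> \<nu>) \<odot>\<^bsub>?U'\<^esub> unit_vec R' 0"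
      unfolding p_def Bi by (rule F0'.smult_l_distr[OF g0 _ unit']) (simp add: g0 \<nu>R)
    also have "g 0 \<odot>\<^bsub>?U'\<^esub> unit_vec R' 0 = g"
      using R'.unit_multiple[of g] g M'_carrier by simp
    also have "(g 0 \<otimes>\<^bsub>R'\<^esub> \<nu>) \<odot>\<^bsub>?U'\<^esub> unit_vec R' 0 = g 0 \<odot>\<^bsub>?U'\<^esub> e' w"
      unfolding w(2) by (rule F0'.smult_assoc1[OF g0 \<nu>R unit'])
    also have "g 0 \<odot>\<^bsub>?U'\<^esub> e' w = e' (t g)"
      unfolding t_def using mod_homsD(3)[OF e'h(1) g0 w(1)] M_simps by simp
    finally show ?thesis using M_simps by simp
  qed
  have "stable_retract R' ?M' (?F'\<lparr>carrier := L\<rparr>) (free_module R' J) e'"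
    unfolding stable_retract_def using i p t pit by blast
  then show ?thesis
    by (rule R'.finite_minimal_resolution_of_stable_retract[OF fin R'.max_ideal_module e'])
qed

end

section \<open>Serre's theorem\<close>

context noetherian_local_ring
begin

lemma quotient_local:
  assumes J: "ideal J R" "J \<subseteq> \<mm>"
  shows "noetherian_local_ring (R Quot J)" and "max_ideal (R Quot J) = (+>) J ` \<mm>"
    and "(+>) J \<in> ring_hom R (R Quot J)" and "(+>) J ` carrier R = carrier (R Quot J)"
    and "\<And>a. a \<in> carrier R \<Longrightarrow> J +> a = \<zero>\<^bsub>R Quot J\<^esub> \<longleftrightarrow> a \<in> J"
proof -
  interpret J: ideal J R by (rule J)
  show hom: "(+>) J \<in> ring_hom R (R Quot J)" by (rule J.rcos_ring_hom)
  show surj: "(+>) J ` carrier R = carrier (R Quot J)"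
    by (auto simp: FactRing_def A_RCOSETS_def')
  show zero: "J +> a = \<zero>\<^bsub>R Quot J\<^esub> \<longleftrightarrow> a \<in> J" if "a \<in> carrier R" for a
    using J.rcos_const_imp_mem[OF that] a_rcos_zero[OF J.is_ideal] by (auto simp: FactRing_def)
  have "\<one>\<^bsub>R Quot J\<^esub> \<noteq> \<zero>\<^bsub>R Quot J\<^esub>"
    using zero[of \<one>] ring_hom_one[OF hom] J(2) mm.prime_one by auto
  note image = surjective_image[OF J.quotient_is_cring[OF cring_axioms] this hom surj]
  show "noetherian_local_ring (R Quot J)" "max_ideal (R Quot J) = (+>) J ` \<mm>" by (rule image)+
qed

text \<open>The third isomorphism theorem for \<open>R/J\<close> and \<open>R/(J + xR)\<close>.
  \<open>B\<close> stands for \<open>R/J\<close> up to isomorphism, so that \<open>R\<close> itself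
  can take this place when \<open>J\<close> is zero.\<close>

lemma regular_quotient_of_quotient:
  fixes B :: "('c, 'd) ring_scheme"
  assumes B: "noetherian_local_ring B" and f: "f \<in> ring_hom R B" "f ` carrier R = carrier B"
    and J: "ideal J R" "\<And>a. a \<in> carrier R \<Longrightarrow> f a = \<zero>\<^bsub>B\<^esub> \<longleftrightarrow> a \<in> J"
    and x: "x \<in> \<mm>" and J': "adjoin R J x \<subseteq> \<mm>"
    and reg: "\<And>w. w \<in> carrier B \<Longrightarrow> f x \<otimes>\<^bsub>B\<^esub> w = \<zero>\<^bsub>B\<^esub> \<Longrightarrow> w = \<zero>\<^bsub>B\<^esub>"
  obtains h where "regular_quotient B (R Quot adjoin R J x) h (f x)"
proof -
  interpret B: noetherian_local_ring B by (rule B)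
  interpret f: ring_hom_cring R B f
    by (intro ring_hom_cring.intro cring_axioms B.cring_axioms ring_hom_cring_axioms.intro f)
  have xR: "x \<in> carrier R" using x mm.Icarr by simp
  let ?J = "adjoin R J x"
  note adj = adjoin[OF J(1) xR]
  interpret J': ideal ?J R by (rule adj)
  note Q = quotient_local[OF adj(1) J']
  interpret Q: noetherian_local_ring "R Quot ?J" by (rule Q)
  define s where "s y = (SOME a. a \<in> carrier R \<and> f a = y)" for y
  have s: "s y \<in> carrier R" "f (s y) = y" if "y \<in> carrier B" for y
  proof -
    have "y \<in> f ` carrier R" using that f(2) by simp
    then have "\<exists>a. a \<in> carrier R \<and> f a = y" by blast
    then show "s y \<in> carrier R" "f (s y) = y" unfolding s_def by (rule someI2_ex, simp)+
  qed
  define h where "h y = ?J +> s y" for y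
  have hf: "h (f a) = ?J +> a" if a: "a \<in> carrier R" for a
  proof -
    have "f (s (f a) \<ominus> a) = \<zero>\<^bsub>B\<^esub>" using s[of "f a"] a by (simp add: a_minus_def B.r_neg)
    then have "s (f a) \<ominus> a \<in> J" using J(2)[of "s (f a) \<ominus> a"] s[of "f a"] a by simp
    then have "s (f a) \<ominus> a \<in> ?J" using adj(2) by blast
    then show ?thesis
      unfolding h_def using quotient_eq_iff_same_a_r_cos[OF adj(1), of "s (f a)" a] s[of "f a"] a by simp
  qed
  have cover: "\<exists>a \<in> carrier R. y = f a" if "y \<in> carrier B" for y
    using s[OF that] by (intro bexI[of _ "s y"]) simp_all
  have h: "h \<in> ring_hom B (R Quot ?J)"
  proof (rule ring_hom_memI)
    fix y assume "y \<in> carrier B"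
    then obtain a where a: "a \<in> carrier R" "y = f a" using cover by blast
    show "h y \<in> carrier (R Quot ?J)" unfolding a(2) hf[OF a(1)] using Q(4) a(1) by blast
    fix z assume "z \<in> carrier B"
    then obtain b where b: "b \<in> carrier R" "z = f b" using cover by blast
    have "h (y \<otimes>\<^bsub>B\<^esub> z) = h (f (a \<otimes> b))" using a b by simp
    also have "\<dots> = ?J +> (a \<otimes> b)" by (rule hf) (use a b in simp)
    finally show "h (y \<otimes>\<^bsub>B\<^esub> z) = h y \<otimes>\<^bsub>R Quot ?J\<^esub> h z"
      unfolding a(2) b(2) hf[OF a(1)] hf[OF b(1)] ring_hom_mult[OF Q(3) a(1) b(1)] .
    have "h (y \<oplus>\<^bsub>B\<^esub> z) = h (f (a \<oplus> b))" using a b by simp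
    also have "\<dots> = ?J +> (a \<oplus> b)" by (rule hf) (use a b in simp)
    finally show "h (y \<oplus>\<^bsub>B\<^esub> z) = h y \<oplus>\<^bsub>R Quot ?J\<^esub> h z"
      unfolding a(2) b(2) hf[OF a(1)] hf[OF b(1)] ring_hom_add[OF Q(3) a(1) b(1)] .
  next
    show "h \<one>\<^bsub>B\<^esub> = \<one>\<^bsub>R Quot ?J\<^esub>" using hf[OF one_closed] unfolding f.hom_one ring_hom_one[OF Q(3)] .
  qed
  have "regular_quotient B (R Quot ?J) h (f x)"
  proof (intro regular_quotient.intro regular_quotient_axioms.intro B Q(1) h)
    show "h ` carrier B = carrier (R Quot ?J)"
    proof
      show "h ` carrier B \<subseteq> carrier (R Quot ?J)" using ring_hom_closed[OF h] by blast
      show "carrier (R Quot ?J) \<subseteq> h ` carrier B"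
      proof
        fix X assume "X \<in> carrier (R Quot ?J)"
        then obtain a where a: "a \<in> carrier R" "X = ?J +> a" using Q(4) by blast
        show "X \<in> h ` carrier B" unfolding a(2) hf[OF a(1), symmetric] by (rule imageI[OF f.hom_closed[OF a(1)]])
      qed
    qed
    show "f x \<in> carrier B" using xR by simp
    show "w = \<zero>\<^bsub>B\<^esub>" if "w \<in> carrier B" "f x \<otimes>\<^bsub>B\<^esub> w = \<zero>\<^bsub>B\<^esub>" for w by (rule reg[OF that])
    fix y assume "y \<in> carrier B"
    then obtain a where a: "a \<in> carrier R" "y = f a" using cover by blast
    have "h y = \<zero>\<^bsub>R Quot ?J\<^esub> \<longleftrightarrow> a \<in> ?J" unfolding a(2) hf[OF a(1)] by (rule Q(5)[OF a(1)])
    also have "\<dots> \<longleftrightarrow> (\<exists>b \<in> carrier B. y = f x \<otimes>\<^bsub>B\<^esub> b)"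
    proof
      assume "a \<in> ?J"
      then obtain j b where jb: "j \<in> J" "b \<in> carrier R" "a = j \<oplus> b \<otimes> x" unfolding adjoin_def by blast
      have j: "j \<in> carrier R" "f j = \<zero>\<^bsub>B\<^esub>" using jb(1) ideal.Icarr[OF J(1)] J(2) by auto
      have "y = f x \<otimes>\<^bsub>B\<^esub> f b" unfolding a(2) jb(3) using j jb(2) xR by (simp add: B.m_comm)
      then show "\<exists>b \<in> carrier B. y = f x \<otimes>\<^bsub>B\<^esub> b" using f.hom_closed[OF jb(2)] by blast
    next
      assume "\<exists>b \<in> carrier B. y = f x \<otimes>\<^bsub>B\<^esub> b"
      then obtain b where b: "b \<in> carrier R" "y = f x \<otimes>\<^bsub>B\<^esub> f b" using cover by blast
      have "f (a \<ominus> b \<otimes> x) = \<zero>\<^bsub>B\<^esub>"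
        using a b xR by (simp add: a_minus_def B.m_comm B.r_neg)
      then have "a \<ominus> b \<otimes> x \<in> J" using J(2)[of "a \<ominus> b \<otimes> x"] a(1) b(1) xR by simp
      then have "a \<ominus> b \<otimes> x \<in> ?J" using adj(2) by blast
      then have "(a \<ominus> b \<otimes> x) \<oplus> b \<otimes> x \<in> ?J" by (rule J'.ideal_closed(3)) (rule J'.ideal_closed(2)[OF b(1) adj(3)])
      then show "a \<in> ?J" using a(1) b(1) xR by (simp add: add_minus_cancel)
    qed
    finally show "h y = \<zero>\<^bsub>R Quot ?J\<^esub> \<longleftrightarrow> (\<exists>b \<in> carrier B. y = f x \<otimes>\<^bsub>B\<^esub> b)" .
  qed
  then show ?thesis by (rule that)
qed

text \<open>In depth zero the collapse of resolutions applies to \<open>\<mm>\<close> as a submodule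
  of the free module of rank one, because its coordinates lie in \<open>\<mm>\<close>. The ring is
  then a field.\<close>

lemma max_ideal_zero_if_socle:
  assumes z: "z \<in> carrier R" "z \<noteq> \<zero>" "\<And>a. a \<in> \<mm> \<Longrightarrow> z \<otimes> a = \<zero>"
    and res: "finite_minimal_resolution R (max_ideal_module R)"
  shows "\<mm> = {\<zero>}"
proof -
  let ?K = "{f \<in> carrier (free_module R {0 :: nat}). f 0 \<in> \<mm>}"
  have K: "?K = {\<zero>\<^bsub>free_module R {0 :: nat}\<^esub>}"
  proof (rule zero_if_socle[OF z(1,2) _ max_ideal_submodule])
    show "f i \<in> \<mm>" if "f \<in> ?K" for f i
      using that mm.ideal_closed(1) by (cases "i = 0") (auto simp: free_module_carrier)
    show "finite_minimal_resolution R ((free_module R {0})\<lparr>carrier := ?K\<rparr>)"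
      using res unfolding max_ideal_module_def .
  qed (rule z(3))
  have "a = \<zero>" if a: "a \<in> \<mm>" for a
  proof -
    define f where "f = (\<lambda>i :: nat. if i = 0 then a else \<zero>)"
    have "f \<in> ?K" using a mm.Icarr by (simp add: f_def free_module_carrier)
    then have "f = \<zero>\<^bsub>free_module R {0 :: nat}\<^esub>" using K by blast
    then have "f 0 = \<zero>" by simp
    then show ?thesis by (simp add: f_def)
  qed
  then show ?thesis using mm.ideal_closed(1) by blast
qed

text \<open>The induction step of Serre's theorem, for the ring \<open>B = R/J\<close>.\<close>

lemma regular_step:
  fixes B :: "('c, 'd) ring_scheme"
  assumes B: "noetherian_local_ring B" and f: "f \<in> ring_hom R B" "f ` carrier R = carrier B"
    and J: "ideal J R" "\<And>a. a \<in> carrier R \<Longrightarrow> f a = \<zero>\<^bsub>B\<^esub> \<longleftrightarrow> a \<in> J"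
    and res: "finite_minimal_resolution B (max_ideal_module B)" and ne: "J \<noteq> \<mm>"
  obtains x where "x \<in> carrier R" "x \<notin> J" "\<forall>a \<in> carrier R. x \<otimes> a \<in> J \<longrightarrow> a \<in> J"
    "adjoin R J x \<subseteq> \<mm>"
    "finite_minimal_resolution (R Quot adjoin R J x) (max_ideal_module (R Quot adjoin R J x))"
proof -
  interpret B: noetherian_local_ring B by (rule B)
  interpret f: ring_hom_cring R B f
    by (intro ring_hom_cring.intro cring_axioms B.cring_axioms ring_hom_cring_axioms.intro f)
  interpret J: ideal J R by (rule J)
  have B10: "\<one>\<^bsub>B\<^esub> \<noteq> \<zero>\<^bsub>B\<^esub>" using B.mm.prime_one B.mm.ideal_closed(1) by auto
  have maxB: "max_ideal B = f ` \<mm>" by (rule surjective_image(2)[OF B.cring_axioms B10 f])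
  have "\<one> \<notin> J" using J(2)[of \<one>] B10 by simp
  then have Jm: "J \<subseteq> \<mm>" by (rule proper_ideal_subset_max[OF J(1)])
  obtain a where a: "a \<in> \<mm>" "a \<notin> J" using ne Jm by blast
  have m0: "max_ideal B \<noteq> {\<zero>\<^bsub>B\<^esub>}"
  proof
    assume "max_ideal B = {\<zero>\<^bsub>B\<^esub>}"
    then have "f a = \<zero>\<^bsub>B\<^esub>" using maxB a(1) by blast
    then show False using J(2)[of a] a mm.Icarr by simp
  qed
  \<comment> \<open>A socle element would make the maximal ideal of \<open>B\<close> zero, against
    \<open>J \<noteq> \<mm>\<close>.\<close>
  have "\<exists>y. y \<in> max_ideal B \<and> (\<forall>w \<in> carrier B. y \<otimes>\<^bsub>B\<^esub> w = \<zero>\<^bsub>B\<^esub> \<longrightarrow> w = \<zero>\<^bsub>B\<^esub>)"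
  proof (rule B.socle_or_regular_element)
    fix z assume "z \<in> carrier B" "z \<noteq> \<zero>\<^bsub>B\<^esub>" "\<And>a. a \<in> max_ideal B \<Longrightarrow> z \<otimes>\<^bsub>B\<^esub> a = \<zero>\<^bsub>B\<^esub>"
    then have "max_ideal B = {\<zero>\<^bsub>B\<^esub>}" by (rule B.max_ideal_zero_if_socle[OF _ _ _ res])
    then show ?thesis using m0 by simp
  qed blast
  then obtain y where y: "y \<in> max_ideal B" "\<And>w. w \<in> carrier B \<Longrightarrow> y \<otimes>\<^bsub>B\<^esub> w = \<zero>\<^bsub>B\<^esub> \<Longrightarrow> w = \<zero>\<^bsub>B\<^esub>" by blast
  obtain v where v: "v \<in> max_ideal B" "v \<notin> max_ideal B \<cdot>\<^bsub>B\<^esub> max_ideal B"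
    "\<And>w. w \<in> carrier B \<Longrightarrow> v \<otimes>\<^bsub>B\<^esub> w = \<zero>\<^bsub>B\<^esub> \<Longrightarrow> w = \<zero>\<^bsub>B\<^esub>"
    by (rule B.regular_element_outside_square[OF y m0]) blast+
  obtain x where x: "x \<in> \<mm>" "v = f x" using v(1) maxB by blast
  have xR: "x \<in> carrier R" using x mm.Icarr by simp
  have J': "adjoin R J x \<subseteq> \<mm>" by (rule adjoin(4)[OF J(1) xR mm.is_ideal Jm x(1)])
  obtain h where h: "regular_quotient B (R Quot adjoin R J x) h (f x)"
    by (rule regular_quotient_of_quotient[OF B f J x(1) J' v(3)[unfolded x(2)]])
  show ?thesis
  proof (rule that[OF xR _ _ J'])
    show "x \<notin> J"
    proof
      assume "x \<in> J"
      then have "v = \<zero>\<^bsub>B\<^esub>" using J(2) xR x(2) by simp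
      then show False using v(3)[of "\<one>\<^bsub>B\<^esub>"] B10 by simp
    qed
    show "\<forall>b \<in> carrier R. x \<otimes> b \<in> J \<longrightarrow> b \<in> J"
    proof (intro ballI impI)
      fix b assume b: "b \<in> carrier R" "x \<otimes> b \<in> J"
      have "f (x \<otimes> b) = \<zero>\<^bsub>B\<^esub>" using J(2)[of "x \<otimes> b"] b xR by simp
      then have "f b = \<zero>\<^bsub>B\<^esub>" using v(3)[of "f b"] b(1) xR x(2) by simp
      then show "b \<in> J" using J(2)[OF b(1)] by simp
    qed
    show "finite_minimal_resolution (R Quot adjoin R J x) (max_ideal_module (R Quot adjoin R J x))"
      by (rule regular_quotient.finite_minimal_resolution_quotient[OF h v(1,2)[unfolded x(2)] res])
  qed
qed

lemma regular_flag_prepend: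
  assumes "regular_flag R (adjoin R J x) n K y" "x \<in> carrier R"
    "\<forall>a \<in> carrier R. x \<otimes> a \<in> J \<longrightarrow> a \<in> J"
  shows "regular_flag R J (Suc n) (case_nat J K) (case_nat x y)"
proof -
  have K: "K 0 = adjoin R J x" "K n = \<mm>" "\<And>i. i < n \<Longrightarrow> y i \<in> carrier R \<and> K (Suc i) = adjoin R (K i) (y i) \<and>
      (\<forall>a \<in> carrier R. y i \<otimes> a \<in> K i \<longrightarrow> a \<in> K i)"
    using assms(1) by (simp_all add: regular_flag_def)
  have "case_nat x y i \<in> carrier R \<and> case_nat J K (Suc i) = adjoin R (case_nat J K i) (case_nat x y i) \<and>
      (\<forall>a \<in> carrier R. case_nat x y i \<otimes> a \<in> case_nat J K i \<longrightarrow> a \<in> case_nat J K i)" if "i < Suc n" for i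
  proof (cases i)
    case 0
    show ?thesis unfolding 0 nat.case K(1) using assms(2,3) by blast
  next
    case (Suc k)
    then have "k < n" using that by simp
    then show ?thesis unfolding Suc nat.case by (rule K(3))
  qed
  then show ?thesis unfolding regular_flag_def nat.case using K(2) by blast
qed

text \<open>The induction runs over ideals \<open>J\<close> of the fixed ring \<open>R\<close>,
  since the rings \<open>R Quot J\<close> all share one type, whereas iterated quotients would
  change it at every step.\<close>

lemma regular_flag_of_quotient_resolution:
  assumes "ideal J R"
  shows "J \<subseteq> \<mm> \<Longrightarrow> finite_minimal_resolution (R Quot J) (max_ideal_module (R Quot J)) \<Longrightarrow>
    \<exists>n K y. regular_flag R J n K y"
  using assms
proof (induction J rule: ideal_induct)
  case (step J)
  show ?case
  proof (cases "J = \<mm>")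
    case True
    then have "regular_flag R J 0 (\<lambda>_. J) (\<lambda>_. \<zero>)" by (simp add: regular_flag_def)
    then show ?thesis by blast
  next
    case False
    note Q = quotient_local[OF step(1,3)]
    obtain x where x: "x \<in> carrier R" "x \<notin> J" "\<forall>a \<in> carrier R. x \<otimes> a \<in> J \<longrightarrow> a \<in> J"
      "adjoin R J x \<subseteq> \<mm>"
      "finite_minimal_resolution (R Quot adjoin R J x) (max_ideal_module (R Quot adjoin R J x))"
      by (rule regular_step[OF Q(1,3,4) step(1) Q(5) step(4) False]) blast
    note adj = adjoin[OF step(1) x(1)]
    have "J \<subset> adjoin R J x" using adj(2,3) x(2) by blast
    then obtain n K y where "regular_flag R (adjoin R J x) n K y" using step(2)[OF adj(1)] x(4,5) by blast
    then show ?thesis using regular_flag_prepend[OF _ x(1,3)] by blast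
  qed
qed

theorem regular_of_finite_minimal_resolution:
  assumes res: "finite_minimal_resolution R (max_ideal_module R)"
  shows "regular_local_ring R"
proof -
  have "\<exists>n K y. regular_flag R {\<zero>} n K y"
  proof (cases "{\<zero>} = \<mm>")
    case True
    then have "regular_flag R {\<zero>} 0 (\<lambda>_. {\<zero>}) (\<lambda>_. \<zero>)" by (simp add: regular_flag_def)
    then show ?thesis by blast
  next
    case False
    \<comment> \<open>The first regular element is found in \<open>R\<close> itself, through the
      identity map; only afterwards does the ring have the form \<open>R Quot J\<close>.\<close>
    have id: "(\<lambda>a. a) \<in> ring_hom R R" by (rule ring_hom_memI) simp_all
    obtain x where x: "x \<in> carrier R" "x \<notin> {\<zero>}" "\<forall>a \<in> carrier R. x \<otimes> a \<in> {\<zero>} \<longrightarrow> a \<in> {\<zero>}"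
      "adjoin R {\<zero>} x \<subseteq> \<mm>"
      "finite_minimal_resolution (R Quot adjoin R {\<zero>} x) (max_ideal_module (R Quot adjoin R {\<zero>} x))"
    proof (rule regular_step[OF noetherian_local_ring_axioms id _ zeroideal _ res False])
      show "(\<lambda>a. a) ` carrier R = carrier R" by simp
      show "a = \<zero> \<longleftrightarrow> a \<in> {\<zero>}" for a by simp
    qed blast
    obtain n K y where "regular_flag R (adjoin R {\<zero>} x) n K y"
      using regular_flag_of_quotient_resolution[OF adjoin(1)[OF zeroideal x(1)] x(4,5)] by blast
    then show ?thesis using regular_flag_prepend[OF _ x(1,3)] by blast
  qed
  then show ?thesis using regular_of_regular_flag by blast
qed

end

section \<open>Finite projective dimension\<close>

definition transport_module ::
  "('a, 'm) module \<Rightarrow> ('m \<Rightarrow> 'n) \<Rightarrow> ('a, 'n) module" where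
  "transport_module M g = \<lparr>carrier = g ` carrier M, mult = undefined, one = undefined, zero = g \<zero>\<^bsub>M\<^esub>,
     add = (\<lambda>x y. g (the_inv_into (carrier M) g x \<oplus>\<^bsub>M\<^esub> the_inv_into (carrier M) g y)),
     smult = (\<lambda>a x. g (a \<odot>\<^bsub>M\<^esub> the_inv_into (carrier M) g x))\<rparr>"

lemma transport_module:
  fixes M :: "('a, 'm) module"
  assumes M: "module R M" and g: "inj_on g (carrier M)"
  shows "module R (transport_module M g)"
    and "g \<in> mod_homs R M (transport_module M g)"
    and "the_inv_into (carrier M) g \<in> mod_homs R (transport_module M g) M"
    and "carrier (transport_module M g) = g ` carrier M"
    and "\<And>x. x \<in> carrier M \<Longrightarrow> the_inv_into (carrier M) g (g x) = x"
proof -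
  interpret M: module R M by (rule M)
  show inv: "\<And>x. x \<in> carrier M \<Longrightarrow> the_inv_into (carrier M) g (g x) = x"
    by (rule the_inv_into_f_f[OF g])
  show car: "carrier (transport_module M g) = g ` carrier M" by (simp add: transport_module_def)
  let ?T = "transport_module M g"
  have ops: "\<zero>\<^bsub>?T\<^esub> = g \<zero>\<^bsub>M\<^esub>"
    "\<And>x y. x \<in> carrier M \<Longrightarrow> y \<in> carrier M \<Longrightarrow> g x \<oplus>\<^bsub>?T\<^esub> g y = g (x \<oplus>\<^bsub>M\<^esub> y)"
    "\<And>a x. x \<in> carrier M \<Longrightarrow> a \<odot>\<^bsub>?T\<^esub> g x = g (a \<odot>\<^bsub>M\<^esub> x)"
    by (simp_all add: transport_module_def inv)
  show "module R ?T"
  proof (rule moduleI)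
    show "abelian_group ?T"
    proof (rule abelian_groupI)
      fix x assume "x \<in> carrier ?T"
      then obtain u where u: "u \<in> carrier M" "x = g u" using car by blast
      have "g (\<ominus>\<^bsub>M\<^esub> u) \<oplus>\<^bsub>?T\<^esub> x = \<zero>\<^bsub>?T\<^esub>" using u by (simp add: ops M.l_neg)
      then show "\<exists>y\<in>carrier ?T. y \<oplus>\<^bsub>?T\<^esub> x = \<zero>\<^bsub>?T\<^esub>" using u car by (intro bexI[of _ "g (\<ominus>\<^bsub>M\<^esub> u)"]) auto
    qed (auto simp: car ops M.a_ac)
  qed (auto simp: car ops M.cring_axioms M.smult_l_distr M.smult_r_distr M.smult_assoc1)
  show "g \<in> mod_homs R M ?T" by (rule mod_homsI) (simp_all add: car ops)
  show "the_inv_into (carrier M) g \<in> mod_homs R ?T M"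
    by (rule mod_homsI) (auto simp: car ops inv)
qed

text \<open>A function that vanishes outside the finite set \<open>I\<close> is coded by the list of
  its values on \<open>I\<close>, which fits the type of the test modules in
  \<open>projective_module\<close>.\<close>

lemma finite_functions_embed:
  assumes "finite I"
  obtains g :: "('i \<Rightarrow> 'a) \<Rightarrow> ('a + 'p) list" where "inj_on g (carrier (free_module R I))"
proof -
  obtain xs where xs: "set xs = I" using finite_list[OF assms] by blast
  have "inj_on (\<lambda>f. map (\<lambda>i. Inl (f i) :: 'a + 'p) xs) (carrier (free_module R I))"
  proof (rule inj_onI)
    fix f f' assume f: "f \<in> carrier (free_module R I)" "f' \<in> carrier (free_module R I)"
      and "map (\<lambda>i. Inl (f i) :: 'a + 'p) xs = map (\<lambda>i. Inl (f' i)) xs"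
    then have "\<And>i. i \<in> I \<Longrightarrow> f i = f' i" using xs by auto
    then show "f = f'" using f unfolding free_module_carrier fun_eq_iff by metis
  qed
  then show ?thesis by (rule that)
qed

text \<open>\<open>M\<close> may live on any type: a section \<open>s\<close> of \<open>e\<close>,
  followed by \<open>g\<close>, copies it to the type of the test modules. The section is a mere
  function, and the copy receives its structure by transport.\<close>

lemma projective_module_lifts:
  fixes P :: "('a, 'p) module" and M :: "('a, 'm) module" and I :: "'i set"
  assumes P: "projective_module R P" and I: "finite I" and M: "module R M"
    and e: "e \<in> mod_homs R (free_module R I) M" "e ` carrier (free_module R I) = carrier M"
  shows "lifts R P (free_module R I) M e"
  unfolding lifts_def
proof
  interpret M: module R M by (rule M)
  fix k assume k: "k \<in> mod_homs R P M"
  let ?F = "free_module R I"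
  obtain g :: "('i \<Rightarrow> 'a) \<Rightarrow> ('a + 'p) list" where g: "inj_on g (carrier ?F)"
    by (rule finite_functions_embed[OF I])
  define s where "s m = (SOME f. f \<in> carrier ?F \<and> e f = m)" for m
  have s: "s m \<in> carrier ?F" "e (s m) = m" if "m \<in> carrier M" for m
  proof -
    have "m \<in> e ` carrier ?F" using that e(2) by simp
    then have "\<exists>f. f \<in> carrier ?F \<and> e f = m" by blast
    then show "s m \<in> carrier ?F" "e (s m) = m" unfolding s_def by (rule someI2_ex, simp)+
  qed
  have gs: "inj_on (\<lambda>m. g (s m)) (carrier M)"
    by (rule inj_onI) (metis s g inj_onD)
  note F = M.free_module[of I]
  note X = transport_module[OF F g] and Y = transport_module[OF M gs]
  let ?X = "transport_module ?F g" and ?Y = "transport_module M (\<lambda>m. g (s m))"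
  let ?i = "the_inv_into (carrier ?F) g"
  define f where "f x = g (s (e (?i x)))" for x
  have f: "f \<in> mod_homs R ?X ?Y"
    unfolding f_def by (rule mod_homs_comp[OF mod_homs_comp[OF X(3) e(1)] Y(2)])
  have "f ` carrier ?X = carrier ?Y"
    unfolding X(4) Y(4) image_image f_def e(2)[symmetric] using X(5) by (intro image_cong) simp_all
  moreover have "(\<lambda>x. g (s (k x))) \<in> mod_homs R P ?Y" by (rule mod_homs_comp[OF k Y(2)])
  ultimately obtain h where h: "h \<in> mod_homs R P ?X" "\<And>x. x \<in> carrier P \<Longrightarrow> f (h x) = g (s (k x))"
    using P X(1) Y(1) f unfolding projective_module_def by blast
  have "e (?i (h x)) = k x" if x: "x \<in> carrier P" for x
  proof -
    have "?i (h x) \<in> carrier ?F" by (rule mod_homsD(1)[OF X(3) mod_homsD(1)[OF h(1) x]])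
    then have "e (?i (h x)) \<in> carrier M" by (rule mod_homsD(1)[OF e(1)])
    then show ?thesis using h(2)[OF x] inj_onD[OF gs] mod_homsD(1)[OF k x] unfolding f_def by blast
  qed
  then show "\<exists>h\<in>mod_homs R P ?F. \<forall>x\<in>carrier P. e (h x) = k x"
    by (intro bexI[of _ "\<lambda>x. ?i (h x)"] mod_homs_comp[OF h(1) X(3)]) simp
qed

lemma projective_module_free:
  fixes P :: "('a, 'p) module" and I :: "'i set"
  assumes P: "module R P" and I: "finite I"
    and p: "p \<in> mod_homs R P (free_module R I)" and q: "q \<in> mod_homs R (free_module R I) P"
    and qp: "\<And>x. x \<in> carrier P \<Longrightarrow> q (p x) = x"
  shows "projective_module R P"
  unfolding projective_module_def
proof (intro conjI allI impI)
  fix X Y :: "('a, ('a, 'p) ample) module" and f g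
  assume "module R X \<and> module R Y \<and>
        f \<in> mod_homs R X Y \<and> f ` carrier X = carrier Y \<and> g \<in> mod_homs R P Y"
  then have X: "module R X" and Y: "module R Y" and f: "f \<in> mod_homs R X Y" "f ` carrier X = carrier Y"
    and g: "g \<in> mod_homs R P Y" by blast+
  obtain h where h: "h \<in> mod_homs R (free_module R I) X" "\<And>x. x \<in> carrier (free_module R I) \<Longrightarrow> f (h x) = g (q x)"
    using free_module_lift[OF X Y I f mod_homs_comp[OF q g]] by blast
  have "f (h (p x)) = g x" if "x \<in> carrier P" for x
    using h(2)[OF mod_homsD(1)[OF p that]] qp[OF that] by simp
  then show "\<exists>h\<in>mod_homs R P X. \<forall>x\<in>carrier P. f (h x) = g x"
    by (intro bexI[of _ "\<lambda>x. h (p x)"] mod_homs_comp[OF p h(1)]) simp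
qed (rule P)

text \<open>Multiplication by \<open>x\<close> embeds \<open>R\<close> in itself. Extending the map
  from \<open>a\<close> to \<open>a y\<close> along it gives a map whose value at
  \<open>\<one>\<close> is the required \<open>w\<close>.\<close>

lemma injective_module_divisible:
  fixes E :: "('a, 'b) module"
  assumes E: "injective_module R E" and x: "x \<in> carrier R" "\<And>a. a \<in> carrier R \<Longrightarrow> x \<otimes>\<^bsub>R\<^esub> a = \<zero>\<^bsub>R\<^esub> \<Longrightarrow> a = \<zero>\<^bsub>R\<^esub>"
    and y: "y \<in> carrier E"
  obtains w where "w \<in> carrier E" "x \<odot>\<^bsub>E\<^esub> w = y"
proof -
  have EM: "module R E" using E by (simp add: injective_module_def)
  interpret E: module R E by (rule EM)
  let ?M = "regular_module R" and ?g = "\<lambda>a. [Inl a] :: ('a + 'b) list"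
  have g: "inj_on ?g (carrier ?M)" by (rule inj_onI) simp
  note X = transport_module[OF E.regular_module_module g]
  let ?X = "transport_module ?M ?g" and ?i = "the_inv_into (carrier ?M) ?g"
  have mx: "(\<lambda>a. x \<otimes>\<^bsub>R\<^esub> a) \<in> mod_homs R ?M ?M"
    using x(1) by (intro mod_homsI) (simp_all add: E.r_distr E.m_lcomm)
  have my: "(\<lambda>a. a \<odot>\<^bsub>E\<^esub> y) \<in> mod_homs R ?M E"
    using y by (intro mod_homsI) (simp_all add: E.smult_l_distr E.smult_assoc1)
  have f: "(\<lambda>u. ?g (x \<otimes>\<^bsub>R\<^esub> ?i u)) \<in> mod_homs R ?X ?X"
    by (rule mod_homs_comp[OF mod_homs_comp[OF X(3) mx] X(2)])
  have "inj_on (\<lambda>u. ?g (x \<otimes>\<^bsub>R\<^esub> ?i u)) (carrier ?X)"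
  proof (rule inj_onI)
    fix u v assume "u \<in> carrier ?X" "v \<in> carrier ?X" and eq: "?g (x \<otimes>\<^bsub>R\<^esub> ?i u) = ?g (x \<otimes>\<^bsub>R\<^esub> ?i v)"
    then obtain a b where ab: "a \<in> carrier R" "b \<in> carrier R" "u = ?g a" "v = ?g b" unfolding X(4) by auto
    have "x \<otimes>\<^bsub>R\<^esub> a = x \<otimes>\<^bsub>R\<^esub> b" using eq X(5) ab by simp
    then have "x \<otimes>\<^bsub>R\<^esub> (a \<ominus>\<^bsub>R\<^esub> b) = \<zero>\<^bsub>R\<^esub>"
      using x(1) ab by (simp add: a_minus_def E.r_distr E.r_minus E.R.r_neg)
    then have "a \<ominus>\<^bsub>R\<^esub> b = \<zero>\<^bsub>R\<^esub>" using x(2) ab by simp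
    then have "a = b" using ab E.R.add_minus_cancel(2)[of a b] by simp
    then show "u = v" using ab by simp
  qed
  moreover have "(\<lambda>u. ?i u \<odot>\<^bsub>E\<^esub> y) \<in> mod_homs R ?X E" by (rule mod_homs_comp[OF X(3) my])
  ultimately obtain h where h: "h \<in> mod_homs R ?X E"
    "\<And>u. u \<in> carrier ?X \<Longrightarrow> h (?g (x \<otimes>\<^bsub>R\<^esub> ?i u)) = ?i u \<odot>\<^bsub>E\<^esub> y"
    using E X(1) f unfolding injective_module_def by blast
  have one: "?g \<one>\<^bsub>R\<^esub> \<in> carrier ?X" unfolding X(4) by simp
  have "x \<odot>\<^bsub>E\<^esub> h (?g \<one>\<^bsub>R\<^esub>) = h (x \<odot>\<^bsub>?X\<^esub> ?g \<one>\<^bsub>R\<^esub>)" using mod_homsD(3)[OF h(1) x(1) one] by simp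
  also have "x \<odot>\<^bsub>?X\<^esub> ?g \<one>\<^bsub>R\<^esub> = ?g (x \<otimes>\<^bsub>R\<^esub> ?i (?g \<one>\<^bsub>R\<^esub>))"
    using mod_homsD(3)[OF X(2) x(1), of "\<one>\<^bsub>R\<^esub>"] X(5)[of "\<one>\<^bsub>R\<^esub>"] by simp
  also have "h \<dots> = y" unfolding h(2)[OF one] using X(5)[of "\<one>\<^bsub>R\<^esub>"] y by simp
  finally show ?thesis using that mod_homsD(1)[OF h(1) one] by blast
qed

text \<open>The augmentation is kept apart because \<open>S\<close> and the terms of its resolution
  live on different types; the recursion of \<open>finite_lifting_resolution\<close> starts at the
  first syzygy.\<close>

lemma finite_proj_dim_resolution:
  fixes S :: "('a, 'b) module"
  assumes "proj_dim R S < \<infinity>"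
  obtains P :: "('a, ('a, 'b) ample) module" and q where "projective_module R P" "q \<in> mod_homs R P S"
    "q ` carrier P = carrier S" "finite_lifting_resolution R (kernel_module P S q)"
proof -
  have "{enat n | n. \<exists>q (P :: nat \<Rightarrow> ('a, ('a, 'b) ample) module) \<delta>.
     projective_resolution R S q P \<delta> \<and> (\<forall>i>n. carrier (P i) = {\<zero>\<^bsub>P i\<^esub>})} \<noteq> {}" (is "?N \<noteq> {}")
  proof
    assume empty: "?N = {}"
    have "proj_dim R S = Inf ?N" by (rule proj_dim_def)
    then have "proj_dim R S = Inf {}" unfolding empty .
    then show False using assms by (simp add: Inf_enat_def)
  qed
  then obtain n q \<delta> and P :: "nat \<Rightarrow> ('a, ('a, 'b) ample) module" where
    res: "projective_resolution R S q P \<delta>" and zero: "\<And>i. i > n \<Longrightarrow> carrier (P i) = {\<zero>\<^bsub>P i\<^esub>}" by blast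
  note res' = res[unfolded projective_resolution_def]
  have S: "module R S" and q: "q \<in> mod_homs R (P 0) S" and qs: "q ` carrier (P 0) = carrier S"
    and ex0: "a_kernel (P 0) S q = \<delta> 0 ` carrier (P 1)"
    by (insert res', (elim conjE, assumption)+)
  have proj: "projective_module R (P i)" and \<delta>: "\<delta> i \<in> mod_homs R (P (Suc i)) (P i)"
    and ex: "a_kernel (P (Suc i)) (P i) (\<delta> i) = \<delta> (Suc i) ` carrier (P (Suc (Suc i)))" for i
    by (insert res', (elim conjE, erule spec)+)
  have P: "module R (P i)" for i using proj[of i] by (simp add: projective_module_def)
  have lift: "lifts_covers R (P i)" for i
    unfolding lifts_covers_def using projective_module_lifts[OF proj] by blast
  define K where "K i = (P i)\<lparr>carrier := \<delta> i ` carrier (P (Suc i))\<rparr>" for i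
  have K0: "kernel_module (P 0) S q = K 0" unfolding K_def by (simp add: ex0)
  have KS: "kernel_module (P (Suc i)) (K i) (\<delta> i) = K (Suc i)" for i
  proof -
    have "a_kernel (P (Suc i)) (K i) (\<delta> i) = a_kernel (P (Suc i)) (P i) (\<delta> i)"
      by (simp add: a_kernel_def' K_def)
    then show ?thesis unfolding K_def ex by simp
  qed
  have Kmod: "module R (K i)" for i
  proof -
    interpret P': module R "P (Suc i)" by (rule P)
    show ?thesis unfolding K_def
      by (rule submodule_module[OF P image_submodule[OF P P \<delta> P'.carrier_is_submodule]])
  qed
  have fin: "finite_lifting_resolution R (K i)" if "i \<le> n" for i
    using that
  proof (induction i rule: inc_induct)
    \<comment> \<open>The term after index \<open>n\<close> vanishes, and with it its image, the
      syzygy \<open>K n\<close>.\<close>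
    case base
    have "carrier (K n) = {\<zero>\<^bsub>K n\<^esub>}"
      using zero[of "Suc n"] mod_homs_zero[OF P P \<delta>, of n] by (simp add: K_def)
    then show ?case by (rule finite_lifting_resolution.zero[OF Kmod])
  next
    case (step i)
    show ?case
    proof (rule finite_lifting_resolution.step[OF Kmod P lift])
      show "\<delta> i \<in> mod_homs R (P (Suc i)) (K i)"
        using mod_homsD[OF \<delta>[of i]] by (intro mod_homsI) (simp_all add: K_def)
      show "\<delta> i ` carrier (P (Suc i)) = carrier (K i)" by (simp add: K_def)
      show "finite_lifting_resolution R (kernel_module (P (Suc i)) (K i) (\<delta> i))" unfolding KS by (rule step)
    qed
  qed
  show ?thesis by (rule that[OF proj q qs]) (unfold K0, rule fin, simp)
qed

text \<open>\<open>S\<close> is a stable retract of itself with zero correction. One syzygy step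
  moves the comparison to modules on the types that the two resolution predicates accept.\<close>

lemma (in noetherian_local_ring) finite_minimal_resolution_of_proj_dim:
  fixes S :: "('a, 's) module"
  assumes fin: "proj_dim R S < \<infinity>" and S: "module R S" and e: "minimal_cover R S I e"
  shows "finite_minimal_resolution R (kernel_module (free_module R I) S e)"
proof -
  interpret S: module R S by (rule S)
  have I: "finite I" and eh: "e \<in> mod_homs R (free_module R I) S" "e ` carrier (free_module R I) = carrier S"
    using e by (auto simp: minimal_cover_def)
  obtain P :: "('a, ('a, 's) ample) module" and q where P: "projective_module R P" and q: "q \<in> mod_homs R P S"
    "q ` carrier P = carrier S" and res: "finite_lifting_resolution R (kernel_module P S q)"
    by (rule finite_proj_dim_resolution[OF fin])
  have PM: "module R P" using P by (simp add: projective_module_def)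
  obtain J e' where e': "minimal_cover R (kernel_module (free_module R I) S e) J e'"
    by (rule kernel_minimal_cover_exists[OF S e])
  have "stable_retract R S S (free_module R I) e"
    unfolding stable_retract_def
  proof (intro bexI ballI)
    show "(\<lambda>x. x) \<in> mod_homs R S S" "(\<lambda>x. x) \<in> mod_homs R S S" by (rule mod_homsI; simp)+
    interpret F: module R "free_module R I" by (rule free_module)
    show "(\<lambda>_. \<zero>\<^bsub>free_module R I\<^esub>) \<in> mod_homs R S (free_module R I)"
      by (rule mod_homsI) (simp_all add: free_module_carrier)
    fix m assume "m \<in> carrier S"
    then show "m = m \<oplus>\<^bsub>S\<^esub> e \<zero>\<^bsub>free_module R I\<^esub>" unfolding mod_homs_zero[OF free_module S eh(1)] by simp
  qed
  then have "stable_retract R (kernel_module (free_module R I) S e) (kernel_module P S q) (free_module R J) e'"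
    by (rule stable_retract_syzygy_minimal[OF S e S PM q projective_module_lifts[OF P I S eh] e'])
  then show ?thesis
    by (rule finite_minimal_resolution_of_stable_retract[OF res
      submodule_module[OF free_module kernel_submodule[OF free_module S eh(1)]] e'])
qed

section \<open>Summands of cosyzygies\<close>

lemma direct_summand_projection:
  assumes M: "module R M" and N: "direct_summand R N M"
  obtains p where "p \<in> mod_homs R M (M\<lparr>carrier := N\<rparr>)" "\<And>a. a \<in> N \<Longrightarrow> p a = a"
proof -
  interpret M: module R M by (rule M)
  obtain L where L: "submodule L R M" and NL: "N \<inter> L = {\<zero>\<^bsub>M\<^esub>}" and sum: "N <+>\<^bsub>M\<^esub> L = carrier M"
    and Ns: "submodule N R M" using N unfolding direct_summand_def by blast
  note N' = M.submoduleE'[OF Ns] and L' = M.submoduleE'[OF L]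
  have NM: "a \<in> N \<Longrightarrow> a \<in> carrier M" and LM: "a \<in> L \<Longrightarrow> a \<in> carrier M" for a
    using N'(1) L'(1) by blast+
  have uniq: "a = a'" if "a \<in> N" "a' \<in> N" "b \<in> L" "b' \<in> L" and eq: "a \<oplus>\<^bsub>M\<^esub> b = a' \<oplus>\<^bsub>M\<^esub> b'" for a a' b b'
  proof -
    have c: "a \<in> carrier M" "a' \<in> carrier M" "b \<in> carrier M" "b' \<in> carrier M" using that NM LM by blast+
    have "a \<ominus>\<^bsub>M\<^esub> a' = (a \<oplus>\<^bsub>M\<^esub> b) \<ominus>\<^bsub>M\<^esub> b \<ominus>\<^bsub>M\<^esub> a'" using c by (simp add: M.add_minus_cancel)
    also have "\<dots> = (a' \<oplus>\<^bsub>M\<^esub> b') \<ominus>\<^bsub>M\<^esub> b \<ominus>\<^bsub>M\<^esub> a'" unfolding eq ..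
    also have "\<dots> = ((b' \<ominus>\<^bsub>M\<^esub> b) \<oplus>\<^bsub>M\<^esub> a') \<ominus>\<^bsub>M\<^esub> a'" using c by (simp add: a_minus_def M.M.a_ac)
    also have "\<dots> = b' \<ominus>\<^bsub>M\<^esub> b" using c by (simp add: M.add_minus_cancel)
    finally have "a \<ominus>\<^bsub>M\<^esub> a' \<in> N \<inter> L" using N'(6)[OF that(1,2)] L'(6)[OF that(4,3)] by simp
    then have "a \<ominus>\<^bsub>M\<^esub> a' = \<zero>\<^bsub>M\<^esub>" using NL by blast
    then show ?thesis using c M.add_minus_cancel(2)[of a a'] by simp
  qed
  define p where "p m = (SOME a. a \<in> N \<and> (\<exists>b \<in> L. m = a \<oplus>\<^bsub>M\<^esub> b))" for m
  have p: "p (a \<oplus>\<^bsub>M\<^esub> b) = a" if "a \<in> N" "b \<in> L" for a b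
    unfolding p_def by (rule some_equality) (use that uniq in blast)+
  have cases: "\<exists>a \<in> N. \<exists>b \<in> L. m = a \<oplus>\<^bsub>M\<^esub> b" if "m \<in> carrier M" for m
    using that unfolding sum[symmetric] set_add_def' by blast
  have "p \<in> mod_homs R M (M\<lparr>carrier := N\<rparr>)"
  proof (rule mod_homsI)
    fix x assume x: "x \<in> carrier M"
    obtain a b where ab: "a \<in> N" "b \<in> L" "x = a \<oplus>\<^bsub>M\<^esub> b" using cases[OF x] by blast
    show "p x \<in> carrier (M\<lparr>carrier := N\<rparr>)" unfolding ab(3) p[OF ab(1,2)] using ab(1) by simp
    show "p (x \<oplus>\<^bsub>M\<^esub> y) = p x \<oplus>\<^bsub>M\<lparr>carrier := N\<rparr>\<^esub> p y" if y: "y \<in> carrier M" for y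
    proof -
      obtain c d where cd: "c \<in> N" "d \<in> L" "y = c \<oplus>\<^bsub>M\<^esub> d" using cases[OF y] by blast
      have "x \<oplus>\<^bsub>M\<^esub> y = (a \<oplus>\<^bsub>M\<^esub> c) \<oplus>\<^bsub>M\<^esub> (b \<oplus>\<^bsub>M\<^esub> d)"
        unfolding ab(3) cd(3) using ab(1,2) cd(1,2) NM LM by (simp add: M.M.a_ac)
      then show ?thesis
        using p[OF N'(4)[OF ab(1) cd(1)] L'(4)[OF ab(2) cd(2)]] p[OF ab(1,2)] p[OF cd(1,2)] ab(3) cd(3) by simp
    qed
    show "p (r \<odot>\<^bsub>M\<^esub> x) = r \<odot>\<^bsub>M\<lparr>carrier := N\<rparr>\<^esub> p x" if r: "r \<in> carrier R" for r
    proof -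
      have "r \<odot>\<^bsub>M\<^esub> x = r \<odot>\<^bsub>M\<^esub> a \<oplus>\<^bsub>M\<^esub> r \<odot>\<^bsub>M\<^esub> b"
        unfolding ab(3) using r ab NM LM by (simp add: M.smult_r_distr)
      then show ?thesis using p[OF N'(3)[OF r ab(1)] L'(3)[OF r ab(2)]] p[OF ab(1,2)] ab(3) by simp
    qed
  qed
  moreover have "p a = a" if "a \<in> N" for a using p[OF that L'(2)] NM[OF that] by simp
  ultimately show ?thesis by (rule that)
qed

context noetherian_local_ring
begin

lemma residue_module:
  shows "X \<in> carrier (residue_module R) \<longleftrightarrow> (\<exists>a \<in> carrier R. X = \<mm> +> a)"
    and "a \<in> carrier R \<Longrightarrow> \<mm> +> a = \<zero>\<^bsub>residue_module R\<^esub> \<longleftrightarrow> a \<in> \<mm>"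
    and "a \<in> carrier R \<Longrightarrow> b \<in> carrier R \<Longrightarrow> a \<odot>\<^bsub>residue_module R\<^esub> (\<mm> +> b) = \<mm> +> (a \<otimes> b)"
    and "a \<in> carrier R \<Longrightarrow> b \<in> carrier R \<Longrightarrow> (\<mm> +> a) \<oplus>\<^bsub>residue_module R\<^esub> (\<mm> +> b) = \<mm> +> (a \<oplus> b)"
proof -
  note Q = quotient_local[OF mm.is_ideal subset_refl]
  have ops: "carrier (residue_module R) = carrier (R Quot \<mm>)" "\<zero>\<^bsub>residue_module R\<^esub> = \<zero>\<^bsub>R Quot \<mm>\<^esub>"
    "\<And>a X. a \<odot>\<^bsub>residue_module R\<^esub> X = (\<mm> +> a) \<otimes>\<^bsub>R Quot \<mm>\<^esub> X"
    "\<And>X Y. X \<oplus>\<^bsub>residue_module R\<^esub> Y = X \<oplus>\<^bsub>R Quot \<mm>\<^esub> Y"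
    by (simp_all add: residue_module_def Let_def ring.defs module.defs)
  show "X \<in> carrier (residue_module R) \<longleftrightarrow> (\<exists>a \<in> carrier R. X = \<mm> +> a)"
    unfolding ops Q(4)[symmetric] by blast
  show "a \<in> carrier R \<Longrightarrow> \<mm> +> a = \<zero>\<^bsub>residue_module R\<^esub> \<longleftrightarrow> a \<in> \<mm>" unfolding ops by (rule Q(5))
  show "a \<in> carrier R \<Longrightarrow> b \<in> carrier R \<Longrightarrow> a \<odot>\<^bsub>residue_module R\<^esub> (\<mm> +> b) = \<mm> +> (a \<otimes> b)"
    unfolding ops by (rule ring_hom_mult[OF Q(3), symmetric])
  show "a \<in> carrier R \<Longrightarrow> b \<in> carrier R \<Longrightarrow> (\<mm> +> a) \<oplus>\<^bsub>residue_module R\<^esub> (\<mm> +> b) = \<mm> +> (a \<oplus> b)"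
    unfolding ops by (rule ring_hom_add[OF Q(3), symmetric])
qed

lemma zero_if_divisible:
  fixes S :: "('a, 's) module"
  assumes S: "module R S" "finitely_generated R S" and y: "y \<in> \<mm>"
    and div: "\<And>s. s \<in> carrier S \<Longrightarrow> \<exists>t \<in> carrier S. s = y \<odot>\<^bsub>S\<^esub> t"
  shows "carrier S = {\<zero>\<^bsub>S\<^esub>}"
proof -
  interpret S: module R S by (rule S)
  obtain T where T: "T \<subseteq> carrier S" "finite T" "\<And>H. submodule H R S \<Longrightarrow> T \<subseteq> H \<Longrightarrow> carrier S \<subseteq> H"
    using S(2) unfolding finitely_generated_def by blast
  have yR: "y \<in> carrier R" using y mm.Icarr by simp
  have Z: "submodule {\<zero>\<^bsub>S\<^esub>} R S" by (rule S.submoduleI') auto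
  have "T \<subseteq> {\<zero>\<^bsub>S\<^esub>}"
  proof (rule S.nakayama[OF max_ideal_prime T(2,1) Z saturated_max[OF S(1) Z]])
    fix t L assume t: "t \<in> T" and L: "submodule L R S"
      and TL: "\<And>a u. a \<in> \<mm> \<Longrightarrow> u \<in> T \<Longrightarrow> a \<odot>\<^bsub>S\<^esub> u \<in> L"
    note L' = S.submoduleE'[OF L]
    let ?H = "{u \<in> carrier S. y \<odot>\<^bsub>S\<^esub> u \<in> L}"
    have H: "submodule ?H R S"
    proof (rule S.submoduleI')
      show "\<zero>\<^bsub>S\<^esub> \<in> ?H" using L'(2) yR by simp
      show "u \<oplus>\<^bsub>S\<^esub> v \<in> ?H" if "u \<in> ?H" "v \<in> ?H" for u v
        using that L'(4) yR by (simp add: S.smult_r_distr)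
      show "a \<odot>\<^bsub>S\<^esub> u \<in> ?H" if a: "a \<in> carrier R" and u: "u \<in> ?H" for a u
      proof -
        have "y \<odot>\<^bsub>S\<^esub> (a \<odot>\<^bsub>S\<^esub> u) = a \<odot>\<^bsub>S\<^esub> (y \<odot>\<^bsub>S\<^esub> u)"
          using a u yR by (simp add: S.smult_assoc1[symmetric] m_comm)
        then show ?thesis using a u L'(3) by simp
      qed
    qed auto
    have "carrier S \<subseteq> ?H" by (rule T(3)[OF H]) (use TL[OF y] T(1) in blast)
    moreover obtain v where "v \<in> carrier S" "t = y \<odot>\<^bsub>S\<^esub> v" using div t T(1) by blast
    ultimately show "t \<in> L" by blast
  qed
  then show ?thesis using T(3)[OF Z] by blast
qed

text \<open>A cosyzygy of positive index is a quotient of an injective module \<open>E\<close> by an essential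
  submodule \<open>C\<close>. If \<open>R\<close> has a regular element in \<open>\<mm>\<close>, the summand \<open>S\<close> is divisible by it.
  Otherwise \<open>S\<close> is free, so that it lifts to a submodule of \<open>E\<close> that meets \<open>C\<close> trivially.\<close>

lemma no_summand_of_positive_cosyzygy:
  fixes S :: "('a, 's) module" and E :: "('a, 'e) module"
  assumes S: "module R S" "finitely_generated R S" "proj_dim R S < \<infinity>"
    and E: "injective_module R E" and q: "q \<in> mod_homs R E S" "q ` carrier E = carrier S"
    and C: "essential_submodule R C E" and Cq: "\<And>c. c \<in> C \<Longrightarrow> q c = \<zero>\<^bsub>S\<^esub>"
  shows "carrier S = {\<zero>\<^bsub>S\<^esub>}"
proof (rule socle_or_regular_element)
  interpret S: module R S by (rule S)
  have EM: "module R E" using E by (simp add: injective_module_def)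
  fix y assume y: "y \<in> \<mm>" "\<And>w. w \<in> carrier R \<Longrightarrow> y \<otimes> w = \<zero> \<Longrightarrow> w = \<zero>"
  have yR: "y \<in> carrier R" using y mm.Icarr by simp
  show ?thesis
  proof (rule zero_if_divisible[OF S(1,2) y(1)])
    fix s assume "s \<in> carrier S"
    then have "s \<in> q ` carrier E" using q(2) by simp
    then obtain v where v: "v \<in> carrier E" "s = q v" by blast
    obtain w where w: "w \<in> carrier E" "y \<odot>\<^bsub>E\<^esub> w = v" by (rule injective_module_divisible[OF E yR y(2) v(1)])
    have "s = y \<odot>\<^bsub>S\<^esub> q w" unfolding v(2) w(2)[symmetric] by (rule mod_homsD(3)[OF q(1) yR w(1)])
    then show "\<exists>t\<in>carrier S. s = y \<odot>\<^bsub>S\<^esub> t" using mod_homsD(1)[OF q(1) w(1)] by blast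
  qed
next
  interpret S: module R S by (rule S)
  have EM: "module R E" using E by (simp add: injective_module_def)
  fix z assume z: "z \<in> carrier R" "z \<noteq> \<zero>" "\<And>a. a \<in> \<mm> \<Longrightarrow> z \<otimes> a = \<zero>"
  obtain I c where c: "minimal_cover R S I c" by (rule minimal_cover_exists[OF S(1,2)])
  have I: "finite I" and ch: "c \<in> mod_homs R (free_module R I) S" "c ` carrier (free_module R I) = carrier S"
    using c by (auto simp: minimal_cover_def)
  interpret F: module R "free_module R I" by (rule free_module)
  interpret E: module R E by (rule EM)
  have ker: "a_kernel (free_module R I) S c = {\<zero>\<^bsub>free_module R I\<^esub>}"
  proof (rule zero_if_socle[OF z(1,2)])
    show "submodule (a_kernel (free_module R I) S c) R (free_module R I)"
      by (rule kernel_submodule[OF free_module S(1) ch(1)])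
    show "f i \<in> \<mm>" if "f \<in> a_kernel (free_module R I) S c" for f i
      using c that by (simp add: minimal_cover_def)
    show "finite_minimal_resolution R (kernel_module (free_module R I) S c)"
      by (rule finite_minimal_resolution_of_proj_dim[OF S(3,1) c])
  qed (rule z(3))
  \<comment> \<open>\<open>c\<close> is an isomorphism, so its lift \<open>s\<close> embeds a copy
    of \<open>S\<close> in \<open>E\<close> on which \<open>q\<close> is injective. As
    \<open>q\<close> kills \<open>C\<close>, the two meet only in zero.\<close>
  obtain s where s: "s \<in> mod_homs R (free_module R I) E" "\<And>f. f \<in> carrier (free_module R I) \<Longrightarrow> q (s f) = c f"
    using free_module_lift[OF EM S(1) I q ch(1)] by blast
  let ?T = "s ` carrier (free_module R I)"
  have T: "submodule ?T R E" by (rule image_submodule[OF free_module EM s(1) F.carrier_is_submodule])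
  note C' = C[unfolded essential_submodule_def]
  have Csub: "submodule C R E" using C' by blast
  have "C \<inter> ?T = {\<zero>\<^bsub>E\<^esub>}"
  proof
    show "{\<zero>\<^bsub>E\<^esub>} \<subseteq> C \<inter> ?T" using E.submoduleE'(2)[OF T] E.submoduleE'(2)[OF Csub] by blast
    show "C \<inter> ?T \<subseteq> {\<zero>\<^bsub>E\<^esub>}"
    proof
      fix v assume v: "v \<in> C \<inter> ?T"
      then obtain f where f: "f \<in> carrier (free_module R I)" "v = s f" by blast
      have "c f = \<zero>\<^bsub>S\<^esub>" using s(2)[OF f(1)] Cq[of v] v f(2) by simp
      then have "f \<in> a_kernel (free_module R I) S c" unfolding a_kernel_iff using f(1) by blast
      then have "f = \<zero>\<^bsub>free_module R I\<^esub>" unfolding ker by (rule singletonD)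
      then show "v \<in> {\<zero>\<^bsub>E\<^esub>}" using f(2) mod_homs_zero[OF free_module EM s(1)] by blast
    qed
  qed
  then have T0: "?T = {\<zero>\<^bsub>E\<^esub>}" using C' T by blast
  have "x = \<zero>\<^bsub>S\<^esub>" if "x \<in> carrier S" for x
  proof -
    have "x \<in> c ` carrier (free_module R I)" using that ch(2) by simp
    then obtain f where f: "f \<in> carrier (free_module R I)" "x = c f" by blast
    then have "s f = \<zero>\<^bsub>E\<^esub>" using T0 by blast
    then show ?thesis using s(2)[OF f(1)] f(2) mod_homs_zero[OF EM S(1) q(1)] by simp
  qed
  then show ?thesis using S.M.zero_closed by blast
qed

text \<open>\<open>S\<close> is the residue field on an arbitrary type. Sending 1 to
  \<open>s\<close> gives a minimal cover of rank one whose kernel is exactly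
  \<open>max_ideal_module R\<close>.\<close>

lemma regular_of_residue_proj_dim:
  fixes S :: "('a, 's) module"
  assumes S: "module R S" "proj_dim R S < \<infinity>" and s: "s \<in> carrier S"
    and gen: "\<And>x. x \<in> carrier S \<Longrightarrow> \<exists>a \<in> carrier R. x = a \<odot>\<^bsub>S\<^esub> s"
    and ann: "\<And>a. a \<in> carrier R \<Longrightarrow> a \<odot>\<^bsub>S\<^esub> s = \<zero>\<^bsub>S\<^esub> \<longleftrightarrow> a \<in> \<mm>"
  shows "regular_local_ring R"
proof -
  interpret S: module R S by (rule S)
  let ?F = "free_module R {0 :: nat}"
  define c where "c f = f 0 \<odot>\<^bsub>S\<^esub> s" for f :: "nat \<Rightarrow> 'a"
  have c: "c \<in> mod_homs R ?F S"
    using s by (intro mod_homsI) (simp_all add: c_def free_module_carrier S.smult_l_distr S.smult_assoc1)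
  have ker: "a_kernel ?F S c = {f \<in> carrier ?F. f 0 \<in> \<mm>}"
    unfolding a_kernel_def' c_def using ann by (auto simp: free_module_carrier)
  have "carrier S \<subseteq> c ` carrier ?F"
  proof
    fix x assume "x \<in> carrier S"
    then obtain a where a: "a \<in> carrier R" "x = a \<odot>\<^bsub>S\<^esub> s" using gen by blast
    define f where "f = (\<lambda>i :: nat. if i = 0 then a else \<zero>)"
    have "f \<in> carrier ?F" "x = c f" using a by (simp_all add: f_def c_def free_module_carrier)
    then show "x \<in> c ` carrier ?F" by blast
  qed
  then have "c ` carrier ?F = carrier S" using mod_homsD(1)[OF c] by blast
  moreover have "f i \<in> \<mm>" if "f \<in> a_kernel ?F S c" for f i
    using that mm.ideal_closed(1) unfolding ker by (cases "i = 0") (auto simp: free_module_carrier)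
  ultimately have "minimal_cover R S {0} c" unfolding minimal_cover_def using c by blast
  then have "finite_minimal_resolution R (kernel_module ?F S c)"
    by (rule finite_minimal_resolution_of_proj_dim[OF S(2,1)])
  then show ?thesis
    unfolding ker max_ideal_module_def[symmetric] by (rule regular_of_finite_minimal_resolution)
qed

theorem regular_of_cosyzygy_summand:
  fixes e :: "'a set \<Rightarrow> 'e" and I :: "nat \<Rightarrow> ('a, 'e) module"
  assumes res: "minimal_injective_resolution R (residue_module R) e I d"
    and \<Omega>: "\<Omega> = cosyzygy (residue_module R) e I d n" and S: "S = \<Omega>\<lparr>carrier := N\<rparr>"
    and N: "direct_summand R N \<Omega>" "N \<noteq> {\<zero>\<^bsub>\<Omega>\<^esub>}" and fin: "fin_gen_module R S" "proj_dim R S < \<infinity>"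
  shows "regular_local_ring R"
proof -
  let ?k = "residue_module R"
  note res' = res[unfolded minimal_injective_resolution_def]
  have k: "module R ?k" and e: "e \<in> mod_homs R ?k (I 0)" and inj: "inj_on e (carrier ?k)"
    by (insert res', (elim conjE, assumption)+)
  have I: "injective_module R (I i)" and d: "d i \<in> mod_homs R (I i) (I (Suc i))"
    and ker: "a_kernel (I i) (I (Suc i)) (d i) = carrier (cosyzygy ?k e I d i)"
    and ess: "essential_submodule R (carrier (cosyzygy ?k e I d i)) (I i)" for i
    by (insert res', (elim conjE, erule spec)+)
  have IM: "module R (I i)" for i using I[of i] by (simp add: injective_module_def)
  have \<Omega>_eq: "\<Omega> = (I n)\<lparr>carrier := carrier \<Omega>\<rparr>" unfolding \<Omega> by (simp add: cosyzygy_def)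
  have "submodule (carrier \<Omega>) R (I n)" unfolding \<Omega> using ess[of n] unfolding essential_submodule_def by blast
  from submodule_module[OF IM this] have \<Omega>M: "module R \<Omega>" unfolding \<Omega>_eq[symmetric] .
  interpret \<Omega>: module R \<Omega> by (rule \<Omega>M)
  have Ns: "submodule N R \<Omega>" using N(1) by (simp add: direct_summand_def)
  note N' = \<Omega>.submoduleE'[OF Ns]
  have SM: "module R S" unfolding S by (rule submodule_module[OF \<Omega>M Ns])
  have carS: "carrier S = N" and zeroS: "\<zero>\<^bsub>S\<^esub> = \<zero>\<^bsub>\<Omega>\<^esub>" and smultS: "smult S = smult \<Omega>" by (simp_all add: S)
  have zero\<Omega>: "\<zero>\<^bsub>\<Omega>\<^esub> = \<zero>\<^bsub>I n\<^esub>" and smult\<Omega>: "smult \<Omega> = smult (I n)" by (subst \<Omega>_eq, simp)+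
  show ?thesis
  proof (cases n)
    case 0
    have car: "carrier \<Omega> = e ` carrier ?k" unfolding \<Omega> 0 by (simp add: cosyzygy_def)
    have e0: "e \<zero>\<^bsub>?k\<^esub> = \<zero>\<^bsub>\<Omega>\<^esub>" unfolding zero\<Omega> 0 by (rule mod_homs_zero[OF k IM e])
    have kc: "\<mm> +> a \<in> carrier ?k" if "a \<in> carrier R" for a using residue_module(1)[of "\<mm> +> a"] that by blast
    have smult_e: "a \<odot>\<^bsub>\<Omega>\<^esub> e (\<mm> +> b) = e (\<mm> +> (a \<otimes> b))" if "a \<in> carrier R" "b \<in> carrier R" for a b
      unfolding smult\<Omega> 0 residue_module(3)[OF that, symmetric] by (rule mod_homsD(3)[OF e that(1) kc[OF that(2)], symmetric])
    have elt: "\<exists>b \<in> carrier R. y = e (\<mm> +> b)" if "y \<in> N" for y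
    proof -
      have "y \<in> e ` carrier ?k" using that N'(1) car by blast
      then obtain X where X: "X \<in> carrier ?k" "y = e X" by blast
      obtain b where "b \<in> carrier R" "X = \<mm> +> b" using X(1) residue_module(1)[of X] by blast
      then show ?thesis using X(2) by blast
    qed
    \<comment> \<open>\<open>\<Omega>\<close> is a copy of the residue field, so any non-zero
      element of \<open>N\<close> has the generator \<open>?s\<close> as a multiple by a unit, and
      \<open>N\<close> is everything.\<close>
    let ?s = "e (\<mm> +> \<one>)"
    obtain y where y: "y \<in> N" "y \<noteq> \<zero>\<^bsub>\<Omega>\<^esub>" using N(2) N'(2) by blast
    obtain b where b: "b \<in> carrier R" "y = e (\<mm> +> b)" using elt[OF y(1)] by blast
    have "b \<notin> \<mm>"
    proof
      assume "b \<in> \<mm>"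
      then have "y = e \<zero>\<^bsub>?k\<^esub>" using b residue_module(2)[OF b(1)] by simp
      then show False using e0 y(2) by simp
    qed
    then obtain u where u: "u \<in> carrier R" "u \<otimes> b = \<one>" using unit_if_not_in_max[of b] b(1) by blast
    have "u \<odot>\<^bsub>\<Omega>\<^esub> y = ?s" unfolding b(2) smult_e[OF u(1) b(1)] u(2) ..
    then have s: "?s \<in> N" using N'(3)[OF u(1) y(1)] by simp
    show ?thesis
    proof (rule regular_of_residue_proj_dim[OF SM fin(2), of ?s])
      show "?s \<in> carrier S" unfolding carS by (rule s)
      show "\<exists>a \<in> carrier R. x = a \<odot>\<^bsub>S\<^esub> ?s" if x: "x \<in> carrier S" for x
      proof -
        obtain a where a: "a \<in> carrier R" "x = e (\<mm> +> a)" using elt x carS by blast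
        have "a \<odot>\<^bsub>S\<^esub> ?s = x" unfolding smultS smult_e[OF a(1) one_closed] a(2) using a(1) by simp
        then show ?thesis using a(1) by blast
      qed
      show "a \<odot>\<^bsub>S\<^esub> ?s = \<zero>\<^bsub>S\<^esub> \<longleftrightarrow> a \<in> \<mm>" if a: "a \<in> carrier R" for a
      proof -
        have "a \<odot>\<^bsub>S\<^esub> ?s = e (\<mm> +> a)" unfolding smultS smult_e[OF a one_closed] using a by simp
        moreover have "e (\<mm> +> a) = e \<zero>\<^bsub>?k\<^esub> \<longleftrightarrow> \<mm> +> a = \<zero>\<^bsub>?k\<^esub>"
        proof (rule inj_on_eq_iff[OF inj kc[OF a]])
          show "\<zero>\<^bsub>?k\<^esub> \<in> carrier ?k"
            using kc[OF zero_closed] residue_module(2)[OF zero_closed] mm.ideal_closed(1) by simp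
        qed
        ultimately show ?thesis unfolding zeroS e0[symmetric] residue_module(2)[OF a, symmetric] by simp
      qed
    qed
  next
    case (Suc i)
    have car: "carrier \<Omega> = d i ` carrier (I i)" unfolding \<Omega> Suc by (simp add: cosyzygy_def)
    obtain p where p: "p \<in> mod_homs R \<Omega> S" "\<And>a. a \<in> N \<Longrightarrow> p a = a"
      unfolding S by (rule direct_summand_projection[OF \<Omega>M N(1)]) blast
    have d': "d i \<in> mod_homs R (I i) \<Omega>"
    proof (rule mod_homsI)
      show "d i x \<in> carrier \<Omega>" if "x \<in> carrier (I i)" for x unfolding car using that by blast
      show "d i (x \<oplus>\<^bsub>I i\<^esub> y) = d i x \<oplus>\<^bsub>\<Omega>\<^esub> d i y" if "x \<in> carrier (I i)" "y \<in> carrier (I i)" for x y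
        using mod_homsD(2)[OF d that] by (subst \<Omega>_eq) (simp add: Suc)
      show "d i (a \<odot>\<^bsub>I i\<^esub> x) = a \<odot>\<^bsub>\<Omega>\<^esub> d i x" if "a \<in> carrier R" "x \<in> carrier (I i)" for a x
        unfolding smult\<Omega> Suc by (rule mod_homsD(3)[OF d that])
    qed
    \<comment> \<open>\<open>S\<close> is the image of \<open>I i\<close> under \<open>d i\<close>
      followed by the projection, and this map kills the preceding cosyzygy, which is essential in
      \<open>I i\<close> by minimality.\<close>
    have "carrier S = {\<zero>\<^bsub>S\<^esub>}"
    proof (rule no_summand_of_positive_cosyzygy[OF SM fin_gen_module_finitely_generated[OF fin(1)] fin(2) I
          mod_homs_comp[OF d' p(1)] _ ess])
      show "(\<lambda>x. p (d i x)) ` carrier (I i) = carrier S"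
      proof
        show "(\<lambda>x. p (d i x)) ` carrier (I i) \<subseteq> carrier S"
          using mod_homsD(1)[OF mod_homs_comp[OF d' p(1)]] by blast
        show "carrier S \<subseteq> (\<lambda>x. p (d i x)) ` carrier (I i)"
        proof
          fix x assume "x \<in> carrier S"
          then have x: "x \<in> N" "x \<in> d i ` carrier (I i)" using carS N'(1) car by blast+
          then obtain w where "w \<in> carrier (I i)" "x = d i w" by blast
          moreover have "x = p x" using p(2)[OF x(1)] by simp
          ultimately show "x \<in> (\<lambda>x. p (d i x)) ` carrier (I i)" by (metis imageI)
        qed
      qed
      fix c assume "c \<in> carrier (cosyzygy ?k e I d i)"
      then have "c \<in> a_kernel (I i) (I (Suc i)) (d i)" unfolding ker .
      then have "d i c = \<zero>\<^bsub>\<Omega>\<^esub>" unfolding a_kernel_iff zero\<Omega> Suc by blast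
      then show "p (d i c) = \<zero>\<^bsub>S\<^esub>" using mod_homs_zero[OF \<Omega>M SM p(1)] by simp
    qed
    then show ?thesis using N(2) carS zeroS by simp
  qed
qed

end

section \<open>The Koszul resolution\<close>

text \<open>A free resolution of \<open>R/J\<close> of length at most \<open>n\<close> with rank one
  in degree zero. Exactness at the augmentation is expressed by membership of the coordinate
  \<open>f a\<close> in \<open>J\<close>, without forming \<open>R/J\<close> as a module.\<close>

definition finite_free_resolution ::
  "('a, 'r) ring_scheme \<Rightarrow> 'a set \<Rightarrow> nat \<Rightarrow> (nat \<Rightarrow> nat list set) \<Rightarrow>
   (nat \<Rightarrow> (nat list \<Rightarrow> 'a) \<Rightarrow> nat list \<Rightarrow> 'a) \<Rightarrow> nat list \<Rightarrow> bool" where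
  "finite_free_resolution R J n A D a \<longleftrightarrow>
     (\<forall>j. finite (A j)) \<and> A 0 = {a} \<and> (\<forall>j>n. A j = {}) \<and>
     (\<forall>j. D j \<in> mod_homs R (free_module R (A (Suc j))) (free_module R (A j))) \<and>
     (\<forall>f \<in> carrier (free_module R (A 0)). f a \<in> J \<longleftrightarrow> f \<in> D 0 ` carrier (free_module R (A 1))) \<and>
     (\<forall>j. a_kernel (free_module R (A (Suc j))) (free_module R (A j)) (D j) =
        D (Suc j) ` carrier (free_module R (A (Suc (Suc j)))))"

lemma finite_free_resolutionD:
  assumes "finite_free_resolution R J n A D a"
  shows "finite (A j)" and "A 0 = {a}" and "j > n \<Longrightarrow> A j = {}"
    and "D j \<in> mod_homs R (free_module R (A (Suc j))) (free_module R (A j))"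
    and "f \<in> carrier (free_module R (A 0)) \<Longrightarrow> f a \<in> J \<longleftrightarrow> f \<in> D 0 ` carrier (free_module R (A 1))"
    and "a_kernel (free_module R (A (Suc j))) (free_module R (A j)) (D j) =
        D (Suc j) ` carrier (free_module R (A (Suc (Suc j))))"
proof -
  note res = assms[unfolded finite_free_resolution_def]
  show "finite (A j)" "A 0 = {a}"
    "D j \<in> mod_homs R (free_module R (A (Suc j))) (free_module R (A j))"
    "a_kernel (free_module R (A (Suc j))) (free_module R (A j)) (D j) =
        D (Suc j) ` carrier (free_module R (A (Suc (Suc j))))"
    by (insert res, (elim conjE, erule spec | elim conjE, assumption)+)
  have "\<forall>j>n. A j = {}" by (insert res, (elim conjE, assumption)+)
  then show "A j = {}" if "j > n" using that by simp
  show "f \<in> carrier (free_module R (A 0)) \<Longrightarrow> f a \<in> J \<longleftrightarrow> f \<in> D 0 ` carrier (free_module R (A 1))"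
    by (insert res, elim conjE, erule (1) bspec)
qed

text \<open>In the index sets of a mapping cone, lists that begin with \<open>0\<close> and \<open>1\<close> mark the two summands.\<close>

definition pair_vec :: "('a, 'r) ring_scheme \<Rightarrow> (nat list \<Rightarrow> 'a) \<Rightarrow> (nat list \<Rightarrow> 'a) \<Rightarrow> nat list \<Rightarrow> 'a" where
  "pair_vec R f g l = (case l of [] \<Rightarrow> \<zero>\<^bsub>R\<^esub> | b # m \<Rightarrow> if b = 0 then f m else if b = 1 then g m else \<zero>\<^bsub>R\<^esub>)"

abbreviation left_vec :: "(nat list \<Rightarrow> 'a) \<Rightarrow> nat list \<Rightarrow> 'a" where "left_vec f \<equiv> \<lambda>l. f (0 # l)"
abbreviation right_vec :: "(nat list \<Rightarrow> 'a) \<Rightarrow> nat list \<Rightarrow> 'a" where "right_vec f \<equiv> \<lambda>l. f (1 # l)"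

definition cone_index :: "(nat \<Rightarrow> nat list set) \<Rightarrow> nat \<Rightarrow> nat list set" where
  "cone_index A j = (#) 0 ` A j \<union> (case j of 0 \<Rightarrow> {} | Suc i \<Rightarrow> (#) 1 ` A i)"

lemma pair_vec_simps [simp]: "pair_vec R f g (0 # l) = f l" "pair_vec R f g (Suc 0 # l) = g l"
  by (simp_all add: pair_vec_def)

lemma cone_index_simps [simp]:
  "[] \<notin> cone_index A j"
  "b # m \<in> cone_index A 0 \<longleftrightarrow> b = 0 \<and> m \<in> A 0"
  "b # m \<in> cone_index A (Suc j) \<longleftrightarrow> b = 0 \<and> m \<in> A (Suc j) \<or> b = 1 \<and> m \<in> A j"
  by (auto simp: cone_index_def split: nat.split)

context cring
begin

lemma cone_carrier:
  shows "f \<in> carrier (free_module R (cone_index A (Suc j))) \<longleftrightarrow>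
      left_vec f \<in> carrier (free_module R (A (Suc j))) \<and> right_vec f \<in> carrier (free_module R (A j)) \<and>
      f = pair_vec R (left_vec f) (right_vec f)" (is ?suc)
    and "f \<in> carrier (free_module R (cone_index A 0)) \<longleftrightarrow>
      left_vec f \<in> carrier (free_module R (A 0)) \<and> f = pair_vec R (left_vec f) (\<lambda>_. \<zero>)" (is ?zero)
proof -
  have pair: "f = pair_vec R (left_vec f) g \<longleftrightarrow> f [] = \<zero> \<and> (\<forall>m. f (1 # m) = g m) \<and>
      (\<forall>b m. b \<noteq> 0 \<longrightarrow> b \<noteq> 1 \<longrightarrow> f (b # m) = \<zero>)" (is "?l \<longleftrightarrow> ?r") for g
  proof
    assume l: ?l
    show ?r
    proof (intro conjI allI impI)
      show "f [] = \<zero>" by (subst l) (simp add: pair_vec_def)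
      show "f (1 # m) = g m" for m by (subst l) (simp add: pair_vec_def)
      show "f (b # m) = \<zero>" if "b \<noteq> 0" "b \<noteq> 1" for b m by (subst l) (use that in \<open>simp add: pair_vec_def\<close>)
    qed
  next
    assume r: ?r
    show ?l
    proof
      show "f l = pair_vec R (left_vec f) g l" for l using r by (cases l) (simp_all add: pair_vec_def)
    qed
  qed
  have carrier_iff: "h \<in> carrier (free_module R X) \<longleftrightarrow> (\<forall>l. if l \<in> X then h l \<in> carrier R else h l = \<zero>)"
    for h :: "nat list \<Rightarrow> 'a" and X
    unfolding free_module_carrier by (metis zero_closed)
  have split: "(\<forall>l. P l) \<longleftrightarrow> P [] \<and> (\<forall>m. P (0 # m)) \<and> (\<forall>m. P (1 # m)) \<and>
      (\<forall>b m. b \<noteq> 0 \<longrightarrow> b \<noteq> 1 \<longrightarrow> P (b # m))" for P :: "nat list \<Rightarrow> bool"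
    by (metis list.exhaust)
  show ?suc
    unfolding pair carrier_iff split[of "\<lambda>l. if l \<in> cone_index A (Suc j) then f l \<in> carrier R else f l = \<zero>"]
    by (simp only: cone_index_simps if_False simp_thms) (auto)
  show ?zero
    unfolding pair carrier_iff split[of "\<lambda>l. if l \<in> cone_index A 0 then f l \<in> carrier R else f l = \<zero>"]
    by (simp only: cone_index_simps if_False simp_thms) auto
qed

lemma cone_pair:
  shows "g \<in> carrier (free_module R (A (Suc j))) \<Longrightarrow> h \<in> carrier (free_module R (A j)) \<Longrightarrow>
      pair_vec R g h \<in> carrier (free_module R (cone_index A (Suc j)))"
    and "g \<in> carrier (free_module R (A 0)) \<Longrightarrow> pair_vec R g (\<lambda>_. \<zero>) \<in> carrier (free_module R (cone_index A 0))"
  by (simp_all add: cone_carrier)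

text \<open>The mapping cone of multiplication by \<open>x\<close>: the sign in \<open>cone_scalar\<close> makes its
  differential square to zero.\<close>

definition cone_scalar :: "'a \<Rightarrow> nat \<Rightarrow> 'a" where "cone_scalar x j = (if even j then x else \<ominus> x)"

definition cone_map ::
  "'a \<Rightarrow> (nat \<Rightarrow> (nat list \<Rightarrow> 'a) \<Rightarrow> nat list \<Rightarrow> 'a) \<Rightarrow> nat \<Rightarrow> (nat list \<Rightarrow> 'a) \<Rightarrow> nat list \<Rightarrow> 'a" where
  "cone_map x D j f = pair_vec R (\<lambda>l. D j (left_vec f) l \<oplus> cone_scalar x j \<otimes> f (1 # l))
     (case j of 0 \<Rightarrow> \<lambda>_. \<zero> | Suc i \<Rightarrow> D i (right_vec f))"

text \<open>The cone of multiplication by \<open>x\<close> on a resolution of \<open>R/J\<close> has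
  homology only in degrees 0 and 1, where it is the cokernel and the kernel of \<open>x\<close> on
  \<open>R/J\<close>. Regularity thus enters only at exactness in degree one, the case
  \<open>j = 0\<close>.\<close>

lemma cone_resolution:
  assumes res: "finite_free_resolution R J n A D a" and J: "ideal J R" and x: "x \<in> carrier R"
    and reg: "\<And>b. b \<in> carrier R \<Longrightarrow> x \<otimes> b \<in> J \<Longrightarrow> b \<in> J"
  shows "finite_free_resolution R (adjoin R J x) (Suc n) (cone_index A) (cone_map x D) (0 # a)"
proof -
  note A = finite_free_resolutionD[OF res]
  let ?F = "\<lambda>j. free_module R (A j)" and ?C = "\<lambda>j. free_module R (cone_index A j)"
  interpret J: ideal J R by (rule J)
  have F: "module R (?F j)" for j by (rule free_module)
  have c: "cone_scalar x j \<in> carrier R" for j using x by (simp add: cone_scalar_def)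
  have neg: "cone_scalar x (Suc j) = \<ominus> cone_scalar x j" for j using x by (simp add: cone_scalar_def)
  have DR: "D j f l \<in> carrier R" if "f \<in> carrier (?F (Suc j))" for j f l
    using mod_homsD(1)[OF A(4) that] by (simp add: free_module_carrier)
  have Dadd: "D j (\<lambda>l. f l \<oplus> g l) l = D j f l \<oplus> D j g l"
    if "f \<in> carrier (?F (Suc j))" "g \<in> carrier (?F (Suc j))" for j f g l
    using mod_homsD(2)[OF A(4) that] by (simp add: fun_eq_iff)
  have Dsm: "D j (\<lambda>l. b \<otimes> f l) l = b \<otimes> D j f l" if "b \<in> carrier R" "f \<in> carrier (?F (Suc j))" for j f b l
    using mod_homsD(3)[OF A(4) that] by (simp add: fun_eq_iff)
  have comb: "(\<lambda>l. f l \<oplus> b \<otimes> g l) \<in> carrier (?F j)" if "f \<in> carrier (?F j)" "g \<in> carrier (?F j)" "b \<in> carrier R" for f g b j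
    using that by (simp add: free_module_carrier)
  have sm: "(\<lambda>l. b \<otimes> g l) \<in> carrier (?F j)" if "g \<in> carrier (?F j)" "b \<in> carrier R" for g b j
    using that by (simp add: free_module_carrier)
  have Dcomb: "D j (\<lambda>l. f l \<oplus> b \<otimes> g l) l = D j f l \<oplus> b \<otimes> D j g l"
    if "f \<in> carrier (?F (Suc j))" "g \<in> carrier (?F (Suc j))" "b \<in> carrier R" for j f g b l
    using Dadd[OF that(1) sm[OF that(2,3)]] Dsm[OF that(3,2)] by simp
  have DD: "D j (D (Suc j) f) l = \<zero>" if "f \<in> carrier (?F (Suc (Suc j)))" for j f l
  proof -
    have "D (Suc j) f \<in> a_kernel (?F (Suc j)) (?F j) (D j)" unfolding A(6) using that by blast
    then show ?thesis by (simp add: a_kernel_iff)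
  qed
  have C0: "D j (left_vec f) l \<oplus> cone_scalar x j \<otimes> f (1 # l) \<in> carrier R"
    if "f \<in> carrier (?C (Suc j))" for j f l
    using that DR[of "left_vec f" j] c unfolding cone_carrier by (simp add: free_module_carrier)
  have fst: "(\<lambda>l. D j (left_vec f) l \<oplus> cone_scalar x j \<otimes> f (1 # l)) \<in> carrier (?F j)"
    if "f \<in> carrier (?C (Suc j))" for j f
    using that comb[OF mod_homsD(1)[OF A(4)] _ c] unfolding cone_carrier by blast
  have map: "cone_map x D j f \<in> carrier (?C j)" if f: "f \<in> carrier (?C (Suc j))" for j f
  proof (cases j)
    case 0
    show ?thesis using cone_pair(2)[of _ A] fst[OF f] unfolding cone_map_def 0 by simp
  next
    case (Suc i)
    have "right_vec f \<in> carrier (?F (Suc i))" using f unfolding cone_carrier Suc by simp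
    then show ?thesis
      using cone_pair(1)[OF fst[OF f, unfolded Suc] mod_homsD(1)[OF A(4)[of i], of "right_vec f"]]
      unfolding cone_map_def Suc by simp
  qed
  have hom: "cone_map x D j \<in> mod_homs R (?C (Suc j)) (?C j)" for j
  proof (rule mod_homsI[OF map])
    fix f g assume f: "f \<in> carrier (?C (Suc j))" and g: "g \<in> carrier (?C (Suc j))"
    note fc = f[unfolded cone_carrier] and gc = g[unfolded cone_carrier]
    have R: "f l \<in> carrier R" "g l \<in> carrier R" for l using f g by (simp_all add: free_module_carrier)
    have 1: "D j (\<lambda>l. f (0 # l) \<oplus> g (0 # l)) l \<oplus> cone_scalar x j \<otimes> (f (1 # l) \<oplus> g (1 # l)) =
      (D j (left_vec f) l \<oplus> cone_scalar x j \<otimes> f (1 # l)) \<oplus> (D j (left_vec g) l \<oplus> cone_scalar x j \<otimes> g (1 # l))" for l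
      using Dadd[of "left_vec f" j "left_vec g"] fc gc DR[of "left_vec f" j l] DR[of "left_vec g" j l] c R
      by (simp add: r_distr a_ac)
    have 2: "D i (\<lambda>l. f (1 # l) \<oplus> g (1 # l)) l = D i (right_vec f) l \<oplus> D i (right_vec g) l" if "j = Suc i" for i l
      using Dadd[of "right_vec f" i "right_vec g"] fc gc that by simp
    show "cone_map x D j (f \<oplus>\<^bsub>?C (Suc j)\<^esub> g) = cone_map x D j f \<oplus>\<^bsub>?C j\<^esub> cone_map x D j g"
      unfolding cone_map_def fun_eq_iff using 1 2
      by (auto simp: pair_vec_def split: list.split nat.split)
  next
    fix b f assume b: "b \<in> carrier R" and f: "f \<in> carrier (?C (Suc j))"
    note fc = f[unfolded cone_carrier]
    have R: "f l \<in> carrier R" for l using f by (simp_all add: free_module_carrier)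
    have 1: "D j (\<lambda>l. b \<otimes> f (0 # l)) l \<oplus> cone_scalar x j \<otimes> (b \<otimes> f (1 # l)) =
      b \<otimes> (D j (left_vec f) l \<oplus> cone_scalar x j \<otimes> f (1 # l))" for l
      using Dsm[of b "left_vec f" j] fc DR[of "left_vec f" j l] c R b by (simp add: r_distr m_lcomm)
    have 2: "D i (\<lambda>l. b \<otimes> f (1 # l)) l = b \<otimes> D i (right_vec f) l" if "j = Suc i" for i l
      using Dsm[of b "right_vec f" i] fc b that by simp
    show "cone_map x D j (b \<odot>\<^bsub>?C (Suc j)\<^esub> f) = b \<odot>\<^bsub>?C j\<^esub> cone_map x D j f"
      unfolding cone_map_def fun_eq_iff using 1 2 b
      by (auto simp: pair_vec_def split: list.split nat.split)
  qed
  have image0: "D 0 f a \<in> J" if "f \<in> carrier (?F 1)" for f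
    using A(5)[OF mod_homsD(1)[OF A(4)[of 0]], of f] that by auto
  have aug: "f (0 # a) \<in> adjoin R J x \<longleftrightarrow> f \<in> cone_map x D 0 ` carrier (?C 1)" if f: "f \<in> carrier (?C 0)" for f
  proof
    have f0: "left_vec f \<in> carrier (?F 0)" "f = pair_vec R (left_vec f) (\<lambda>_. \<zero>)"
      using f unfolding cone_carrier by blast+
    have fR: "f l \<in> carrier R" for l using f by (simp add: free_module_carrier)
    assume "f (0 # a) \<in> adjoin R J x"
    then obtain j b where jb: "f (0 # a) = j \<oplus> b \<otimes> x" "j \<in> J" "b \<in> carrier R" unfolding adjoin_def by blast
    \<comment> \<open>\<open>h\<close> carries the coefficient \<open>b\<close> of \<open>x\<close>;
      removing \<open>x h\<close> leaves a vector whose coordinate at \<open>a\<close> lies in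
      \<open>J\<close>.\<close>
    define h where "h = (\<lambda>l. if l = a then b else \<zero>)"
    have h: "h \<in> carrier (?F 0)" using jb(3) by (simp add: h_def free_module_carrier A(2))
    define k where "k = (\<lambda>l. f (0 # l) \<oplus> \<ominus> x \<otimes> h l)"
    have k: "k \<in> carrier (?F 0)" unfolding k_def by (rule comb[OF f0(1) h]) (use x in simp)
    have "k a = j"
    proof -
      have "k a = (j \<oplus> b \<otimes> x) \<oplus> \<ominus> x \<otimes> b" unfolding k_def h_def jb(1) by simp
      then show ?thesis using jb(3) x J.Icarr[OF jb(2)] by algebra
    qed
    then obtain g where g: "g \<in> carrier (?F 1)" "k = D 0 g" using A(5)[OF k] jb(2) by blast
    have "D 0 g l \<oplus> x \<otimes> h l = f (0 # l)" for l
    proof -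
      have hl: "h l \<in> carrier R" using h by (simp add: free_module_carrier)
      have "D 0 g l = f (0 # l) \<oplus> \<ominus> x \<otimes> h l" unfolding g(2)[symmetric] k_def ..
      then show ?thesis using hl x fR[of "0 # l"] by algebra
    qed
    then have "cone_map x D 0 (pair_vec R g h) = pair_vec R (left_vec f) (\<lambda>_. \<zero>)"
      unfolding cone_map_def by (simp add: cone_scalar_def)
    moreover have "pair_vec R g h \<in> carrier (?C 1)" using cone_pair(1)[of g A 0 h] g(1) h by simp
    ultimately show "f \<in> cone_map x D 0 ` carrier (?C 1)" using f0(2) by (metis imageI)
  next
    assume "f \<in> cone_map x D 0 ` carrier (?C 1)"
    then obtain g where g: "g \<in> carrier (?C 1)" "f = cone_map x D 0 g" by blast
    have g': "left_vec g \<in> carrier (?F 1)" "right_vec g \<in> carrier (?F 0)"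
      using g(1) cone_carrier(1)[of g A 0] by simp_all
    have "f (0 # a) = D 0 (left_vec g) a \<oplus> x \<otimes> g (1 # a)"
      unfolding g(2) cone_map_def by (simp add: cone_scalar_def)
    moreover have "D 0 (left_vec g) a \<in> adjoin R J x" using image0[OF g'(1)] adjoin(2)[OF J x] by blast
    moreover have "x \<otimes> g (1 # a) \<in> adjoin R J x"
      using ideal.I_r_closed[OF adjoin(1)[OF J x] adjoin(3)[OF J x]] g'(2) by (simp add: free_module_carrier)
    ultimately show "f (0 # a) \<in> adjoin R J x" using ideal.ideal_closed(3)[OF adjoin(1)[OF J x]] by simp
  qed
  have exact: "a_kernel (?C (Suc j)) (?C j) (cone_map x D j) = cone_map x D (Suc j) ` carrier (?C (Suc (Suc j)))" for j
  proof
    show "cone_map x D (Suc j) ` carrier (?C (Suc (Suc j))) \<subseteq> a_kernel (?C (Suc j)) (?C j) (cone_map x D j)"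
    proof
      fix f assume "f \<in> cone_map x D (Suc j) ` carrier (?C (Suc (Suc j)))"
      then obtain g where g: "g \<in> carrier (?C (Suc (Suc j)))" "f = cone_map x D (Suc j) g" by blast
      have g': "left_vec g \<in> carrier (?F (Suc (Suc j)))" "right_vec g \<in> carrier (?F (Suc j))"
        using g(1) unfolding cone_carrier by blast+
      have f: "left_vec f = (\<lambda>l. D (Suc j) (left_vec g) l \<oplus> cone_scalar x (Suc j) \<otimes> g (1 # l))"
        "right_vec f = D j (right_vec g)" unfolding g(2) cone_map_def by simp_all
      have 1: "D j (left_vec f) l \<oplus> cone_scalar x j \<otimes> f (1 # l) = \<zero>" for l
      proof -
        have "D j (left_vec f) l = D j (D (Suc j) (left_vec g)) l \<oplus> cone_scalar x (Suc j) \<otimes> D j (right_vec g) l"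
          unfolding f(1) by (rule Dcomb[OF mod_homsD(1)[OF A(4) g'(1)] g'(2) c])
        also have "\<dots> = \<ominus> (cone_scalar x j \<otimes> D j (right_vec g) l)"
          unfolding DD[OF g'(1)] neg using c DR[OF g'(2)] by (simp add: l_minus)
        finally show ?thesis using fun_cong[OF f(2), of l] c DR[OF g'(2)] by (simp add: l_neg)
      qed
      have 2: "D i (right_vec f) l = \<zero>" if "j = Suc i" for i l
        unfolding f(2) that by (rule DD) (use g'(2) that in simp)
      have "cone_map x D j f = (\<lambda>_. \<zero>)"
        unfolding cone_map_def fun_eq_iff using 1 2 by (auto simp: pair_vec_def split: list.split nat.split)
      moreover have "f \<in> carrier (?C (Suc j))" unfolding g(2) by (rule map[OF g(1)])
      ultimately show "f \<in> a_kernel (?C (Suc j)) (?C j) (cone_map x D j)" by (simp add: a_kernel_iff)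
    qed
    show "a_kernel (?C (Suc j)) (?C j) (cone_map x D j) \<subseteq> cone_map x D (Suc j) ` carrier (?C (Suc (Suc j)))"
    proof
      fix f assume "f \<in> a_kernel (?C (Suc j)) (?C j) (cone_map x D j)"
      then have f: "f \<in> carrier (?C (Suc j))" and zero: "\<And>l. cone_map x D j f l = \<zero>"
        by (simp_all add: a_kernel_iff)
      have f': "left_vec f \<in> carrier (?F (Suc j))" "right_vec f \<in> carrier (?F j)"
        "f = pair_vec R (left_vec f) (right_vec f)" using f unfolding cone_carrier by blast+
      have fR: "f l \<in> carrier R" for l using f by (simp add: free_module_carrier)
      have z0: "D j (left_vec f) l \<oplus> cone_scalar x j \<otimes> f (1 # l) = \<zero>" for l
        using zero[of "0 # l"] unfolding cone_map_def by simp
      have z1: "D i (right_vec f) l = \<zero>" if "j = Suc i" for i l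
        using zero[of "1 # l"] unfolding cone_map_def that by simp
      \<comment> \<open>The right component is a cycle, hence a boundary. For \<open>j = 0\<close>
        this means that its coordinate at \<open>a\<close> lies in \<open>J\<close>, which is where
        regularity of \<open>x\<close> on \<open>R/J\<close> is used.\<close>
      have "\<exists>h \<in> carrier (?F (Suc j)). right_vec f = D j h"
      proof (cases j)
        case 0
        have "D 0 (left_vec f) a \<oplus> x \<otimes> f (1 # a) = \<zero>" using z0[of a] unfolding 0 by (simp add: cone_scalar_def)
        then have "x \<otimes> f (1 # a) = \<ominus> D 0 (left_vec f) a"
          using minus_equality[of "x \<otimes> f (1 # a)" "D 0 (left_vec f) a"] x fR DR[of "left_vec f" 0 a] f'(1)
          unfolding 0 by (simp add: a_comm)
        then have "x \<otimes> f (1 # a) \<in> J" using image0[of "left_vec f"] f'(1) J.ideal_closed(4) unfolding 0 by simp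
        then have "f (1 # a) \<in> J" by (rule reg[OF fR])
        then show ?thesis using A(5)[of "right_vec f"] f'(2) unfolding 0 by auto
      next
        case (Suc i)
        have "right_vec f \<in> a_kernel (?F (Suc i)) (?F i) (D i)"
          using f'(2) z1[OF Suc] unfolding Suc by (simp add: a_kernel_iff fun_eq_iff)
        then show ?thesis unfolding A(6) Suc by blast
      qed
      then obtain h where h: "h \<in> carrier (?F (Suc j))" "right_vec f = D j h" by blast
      \<comment> \<open>Adding this multiple of \<open>h\<close> turns the left component into a
        cycle, by \<open>z0\<close>. A preimage \<open>g\<close> of it under
        \<open>D (Suc j)\<close>, paired with \<open>h\<close>, is the preimage of
        \<open>f\<close>.\<close>
      define k where "k = (\<lambda>l. f (0 # l) \<oplus> cone_scalar x j \<otimes> h l)"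
      have k: "k \<in> carrier (?F (Suc j))" unfolding k_def by (rule comb[OF f'(1) h(1) c])
      have "D j k l = \<zero>" for l
      proof -
        have "D j k l = D j (left_vec f) l \<oplus> cone_scalar x j \<otimes> D j h l"
          unfolding k_def by (rule Dcomb[OF f'(1) h(1) c])
        then show ?thesis using z0[of l] fun_cong[OF h(2), of l] by simp
      qed
      then have "k \<in> a_kernel (?F (Suc j)) (?F j) (D j)" using k by (simp add: a_kernel_iff fun_eq_iff)
      then obtain g where g: "g \<in> carrier (?F (Suc (Suc j)))" "k = D (Suc j) g" unfolding A(6) by blast
      have "D (Suc j) g l \<oplus> cone_scalar x (Suc j) \<otimes> h l = f (0 # l)" for l
      proof -
        have hl: "h l \<in> carrier R" using h(1) by (simp add: free_module_carrier)
        have "D (Suc j) g l = f (0 # l) \<oplus> cone_scalar x j \<otimes> h l" unfolding g(2)[symmetric] k_def ..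
        then show ?thesis unfolding neg using hl c[of j] fR[of "0 # l"] by algebra
      qed
      then have "cone_map x D (Suc j) (pair_vec R g h) = pair_vec R (left_vec f) (right_vec f)"
        unfolding cone_map_def using h(2) by simp
      then have "cone_map x D (Suc j) (pair_vec R g h) = f" using f'(3) by simp
      moreover have "pair_vec R g h \<in> carrier (?C (Suc (Suc j)))" by (rule cone_pair(1)[where A = A, OF g(1) h(1)])
      ultimately show "f \<in> cone_map x D (Suc j) ` carrier (?C (Suc (Suc j)))" by blast
    qed
  qed
  show ?thesis
    unfolding finite_free_resolution_def
  proof (intro conjI allI ballI impI)
    show "finite (cone_index A j)" for j using A(1) by (simp add: cone_index_def split: nat.split)
    show "cone_index A 0 = {0 # a}" by (simp add: cone_index_def A(2))
    show "cone_index A j = {}" if "j > Suc n" for j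
      using that A(3)[of j] A(3)[of "j - 1"] by (cases j) (simp_all add: cone_index_def)
  qed (rule hom aug exact | assumption)+
qed

lemma trivial_resolution:
  "finite_free_resolution R {\<zero>} 0 (\<lambda>j. if j = 0 then {[]} else {}) (\<lambda>_ _ _. \<zero>) []"
proof -
  have empty: "carrier (free_module R {}) = {\<lambda>_. \<zero>}" by (auto simp: free_module_carrier)
  show ?thesis
    unfolding finite_free_resolution_def
  proof (intro conjI allI ballI impI)
    fix j :: nat
    show "(\<lambda>_ _. \<zero>) \<in> mod_homs R (free_module R (if Suc j = 0 then {[] :: nat list} else {}))
       (free_module R (if j = 0 then {[]} else {}))"
      by (rule mod_homsI) (simp_all add: free_module_carrier)
    show "a_kernel (free_module R (if Suc j = 0 then {[] :: nat list} else {}))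
       (free_module R (if j = 0 then {[]} else {})) (\<lambda>_ _. \<zero>) =
      (\<lambda>_ _. \<zero>) ` carrier (free_module R (if Suc (Suc j) = 0 then {[] :: nat list} else {}))"
      by (auto simp: a_kernel_def' empty)
  next
    fix f assume "f \<in> carrier (free_module R (if (0 :: nat) = 0 then {[] :: nat list} else {}))"
    then have f: "l \<noteq> [] \<Longrightarrow> f l = \<zero>" for l by (simp add: free_module_carrier)
    have "f [] = \<zero> \<longleftrightarrow> f = (\<lambda>_. \<zero>)" using f by (metis ext)
    then show "f [] \<in> {\<zero>} \<longleftrightarrow> f \<in> (\<lambda>_ _. \<zero>) ` carrier (free_module R (if (1 :: nat) = 0 then {[] :: nat list} else {}))"
      by (simp add: empty)
  qed simp_all
qed

end

text \<open>One cone for each member of the sequence, starting from the ring as a resolution of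
  itself, builds the Koszul complex.\<close>

lemma (in noetherian_local_ring) resolution_of_regular_flag:
  assumes flag: "regular_flag R {\<zero>} n J x"
  shows "\<exists>A D a. finite_free_resolution R \<mm> n A D a"
proof -
  have J: "J 0 = {\<zero>}" "J n = \<mm>" and step: "\<And>i. i < n \<Longrightarrow> x i \<in> carrier R" "\<And>i. i < n \<Longrightarrow> J (Suc i) = adjoin R (J i) (x i)"
    and reg: "\<And>i b. i < n \<Longrightarrow> b \<in> carrier R \<Longrightarrow> x i \<otimes> b \<in> J i \<Longrightarrow> b \<in> J i"
    using flag unfolding regular_flag_def by blast+
  have "i \<le> n \<Longrightarrow> ideal (J i) R \<and> (\<exists>A D a. finite_free_resolution R (J i) i A D a)" for i
  proof (induction i)
    case 0
    show ?case unfolding J using zeroideal trivial_resolution by blast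
  next
    case (Suc i)
    then obtain A D a where id: "ideal (J i) R" and res: "finite_free_resolution R (J i) i A D a" by auto
    have i: "i < n" using Suc.prems by simp
    show ?case
      unfolding step(2)[OF i] using cone_resolution[OF res id step(1)[OF i] reg[OF i]] adjoin(1)[OF id step(1)[OF i]] by blast
  qed
  from this[of n] show ?thesis using J by simp
qed

section \<open>Projective dimension from a finite free resolution\<close>

lemma eq_image_if_preimage:
  assumes "\<And>x. x \<in> F \<Longrightarrow> g x \<in> K \<longleftrightarrow> x \<in> X" "X \<subseteq> F" "K \<subseteq> g ` F"
  shows "K = g ` X"
  using assms by blast

text \<open>\<open>S\<close> is \<open>R/J\<close> on an arbitrary type. The free terms are copied
  to the list type over which \<open>proj_dim\<close> ranges, which is possible because their index
  sets are finite.\<close>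

lemma proj_dim_le_resolution:
  fixes S :: "('a, 's) module"
  assumes S: "module R S" and s: "s \<in> carrier S"
    and gen: "\<And>x. x \<in> carrier S \<Longrightarrow> \<exists>b \<in> carrier R. x = b \<odot>\<^bsub>S\<^esub> s"
    and ann: "\<And>b. b \<in> carrier R \<Longrightarrow> b \<odot>\<^bsub>S\<^esub> s = \<zero>\<^bsub>S\<^esub> \<longleftrightarrow> b \<in> J"
    and res: "finite_free_resolution R J n A D a"
  shows "proj_dim R S \<le> enat n"
proof -
  interpret S: module R S by (rule S)
  note A = finite_free_resolutionD[OF res]
  let ?F = "\<lambda>j. free_module R (A j)"
  have F: "module R (?F j)" for j by (rule S.free_module)
  have "\<exists>g :: (nat list \<Rightarrow> 'a) \<Rightarrow> ('a, 's) ample. inj_on g (carrier (?F j))" for j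
    using finite_functions_embed[OF A(1)[of j]] by blast
  then obtain g :: "nat \<Rightarrow> (nat list \<Rightarrow> 'a) \<Rightarrow> ('a, 's) ample" where g: "\<And>j. inj_on (g j) (carrier (?F j))" by metis
  define P where "P j = transport_module (?F j) (g j)" for j
  define i where "i j = the_inv_into (carrier (?F j)) (g j)" for j
  have P: "module R (P j)" and gP: "g j \<in> mod_homs R (?F j) (P j)" and iP: "i j \<in> mod_homs R (P j) (?F j)"
    and car: "carrier (P j) = g j ` carrier (?F j)" and ig: "\<And>f. f \<in> carrier (?F j) \<Longrightarrow> i j (g j f) = f" for j
    using transport_module[OF F g] unfolding P_def i_def by blast+
  have proj: "projective_module R (P j)" for j
  proof (rule projective_module_free[OF P A(1) iP gP])
    fix y assume "y \<in> carrier (P j)"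
    then obtain f where f: "f \<in> carrier (?F j)" "y = g j f" unfolding car by blast
    show "g j (i j y) = y" unfolding f(2) ig[OF f(1)] ..
  qed
  define q where "q y = i 0 y a \<odot>\<^bsub>S\<^esub> s" for y
  define \<delta> where "\<delta> j y = g j (D j (i (Suc j) y))" for j y
  have \<delta>: "\<delta> j \<in> mod_homs R (P (Suc j)) (P j)" for j
    unfolding \<delta>_def by (rule mod_homs_comp[OF mod_homs_comp[OF iP A(4)] gP])
  have eva: "(\<lambda>f. f a \<odot>\<^bsub>S\<^esub> s) \<in> mod_homs R (?F 0) S"
    using s by (intro mod_homsI) (simp_all add: free_module_carrier S.smult_l_distr S.smult_assoc1)
  have q: "q \<in> mod_homs R (P 0) S" unfolding q_def by (rule mod_homs_comp[OF iP eva])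
  have qg: "q (g 0 f) = f a \<odot>\<^bsub>S\<^esub> s" if "f \<in> carrier (?F 0)" for f unfolding q_def ig[OF that] ..
  have \<delta>g: "\<delta> j (g (Suc j) f) = g j (D j f)" if "f \<in> carrier (?F (Suc j))" for j f
    unfolding \<delta>_def ig[OF that] ..
  have \<delta>_image: "\<delta> j ` carrier (P (Suc j)) = g j ` D j ` carrier (?F (Suc j))" for j
    unfolding car image_image by (rule image_cong[OF refl \<delta>g])
  have g0: "g j f = \<zero>\<^bsub>P j\<^esub> \<longleftrightarrow> f = \<zero>\<^bsub>?F j\<^esub>" if "f \<in> carrier (?F j)" for j f
  proof -
    interpret Fj: module R "?F j" by (rule F)
    show ?thesis using inj_on_eq_iff[OF g that Fj.M.zero_closed] mod_homs_zero[OF F P gP, of j] by simp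
  qed
  have "projective_resolution R S q P \<delta>"
    unfolding projective_resolution_def
  proof (intro conjI allI S proj q \<delta>)
    show "q ` carrier (P 0) = carrier S"
    proof
      show "q ` carrier (P 0) \<subseteq> carrier S" using mod_homsD(1)[OF q] by blast
      show "carrier S \<subseteq> q ` carrier (P 0)"
      proof
        fix x assume "x \<in> carrier S"
        then obtain b where b: "b \<in> carrier R" "x = b \<odot>\<^bsub>S\<^esub> s" using gen by blast
        define f where "f = (\<lambda>l. if l = a then b else \<zero>\<^bsub>R\<^esub>)"
        have f: "f \<in> carrier (?F 0)" using b(1) by (simp add: f_def free_module_carrier A(2))
        have "x = q (g 0 f)" unfolding qg[OF f] b(2) by (simp add: f_def)
        then show "x \<in> q ` carrier (P 0)" unfolding car using f by blast
      qed
    qed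
    show "a_kernel (P 0) S q = \<delta> 0 ` carrier (P 1)"
    proof -
      have "g 0 f \<in> a_kernel (P 0) S q \<longleftrightarrow> f \<in> D 0 ` carrier (?F 1)" if f: "f \<in> carrier (?F 0)" for f
      proof -
        have fa: "f a \<in> carrier R" using f by (simp add: free_module_carrier)
        have "g 0 f \<in> a_kernel (P 0) S q \<longleftrightarrow> f a \<odot>\<^bsub>S\<^esub> s = \<zero>\<^bsub>S\<^esub>"
          unfolding a_kernel_iff qg[OF f] car using f by blast
        then show ?thesis unfolding ann[OF fa] A(5)[OF f] .
      qed
      moreover have "D 0 ` carrier (?F 1) \<subseteq> carrier (?F 0)" using mod_homsD(1)[OF A(4)[of 0]] by auto
      moreover have "a_kernel (P 0) S q \<subseteq> g 0 ` carrier (?F 0)" unfolding car[symmetric] by (auto simp: a_kernel_iff)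
      ultimately have "a_kernel (P 0) S q = g 0 ` D 0 ` carrier (?F 1)" by (rule eq_image_if_preimage)
      then show ?thesis using \<delta>_image[of 0] by simp
    qed
    show "a_kernel (P (Suc j)) (P j) (\<delta> j) = \<delta> (Suc j) ` carrier (P (Suc (Suc j)))" for j
    proof -
      have "g (Suc j) f \<in> a_kernel (P (Suc j)) (P j) (\<delta> j) \<longleftrightarrow> f \<in> D (Suc j) ` carrier (?F (Suc (Suc j)))"
        if f: "f \<in> carrier (?F (Suc j))" for f
      proof -
        have "g (Suc j) f \<in> a_kernel (P (Suc j)) (P j) (\<delta> j) \<longleftrightarrow> D j f = \<zero>\<^bsub>?F j\<^esub>"
          unfolding a_kernel_iff \<delta>g[OF f] car g0[OF mod_homsD(1)[OF A(4) f]] using f by blast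
        also have "\<dots> \<longleftrightarrow> f \<in> a_kernel (?F (Suc j)) (?F j) (D j)" unfolding a_kernel_iff using f by blast
        finally show ?thesis unfolding A(6) .
      qed
      moreover have "D (Suc j) ` carrier (?F (Suc (Suc j))) \<subseteq> carrier (?F (Suc j))"
        using mod_homsD(1)[OF A(4)[of "Suc j"]] by auto
      moreover have "a_kernel (P (Suc j)) (P j) (\<delta> j) \<subseteq> g (Suc j) ` carrier (?F (Suc j))"
        unfolding car[symmetric] by (auto simp: a_kernel_iff)
      ultimately have "a_kernel (P (Suc j)) (P j) (\<delta> j) = g (Suc j) ` D (Suc j) ` carrier (?F (Suc (Suc j)))" by (rule eq_image_if_preimage)
      then show ?thesis using \<delta>_image[of "Suc j"] by simp
    qed
  qed
  moreover have "carrier (P j) = {\<zero>\<^bsub>P j\<^esub>}" if "j > n" for j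
  proof -
    have "carrier (?F j) = {\<zero>\<^bsub>?F j\<^esub>}" unfolding A(3)[OF that] by (auto simp: free_module_carrier)
    then show ?thesis unfolding car using mod_homs_zero[OF F P gP, of j] by simp
  qed
  ultimately show ?thesis unfolding proj_dim_def by (intro Inf_lower) blast
qed

text \<open>The cosyzygy of index zero is the image of the residue field under the injective map
  \<open>e\<close>. All of it serves as the summand, and the Koszul complex bounds its projective
  dimension.\<close>

lemma (in noetherian_local_ring) regular_zeroth_cosyzygy:
  fixes e :: "'a set \<Rightarrow> 'e" and I :: "nat \<Rightarrow> ('a, 'e) module"
  assumes reg: "regular_local_ring R"
    and res: "minimal_injective_resolution R (residue_module R) e I d"
    and \<Omega>: "\<Omega> = cosyzygy (residue_module R) e I d 0"
  shows "direct_summand R (carrier \<Omega>) \<Omega>" and "carrier \<Omega> \<noteq> {\<zero>\<^bsub>\<Omega>\<^esub>}" and "fin_gen_module R \<Omega>"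
    and "proj_dim R \<Omega> < \<infinity>"
proof -
  let ?k = "residue_module R"
  note res' = res[unfolded minimal_injective_resolution_def]
  have k: "module R ?k" and e: "e \<in> mod_homs R ?k (I 0)" and inj: "inj_on e (carrier ?k)"
    by (insert res', (elim conjE, assumption)+)
  have "injective_module R (I 0)" by (insert res', elim conjE, erule spec)
  then have IM: "module R (I 0)" by (simp add: injective_module_def)
  interpret k: module R ?k by (rule k)
  have \<Omega>_eq: "\<Omega> = (I 0)\<lparr>carrier := e ` carrier ?k\<rparr>" unfolding \<Omega> by (simp add: cosyzygy_def)
  have \<Omega>M: "module R \<Omega>"
    unfolding \<Omega>_eq by (rule submodule_module[OF IM image_submodule[OF k IM e k.carrier_is_submodule]])
  interpret \<Omega>: module R \<Omega> by (rule \<Omega>M)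
  have car: "carrier \<Omega> = e ` carrier ?k" and zero: "\<zero>\<^bsub>\<Omega>\<^esub> = \<zero>\<^bsub>I 0\<^esub>" and smult: "smult \<Omega> = smult (I 0)"
    by (simp_all add: \<Omega>_eq)
  have e0: "e \<zero>\<^bsub>?k\<^esub> = \<zero>\<^bsub>\<Omega>\<^esub>" unfolding zero by (rule mod_homs_zero[OF k IM e])
  have kc: "\<mm> +> b \<in> carrier ?k" if "b \<in> carrier R" for b using residue_module(1)[of "\<mm> +> b"] that by blast
  let ?s = "e (\<mm> +> \<one>)"
  have s: "?s \<in> carrier \<Omega>" unfolding car using kc[OF one_closed] by blast
  have smult_s: "b \<odot>\<^bsub>\<Omega>\<^esub> ?s = e (\<mm> +> b)" if b: "b \<in> carrier R" for b
  proof -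
    have "b \<odot>\<^bsub>\<Omega>\<^esub> ?s = e (b \<odot>\<^bsub>?k\<^esub> (\<mm> +> \<one>))"
      unfolding smult by (rule mod_homsD(3)[OF e b kc[OF one_closed], symmetric])
    then show ?thesis using residue_module(3)[OF b one_closed] b by simp
  qed
  have gen: "\<exists>b \<in> carrier R. x = b \<odot>\<^bsub>\<Omega>\<^esub> ?s" if "x \<in> carrier \<Omega>" for x
  proof -
    have "x \<in> e ` carrier ?k" using that unfolding car .
    then obtain X where X: "X \<in> carrier ?k" "x = e X" by blast
    obtain b where b: "b \<in> carrier R" "X = \<mm> +> b" using X(1) residue_module(1)[of X] by blast
    have "x = b \<odot>\<^bsub>\<Omega>\<^esub> ?s" unfolding X(2) b(2) smult_s[OF b(1)] ..
    then show ?thesis using b(1) by blast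
  qed
  have ann: "b \<odot>\<^bsub>\<Omega>\<^esub> ?s = \<zero>\<^bsub>\<Omega>\<^esub> \<longleftrightarrow> b \<in> \<mm>" if b: "b \<in> carrier R" for b
    unfolding smult_s[OF b] e0[symmetric] inj_on_eq_iff[OF inj kc[OF b] k.M.zero_closed] by (rule residue_module(2)[OF b])
  show "direct_summand R (carrier \<Omega>) \<Omega>"
    unfolding direct_summand_def
  proof (intro conjI exI[of _ "{\<zero>\<^bsub>\<Omega>\<^esub>}"])
    show "submodule (carrier \<Omega>) R \<Omega>" by (rule \<Omega>.carrier_is_submodule)
    show "submodule {\<zero>\<^bsub>\<Omega>\<^esub>} R \<Omega>" by (rule \<Omega>.submoduleI') auto
    show "carrier \<Omega> \<inter> {\<zero>\<^bsub>\<Omega>\<^esub>} = {\<zero>\<^bsub>\<Omega>\<^esub>}" by auto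
    show "carrier \<Omega> <+>\<^bsub>\<Omega>\<^esub> {\<zero>\<^bsub>\<Omega>\<^esub>} = carrier \<Omega>" unfolding set_add_def' by auto
  qed
  show "carrier \<Omega> \<noteq> {\<zero>\<^bsub>\<Omega>\<^esub>}"
  proof
    assume "carrier \<Omega> = {\<zero>\<^bsub>\<Omega>\<^esub>}"
    then have "\<one> \<odot>\<^bsub>\<Omega>\<^esub> ?s = \<zero>\<^bsub>\<Omega>\<^esub>" using s by simp
    then show False using ann[OF one_closed] mm.prime_one by blast
  qed
  show "fin_gen_module R \<Omega>"
    unfolding fin_gen_module_def
  proof (intro conjI exI[of _ "{?s}"])
    show "{?s} \<subseteq> carrier \<Omega>" using s by simp
    have sum: "finsum \<Omega> (\<lambda>s. a s \<odot>\<^bsub>\<Omega>\<^esub> s) {?s} = a ?s \<odot>\<^bsub>\<Omega>\<^esub> ?s" if "a \<in> {?s} \<rightarrow> carrier R" for a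
      using that s \<Omega>.M.finsum_insert[of "{}" ?s "\<lambda>s. a s \<odot>\<^bsub>\<Omega>\<^esub> s"] by simp
    show "carrier \<Omega> = {finsum \<Omega> (\<lambda>s. a s \<odot>\<^bsub>\<Omega>\<^esub> s) {?s} | a. a \<in> {?s} \<rightarrow> carrier R}"
    proof
      show "carrier \<Omega> \<subseteq> {finsum \<Omega> (\<lambda>s. a s \<odot>\<^bsub>\<Omega>\<^esub> s) {?s} | a. a \<in> {?s} \<rightarrow> carrier R}"
      proof
        fix x assume "x \<in> carrier \<Omega>"
        then obtain b where b: "b \<in> carrier R" "x = b \<odot>\<^bsub>\<Omega>\<^esub> ?s" using gen by blast
        have "x = finsum \<Omega> (\<lambda>s. (\<lambda>_. b) s \<odot>\<^bsub>\<Omega>\<^esub> s) {?s}" by (subst sum) (use b in simp_all)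
        then show "x \<in> {finsum \<Omega> (\<lambda>s. a s \<odot>\<^bsub>\<Omega>\<^esub> s) {?s} | a. a \<in> {?s} \<rightarrow> carrier R}"
          using b(1) by (intro CollectI exI[of _ "\<lambda>_. b"] conjI) simp_all
      qed
      show "{finsum \<Omega> (\<lambda>s. a s \<odot>\<^bsub>\<Omega>\<^esub> s) {?s} | a. a \<in> {?s} \<rightarrow> carrier R} \<subseteq> carrier \<Omega>"
      proof
        fix x assume "x \<in> {finsum \<Omega> (\<lambda>s. a s \<odot>\<^bsub>\<Omega>\<^esub> s) {?s} | a. a \<in> {?s} \<rightarrow> carrier R}"
        then obtain a where a: "x = finsum \<Omega> (\<lambda>s. a s \<odot>\<^bsub>\<Omega>\<^esub> s) {?s}" "a \<in> {?s} \<rightarrow> carrier R" by blast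
        then have "x = a ?s \<odot>\<^bsub>\<Omega>\<^esub> ?s" "a ?s \<in> carrier R" using sum by auto
        then show "x \<in> carrier \<Omega>" using s by simp
      qed
    qed
  qed (simp_all add: \<Omega>M)
  obtain n J x where "regular_flag R {\<zero>} n J x" using regular_flag_of_regular[OF reg] by blast
  then obtain A D a where free: "finite_free_resolution R \<mm> n A D a" using resolution_of_regular_flag by blast
  have "proj_dim R \<Omega> \<le> enat n" by (rule proj_dim_le_resolution[OF \<Omega>M s _ _ free]) (use gen ann in blast)+
  then show "proj_dim R \<Omega> < \<infinity>" by (rule order_le_less_trans) simp
qed

theorem corollary6p2p8:
  fixes A :: "('a, 'r) ring_scheme"
    and e :: "'a set \<Rightarrow> 'b"
    and I :: "nat \<Rightarrow> ('a, 'b) module"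
    and d :: "nat \<Rightarrow> 'b \<Rightarrow> 'b"
  assumes "noetherian_local_ring A"
    and "minimal_injective_resolution A (residue_module A) e I d"
  shows "regular_local_ring A \<longleftrightarrow>
    (\<exists>n N. let \<Omega> = cosyzygy (residue_module A) e I d n; S = \<Omega>\<lparr>carrier := N\<rparr> in
       direct_summand A N \<Omega> \<and> N \<noteq> {\<zero>\<^bsub>\<Omega>\<^esub>} \<and> fin_gen_module A S \<and> proj_dim A S < \<infinity>)"
proof -
  interpret noetherian_local_ring A by (rule assms(1))
  show ?thesis
  proof
    define \<Omega> where "\<Omega> = cosyzygy (residue_module A) e I d 0"
    assume "regular_local_ring A"
    note * = regular_zeroth_cosyzygy[OF this assms(2) \<Omega>_def]
    have "\<Omega>\<lparr>carrier := carrier \<Omega>\<rparr> = \<Omega>" by simp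
    then show "\<exists>n N. let \<Omega> = cosyzygy (residue_module A) e I d n; S = \<Omega>\<lparr>carrier := N\<rparr> in
       direct_summand A N \<Omega> \<and> N \<noteq> {\<zero>\<^bsub>\<Omega>\<^esub>} \<and> fin_gen_module A S \<and> proj_dim A S < \<infinity>"
      unfolding Let_def using * \<Omega>_def by (intro exI[of _ 0] exI[of _ "carrier \<Omega>"]) simp
  next
    assume "\<exists>n N. let \<Omega> = cosyzygy (residue_module A) e I d n; S = \<Omega>\<lparr>carrier := N\<rparr> in
       direct_summand A N \<Omega> \<and> N \<noteq> {\<zero>\<^bsub>\<Omega>\<^esub>} \<and> fin_gen_module A S \<and> proj_dim A S < \<infinity>"
    then show "regular_local_ring A"
      unfolding Let_def using regular_of_cosyzygy_summand[OF assms(2) refl refl] by blast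
  qed
qed

end
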